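(* Let $N^n$, $n\geq 3$, be an $n$-dimensional submanifold of the Riemannian product $\widetilde{M}^{p+q}=M_1^p(c)\times M_2^q(-c)$, where $p,q\geq 2$, $c\neq 0$, and $M_1^p(c)$ and $M_2^q(-c)$ are real space forms of dimensions $p$ and $q$ and constant sectional curvatures $c$ and $-c$, respectively. Then $$\rho+\rho^\perp\leq\|H\|^2+\frac{2c}{n(p+q-2)}\left[(p-1)\lambda-(q-1)(n-\lambda)\right]-\frac{c(p-q)}{p+q-2},$$ where $\lambda=\sum_{j=1}^n\|(\pi_1)_*e_j\|^2$ for a local orthonormal tangent frame $\{e_j\}_{1\le j\le n}$ on $N^n$ and $\pi_1:\widetilde{M}^{p+q}\to M_1^p(c)$ is the projection on the first component.
   Context: $\widetilde M^{p+q}$ carries the product metric $\widetilde g=g_1+g_2$. $N^n$ carries the induced metric; $h$ is the second fundamental form and $H=\frac1n\operatorname{trace}h$ the mean curvature vector. With $m=p+q$ and $\{\upsilon_r\}_{1\le r\le m-n}$ a local orthonormal normal frame, $\rho=\frac{2}{n(n-1)}\sum_{1\le i<j\le n}\sigma(e_i\wedge e_j)$, where $\sigma$ is the sectional curvature of $N^n$, and $\rho^\perp=\frac{2}{n(n-1)}\sqrt{\sum_{1\le i<j\le n}\sum_{1\le r<s\le m-n}\left(R^\perp(e_i,e_j,\upsilon_r,\upsilon_s)\right)^2}$, where $R^\perp$ is the curvature tensor of the normal connection. *)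

theory Defs
  imports "HOL-Analysis.Analysis"
begin

section \<open>Smooth maps between open subsets of Euclidean spaces\<close>

primrec Ck_on :: "nat \<Rightarrow> 'a::euclidean_space set \<Rightarrow> ('a \<Rightarrow> 'b::euclidean_space) \<Rightarrow> bool" where
  "Ck_on 0 S f \<longleftrightarrow> continuous_on S f"
| "Ck_on (Suc k) S f \<longleftrightarrow>
     (\<forall>x\<in>S. f differentiable (at x)) \<and> (\<forall>v. Ck_on k S (\<lambda>x. frechet_derivative f (at x) v))"

text \<open>Only used for open sets.\<close>

definition smooth_on :: "'a::euclidean_space set \<Rightarrow> ('a \<Rightarrow> 'b::euclidean_space) \<Rightarrow> bool" where
  "smooth_on S f \<longleftrightarrow> (\<forall>k. Ck_on k S f)"

abbreviation differential ::
  "('a::euclidean_space \<Rightarrow> 'b::euclidean_space) \<Rightarrow> 'a \<Rightarrow> 'a \<Rightarrow> 'b" where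
  "differential f u \<equiv> frechet_derivative f (at u)"

section \<open>Smooth and Riemannian manifolds\<close>

text \<open>
  A manifold modelled on the Euclidean space \<open>'a\<close> (so of dimension \<open>DIM('a)\<close>) is a topological
  space with an indexed atlas. The atlas need not be maximal. The inner product of \<open>'a\<close> plays
  no role.
\<close>

record ('x, 'i, 'a) manifold =
  mtop :: "'x topology"
  indices :: "'i set"
  chart_dom :: "'i \<Rightarrow> 'x set"
  chart_map :: "'i \<Rightarrow> 'x \<Rightarrow> 'a"

text \<open>
  A metric is given by its components in each chart: \<open>metric_in M i u v w\<close> is
  \<open>\<Sum>ab. g\<^sub>a\<^sub>b(u) v\<^sup>a w\<^sup>b\<close> in the chart \<open>i\<close>, where \<open>u\<close> is a coordinate point and \<open>v\<close>, \<open>w\<close> are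
  coordinate vectors.
\<close>

record ('x, 'i, 'a) riemannian = "('x, 'i, 'a) manifold" +
  metric_in :: "'i \<Rightarrow> 'a \<Rightarrow> 'a \<Rightarrow> 'a \<Rightarrow> real"

definition chart_img :: "('x, 'i, 'a, 'm) manifold_scheme \<Rightarrow> 'i \<Rightarrow> 'a set" where
  "chart_img M i = chart_map M i ` chart_dom M i"

definition chart_inv :: "('x, 'i, 'a, 'm) manifold_scheme \<Rightarrow> 'i \<Rightarrow> 'a \<Rightarrow> 'x" where
  "chart_inv M i = inv_into (chart_dom M i) (chart_map M i)"

text \<open>The coordinate expression of a map. It is meaningful on \<open>local_dom\<close>.\<close>

definition local_rep ::
  "('x, 'i, 'a, 'm) manifold_scheme \<Rightarrow> 'i \<Rightarrow> ('y, 'j, 'b, 'k) manifold_scheme \<Rightarrow> 'j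
    \<Rightarrow> ('x \<Rightarrow> 'y) \<Rightarrow> 'a \<Rightarrow> 'b" where
  "local_rep M i N j F = (\<lambda>u. chart_map N j (F (chart_inv M i u)))"

definition local_dom ::
  "('x, 'i, 'a, 'm) manifold_scheme \<Rightarrow> 'i \<Rightarrow> ('y, 'j, 'b, 'k) manifold_scheme \<Rightarrow> 'j
    \<Rightarrow> ('x \<Rightarrow> 'y) \<Rightarrow> 'a set" where
  "local_dom M i N j F = chart_map M i ` (chart_dom M i \<inter> F -` chart_dom N j)"

definition smooth_manifold :: "('x, 'i, 'a::euclidean_space, 'm) manifold_scheme \<Rightarrow> bool" where
  "smooth_manifold M \<longleftrightarrow>
     Hausdorff_space (mtop M) \<and> second_countable (mtop M) \<and>
     (\<Union>i\<in>indices M. chart_dom M i) = topspace (mtop M) \<and>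
     (\<forall>i\<in>indices M. openin (mtop M) (chart_dom M i) \<and> open (chart_img M i) \<and>
        homeomorphic_map (subtopology (mtop M) (chart_dom M i)) (top_of_set (chart_img M i))
          (chart_map M i)) \<and>
     (\<forall>i\<in>indices M. \<forall>j\<in>indices M.
        smooth_on (local_dom M i M j (\<lambda>x. x)) (local_rep M i M j (\<lambda>x. x)))"

definition riemannian_manifold :: "('x, 'i, 'a::euclidean_space, 'm) riemannian_scheme \<Rightarrow> bool" where
  "riemannian_manifold M \<longleftrightarrow>
     smooth_manifold M \<and>
     (\<forall>i\<in>indices M. \<forall>u\<in>chart_img M i.
        bilinear (metric_in M i u) \<and>
        (\<forall>v w. metric_in M i u v w = metric_in M i u w v) \<and>
        (\<forall>v. v \<noteq> 0 \<longrightarrow> 0 < metric_in M i u v v)) \<and>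
     (\<forall>i\<in>indices M. \<forall>v w. smooth_on (chart_img M i) (\<lambda>u. metric_in M i u v w)) \<and>
     (\<forall>i\<in>indices M. \<forall>j\<in>indices M. \<forall>u\<in>local_dom M i M j (\<lambda>x. x). \<forall>v w.
        metric_in M i u v w =
          metric_in M j (local_rep M i M j (\<lambda>x. x) u)
            (differential (local_rep M i M j (\<lambda>x. x)) u v)
            (differential (local_rep M i M j (\<lambda>x. x)) u w))"

text \<open>The Riemannian product, with its product charts and the metric \<open>g\<^sub>1 + g\<^sub>2\<close>.\<close>

definition riemannian_product ::
  "('x, 'i, 'a) riemannian \<Rightarrow> ('y, 'j, 'b) riemannian \<Rightarrow> ('x \<times> 'y, 'i \<times> 'j, 'a \<times> 'b) riemannian" where
  "riemannian_product M1 M2 =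
     \<lparr> mtop = prod_topology (mtop M1) (mtop M2),
       indices = indices M1 \<times> indices M2,
       chart_dom = (\<lambda>(i, j). chart_dom M1 i \<times> chart_dom M2 j),
       chart_map = (\<lambda>(i, j) (x, y). (chart_map M1 i x, chart_map M2 j y)),
       metric_in = (\<lambda>(i, j) u v w. metric_in M1 i (fst u) (fst v) (fst w)
                                 + metric_in M2 j (snd u) (snd v) (snd w)) \<rparr>"

text \<open>
  Submanifolds are immersed. An embedded submanifold is the case where \<open>F\<close> is an inclusion map.
\<close>

definition immersed_submanifold ::
  "('z, 'k, 'n::euclidean_space, 'u) manifold_scheme \<Rightarrow> ('x, 'i, 'a::euclidean_space, 'm) manifold_scheme
    \<Rightarrow> ('z \<Rightarrow> 'x) \<Rightarrow> bool" where
  "immersed_submanifold N M F \<longleftrightarrow>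
     smooth_manifold N \<and> smooth_manifold M \<and> continuous_map (mtop N) (mtop M) F \<and>
     (\<forall>k\<in>indices N. \<forall>i\<in>indices M.
        smooth_on (local_dom N k M i F) (local_rep N k M i F) \<and>
        (\<forall>u\<in>local_dom N k M i F. inj (differential (local_rep N k M i F) u)))"

section \<open>Connections and curvature in coordinates\<close>

text \<open>
  In this section \<open>g\<close> is a metric on an open subset of \<open>'a\<close>, given as \<open>g u v w\<close> like
  \<open>metric_in M i\<close>, and \<open>f\<close> is a map from an open subset of \<open>'n\<close> to the domain of \<open>g\<close>. A vector
  field is a vector-valued function of the coordinate point, and so is a vector field along \<open>f\<close>.
  For the identity map \<open>f\<close> these notions are the ones of \<open>g\<close> itself.
\<close>

text \<open>The Koszul formula for coordinate vector fields, whose brackets vanish.\<close>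

definition christoffel :: "('a::euclidean_space \<Rightarrow> 'a \<Rightarrow> 'a \<Rightarrow> real) \<Rightarrow> 'a \<Rightarrow> 'a \<Rightarrow> 'a \<Rightarrow> 'a" where
  "christoffel g u v w = (THE b. \<forall>z. 2 * g u b z =
      differential (\<lambda>y. g y w z) u v
    + differential (\<lambda>y. g y v z) u w
    - differential (\<lambda>y. g y v w) u z)"

text \<open>The covariant derivative \<open>\<nabla>\<^sub>X \<xi>\<close>, for the Levi-Civita connection of \<open>g\<close>, of a field \<open>\<xi>\<close> along \<open>f\<close>.\<close>

definition cov_deriv ::
  "('a::euclidean_space \<Rightarrow> 'a \<Rightarrow> 'a \<Rightarrow> real) \<Rightarrow> ('n::euclidean_space \<Rightarrow> 'a)
    \<Rightarrow> ('n \<Rightarrow> 'n) \<Rightarrow> ('n \<Rightarrow> 'a) \<Rightarrow> 'n \<Rightarrow> 'a" where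
  "cov_deriv g f X \<xi> u =
     differential \<xi> u (X u) + christoffel g (f u) (differential f u (X u)) (\<xi> u)"

definition lie_bracket :: "('n::euclidean_space \<Rightarrow> 'n) \<Rightarrow> ('n \<Rightarrow> 'n) \<Rightarrow> 'n \<Rightarrow> 'n" where
  "lie_bracket X Y u = differential Y u (X u) - differential X u (Y u)"

definition curvature_op ::
  "(('n::euclidean_space \<Rightarrow> 'n) \<Rightarrow> ('n \<Rightarrow> 'a::euclidean_space) \<Rightarrow> 'n \<Rightarrow> 'a)
    \<Rightarrow> ('n \<Rightarrow> 'n) \<Rightarrow> ('n \<Rightarrow> 'n) \<Rightarrow> ('n \<Rightarrow> 'a) \<Rightarrow> 'n \<Rightarrow> 'a" where
  "curvature_op D X Y \<xi> u =
     D X (D Y \<xi>) u - D Y (D X \<xi>) u - D (lie_bracket X Y) \<xi> u"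

text \<open>
  The sectional curvature at \<open>u\<close> of the plane spanned by \<open>v\<close> and \<open>w\<close>. These vectors are
  extended to vector fields with constant coefficients.
\<close>

definition sectional_curvature ::
  "('a::euclidean_space \<Rightarrow> 'a \<Rightarrow> 'a \<Rightarrow> real) \<Rightarrow> 'a \<Rightarrow> 'a \<Rightarrow> 'a \<Rightarrow> real" where
  "sectional_curvature g u v w =
     g u (curvature_op (cov_deriv g (\<lambda>y. y)) (\<lambda>_. v) (\<lambda>_. w) (\<lambda>_. w) u) v
       / (g u v v * g u w w - (g u v w)\<^sup>2)"

definition real_space_form :: "real \<Rightarrow> ('x, 'i, 'a::euclidean_space, 'm) riemannian_scheme \<Rightarrow> bool" where
  "real_space_form c M \<longleftrightarrow>
     riemannian_manifold M \<and>
     (\<forall>i\<in>indices M. \<forall>u\<in>chart_img M i. \<forall>v w. v \<noteq> w \<and> independent {v, w} \<longrightarrow>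
        sectional_curvature (metric_in M i) u v w = c)"

section \<open>Submanifold geometry in coordinates\<close>

text \<open>From now on \<open>f\<close> is the coordinate expression of an immersion into the domain of \<open>g\<close>.\<close>

definition induced_metric ::
  "('a::euclidean_space \<Rightarrow> 'a \<Rightarrow> 'a \<Rightarrow> real) \<Rightarrow> ('n::euclidean_space \<Rightarrow> 'a)
    \<Rightarrow> 'n \<Rightarrow> 'n \<Rightarrow> 'n \<Rightarrow> real" where
  "induced_metric g f u v w = g (f u) (differential f u v) (differential f u w)"

definition normal_space ::
  "('a::euclidean_space \<Rightarrow> 'a \<Rightarrow> 'a \<Rightarrow> real) \<Rightarrow> ('n::euclidean_space \<Rightarrow> 'a) \<Rightarrow> 'n \<Rightarrow> 'a set" where
  "normal_space g f u = {\<xi>. \<forall>v. g (f u) \<xi> (differential f u v) = 0}"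

definition normal_part ::
  "('a::euclidean_space \<Rightarrow> 'a \<Rightarrow> 'a \<Rightarrow> real) \<Rightarrow> ('n::euclidean_space \<Rightarrow> 'a) \<Rightarrow> 'n \<Rightarrow> 'a \<Rightarrow> 'a" where
  "normal_part g f u w = (THE \<xi>. \<xi> \<in> normal_space g f u \<and> w - \<xi> \<in> range (differential f u))"

definition second_fundamental_form ::
  "('a::euclidean_space \<Rightarrow> 'a \<Rightarrow> 'a \<Rightarrow> real) \<Rightarrow> ('n::euclidean_space \<Rightarrow> 'a)
    \<Rightarrow> ('n \<Rightarrow> 'n) \<Rightarrow> ('n \<Rightarrow> 'n) \<Rightarrow> 'n \<Rightarrow> 'a" where
  "second_fundamental_form g f X Y u =
     normal_part g f u (cov_deriv g f X (\<lambda>y. differential f y (Y y)) u)"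

definition normal_connection ::
  "('a::euclidean_space \<Rightarrow> 'a \<Rightarrow> 'a \<Rightarrow> real) \<Rightarrow> ('n::euclidean_space \<Rightarrow> 'a)
    \<Rightarrow> ('n \<Rightarrow> 'n) \<Rightarrow> ('n \<Rightarrow> 'a) \<Rightarrow> 'n \<Rightarrow> 'a" where
  "normal_connection g f X \<xi> u = normal_part g f u (cov_deriv g f X \<xi> u)"

definition normal_curvature ::
  "('a::euclidean_space \<Rightarrow> 'a \<Rightarrow> 'a \<Rightarrow> real) \<Rightarrow> ('n::euclidean_space \<Rightarrow> 'a)
    \<Rightarrow> ('n \<Rightarrow> 'n) \<Rightarrow> ('n \<Rightarrow> 'n) \<Rightarrow> ('n \<Rightarrow> 'a) \<Rightarrow> ('n \<Rightarrow> 'a) \<Rightarrow> 'n \<Rightarrow> real" where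
  "normal_curvature g f X Y \<xi> \<eta> u =
     g (f u) (curvature_op (normal_connection g f) X Y \<xi> u) (\<eta> u)"

definition orthonormal_tangent_frame ::
  "('a::euclidean_space \<Rightarrow> 'a \<Rightarrow> 'a \<Rightarrow> real) \<Rightarrow> ('n::euclidean_space \<Rightarrow> 'a) \<Rightarrow> 'n set
    \<Rightarrow> (nat \<Rightarrow> 'n \<Rightarrow> 'n) \<Rightarrow> bool" where
  "orthonormal_tangent_frame g f W e \<longleftrightarrow>
     (\<forall>i\<in>{1..DIM('n)}. smooth_on W (e i)) \<and>
     (\<forall>u\<in>W. \<forall>i\<in>{1..DIM('n)}. \<forall>j\<in>{1..DIM('n)}.
        induced_metric g f u (e i u) (e j u) = (if i = j then 1 else 0))"

definition orthonormal_normal_frame ::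
  "('a::euclidean_space \<Rightarrow> 'a \<Rightarrow> 'a \<Rightarrow> real) \<Rightarrow> ('n::euclidean_space \<Rightarrow> 'a) \<Rightarrow> 'n set
    \<Rightarrow> (nat \<Rightarrow> 'n \<Rightarrow> 'a) \<Rightarrow> bool" where
  "orthonormal_normal_frame g f W \<nu> \<longleftrightarrow>
     (\<forall>r\<in>{1..DIM('a) - DIM('n)}. smooth_on W (\<nu> r)) \<and>
     (\<forall>u\<in>W. \<forall>r\<in>{1..DIM('a) - DIM('n)}. \<nu> r u \<in> normal_space g f u) \<and>
     (\<forall>u\<in>W. \<forall>r\<in>{1..DIM('a) - DIM('n)}. \<forall>s\<in>{1..DIM('a) - DIM('n)}.
        g (f u) (\<nu> r u) (\<nu> s u) = (if r = s then 1 else 0))"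

definition mean_curvature_vector ::
  "('a::euclidean_space \<Rightarrow> 'a \<Rightarrow> 'a \<Rightarrow> real) \<Rightarrow> ('n::euclidean_space \<Rightarrow> 'a)
    \<Rightarrow> (nat \<Rightarrow> 'n \<Rightarrow> 'n) \<Rightarrow> 'n \<Rightarrow> 'a" where
  "mean_curvature_vector g f e u =
     (1 / real DIM('n)) *\<^sub>R (\<Sum>i=1..DIM('n). second_fundamental_form g f (e i) (e i) u)"

definition normalized_scalar_curvature ::
  "('a::euclidean_space \<Rightarrow> 'a \<Rightarrow> 'a \<Rightarrow> real) \<Rightarrow> ('n::euclidean_space \<Rightarrow> 'a)
    \<Rightarrow> (nat \<Rightarrow> 'n \<Rightarrow> 'n) \<Rightarrow> 'n \<Rightarrow> real" where
  "normalized_scalar_curvature g f e u =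
     2 / (real DIM('n) * (real DIM('n) - 1)) *
     (\<Sum>i=1..DIM('n). \<Sum>j\<in>{i<..DIM('n)}.
        sectional_curvature (induced_metric g f) u (e i u) (e j u))"

definition normalized_normal_scalar_curvature ::
  "('a::euclidean_space \<Rightarrow> 'a \<Rightarrow> 'a \<Rightarrow> real) \<Rightarrow> ('n::euclidean_space \<Rightarrow> 'a)
    \<Rightarrow> (nat \<Rightarrow> 'n \<Rightarrow> 'n) \<Rightarrow> (nat \<Rightarrow> 'n \<Rightarrow> 'a) \<Rightarrow> 'n \<Rightarrow> real" where
  "normalized_normal_scalar_curvature g f e \<nu> u =
     2 / (real DIM('n) * (real DIM('n) - 1)) *
     sqrt (\<Sum>i=1..DIM('n). \<Sum>j\<in>{i<..DIM('n)}.
           \<Sum>r=1..DIM('a) - DIM('n). \<Sum>s\<in>{r<..DIM('a) - DIM('n)}.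
             (normal_curvature g f (e i) (e j) (\<nu> r) (\<nu> s) u)\<^sup>2)"

end

theory Submission
  imports Defs
begin

text \<open>
  The product is conformally flat: for tangent and normal vectors \<open>v\<close>, \<open>\<nu>\<close> the components in the two
  factors satisfy \<open>g\<^sub>1(v, \<nu>) = - g\<^sub>2(v, \<nu>)\<close>, so the ambient curvature drops out of the Ricci equation, while
  in the Gauss equation it contributes \<open>c (a\<^sub>i + a\<^sub>j - 1)\<close> with \<open>a\<^sub>i = \<parallel>(\<pi>\<^sub>1)\<^sub>*e\<^sub>i\<parallel>\<^sup>2\<close>. What remains is the inequality
  \<open>\<Sum>\<^sub>r\<^sub>s \<parallel>[B\<^sub>r, B\<^sub>s]\<parallel>\<^sup>2 \<le> (\<Sum>\<^sub>r \<parallel>B\<^sub>r\<parallel>\<^sup>2)\<^sup>2\<close> for symmetric matrices (the DDVV inequality of Ge--Tang and Lu), applied to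
  the traceless shape operators.

  After a rotation of the index \<open>r\<close> the \<open>B\<^sub>r\<close> are orthogonal. For orthonormal \<open>B\<^sub>s\<close>, \<open>s \<in> S\<close>, one diagonalises a
  fixed \<open>B\<^sub>r\<close>: since the pairs of eigenvalues differing by more than \<open>1\<close> form a star, Bessel's inequality gives
  \<open>\<Sum>\<^sub>s \<parallel>[B\<^sub>r, B\<^sub>s]\<parallel>\<^sup>2 \<le> card S\<close>. Writing the vector of the \<open>\<parallel>B\<^sub>r\<parallel>\<^sup>2\<close> as a positive combination of indicators of a
  decreasing chain of sets \<open>S\<close> yields the general case.
\<close>


section \<open>The DDVV inequality\<close>

text \<open>The exact constants matter. Summed over the frame, the Gauss equation expresses
  \<open>n (n - 1)\<close> times the normalized scalar curvature as a curvature term plus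
  \<open>n^2 |H|^2 - |h|^2\<close>. The commutator inequality bounds \<open>n (n - 1)\<close> times
  the normal scalar curvature by the norm \<open>|h|^2 - n |H|^2\<close> of the traceless form. With
  constant 1 in that inequality the two \<open>|h|^2\<close> cancel, and \<open>|H|^2\<close> is
  left with coefficient 1. The threshold 1 for eigenvalue differences has the same source. Each
  weight \<open>(\<eta> p - \<eta> q)^2\<close> is split into 1 plus an excess. The ones add up to
  \<open>card S - 1\<close>, because a matrix commutes with itself, and this leaves room for a total
  excess of 1. On the geometric side the obstacle is regularity. Christoffel symbols and normal
  parts are definite descriptions, so differentiability in the base point has to be established
  before curvature can be computed. For the former it comes from the Koszul equation, for the latter
  from an explicit formula in the orthonormal frame.\<close>

definition orthonormal_set :: "'a::euclidean_space set \<Rightarrow> bool" where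
  "orthonormal_set B \<longleftrightarrow> finite B \<and> span B = UNIV \<and> (\<forall>a\<in>B. \<forall>b\<in>B. a \<bullet> b = (if a = b then 1 else 0))"

section \<open>Orthonormal eigenbases of self-adjoint maps\<close>

text \<open>Rayleigh quotient: a maximiser \<open>v\<close> of \<open>T x \<bullet> x\<close> on the
  unit sphere of \<open>S\<close> is critical, and perturbing it in the direction of the defect
  \<open>w = T v - l *\<^sub>R v\<close> forces \<open>w = 0\<close>.\<close>

lemma self_adjoint_eigenvector:
  fixes T :: "'a::euclidean_space \<Rightarrow> 'a"
  assumes "linear T" and sym: "\<And>x y. T x \<bullet> y = x \<bullet> T y"
    and S: "subspace S" "T ` S \<subseteq> S" "S \<noteq> {0}"
  obtains v l where "v \<in> S" "norm v = 1" "T v = l *\<^sub>R v"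
proof -
  interpret T: linear T by fact
  let ?K = "S \<inter> sphere 0 1"
  have "compact ?K"
    using closed_subspace[OF S(1)] by (simp add: closed_Int_compact)
  moreover obtain a where "a \<in> S" "a \<noteq> 0" using S(1,3) subspace_0 by blast
  then have "(1 / norm a) *\<^sub>R a \<in> ?K" using S(1) by (simp add: subspace_scale)
  then have "?K \<noteq> {}" by blast
  moreover have "continuous_on ?K (\<lambda>x. T x \<bullet> x)"
    using linear_continuous_on[OF linear_conv_bounded_linear[THEN iffD1, OF \<open>linear T\<close>]]
    by (intro continuous_intros)
  ultimately obtain v where v: "v \<in> ?K" and max: "\<And>x. x \<in> ?K \<Longrightarrow> T x \<bullet> x \<le> T v \<bullet> v"
    using continuous_attains_sup[of ?K "\<lambda>x. T x \<bullet> x"] by blast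
  define l where "l = T v \<bullet> v"
  have vS: "v \<in> S" and nv: "norm v = 1" and vv: "v \<bullet> v = 1"
    using v by (auto simp: norm_eq_1)
  have ray: "T x \<bullet> x \<le> l * (x \<bullet> x)" if "x \<in> S" for x
  proof (cases "x = 0")
    case True then show ?thesis by (simp add: T.zero)
  next
    case False
    have "(1 / norm x) *\<^sub>R x \<in> ?K" using False that S(1) by (simp add: subspace_scale)
    from max[OF this] have "(T x \<bullet> x) / (norm x)\<^sup>2 \<le> l"
      by (simp add: T.scaleR l_def power2_eq_square field_simps)
    then show ?thesis using False by (simp add: field_simps power2_norm_eq_inner)
  qed
  define w where "w = T v - l *\<^sub>R v"
  have wS: "w \<in> S" unfolding w_def using S(1,2) vS by (auto intro!: subspace_diff subspace_scale)
  have vw: "v \<bullet> w = 0" by (simp add: w_def inner_diff_right vv l_def inner_commute)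
  have Tvw: "T v \<bullet> w = w \<bullet> w"
  proof -
    have "w \<bullet> w = T v \<bullet> w - l * (v \<bullet> w)"
      by (subst (1) w_def) (simp only: inner_diff_left inner_scaleR_left)
    then show ?thesis using vw by simp
  qed
  have ineq: "2 * t * (w \<bullet> w) + t\<^sup>2 * (T w \<bullet> w) \<le> l * t\<^sup>2 * (w \<bullet> w)" for t
  proof -
    have "v + t *\<^sub>R w \<in> S" using S(1) vS wS by (simp add: subspace_add subspace_scale)
    from ray[OF this]
    have "T v \<bullet> v + t * (T v \<bullet> w) + t * (T w \<bullet> v) + t * (t * (T w \<bullet> w)) \<le>
       l * (v \<bullet> v + t * (v \<bullet> w) + t * (w \<bullet> v) + t * (t * (w \<bullet> w)))"
      by (simp add: T.add T.scaleR inner_add_left inner_add_right algebra_simps)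
    moreover have "T w \<bullet> v = w \<bullet> w" using sym[of w v] Tvw by (simp add: inner_commute)
    ultimately show ?thesis
      using vw Tvw vv inner_commute[of v w] l_def by (simp add: power2_eq_square algebra_simps)
  qed
  have "w \<bullet> w = 0"
  proof (rule ccontr)
    assume "w \<bullet> w \<noteq> 0"
    then have pos: "w \<bullet> w > 0" by (simp add: inner_gt_zero_iff)
    define C where "C = l * (w \<bullet> w) - T w \<bullet> w"
    have *: "2 * t * (w \<bullet> w) \<le> t\<^sup>2 * C" for t using ineq[of t] by (simp add: C_def algebra_simps)
    \<comment> \<open>So small that the quadratic term \<open>t^2 * C\<close> cannot make up for the
      linear gain \<open>2 * t * (w \<bullet> w)\<close>; the added 1 keeps the denominator
      positive.\<close>
    define t where "t = (w \<bullet> w) / (\<bar>C\<bar> + 1)"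
    have t: "t > 0" using pos by (simp add: t_def)
    have "2 * (w \<bullet> w) \<le> t * C" using *[of t] t by (simp add: power2_eq_square)
    also have "\<dots> \<le> t * (\<bar>C\<bar> + 1)" using t by (intro mult_left_mono) auto
    also have "\<dots> = w \<bullet> w" by (simp add: t_def)
    finally show False using pos by simp
  qed
  then have "T v = l *\<^sub>R v" by (simp add: w_def)
  then show ?thesis using that vS nv by blast
qed

text \<open>Split off one eigenvector; by self-adjointness its orthogonal complement in
  \<open>S\<close> is again invariant, and its dimension is smaller.\<close>

lemma self_adjoint_eigenbasis_subspace:
  fixes T :: "'a::euclidean_space \<Rightarrow> 'a"
  assumes "linear T" and sym: "\<And>x y. T x \<bullet> y = x \<bullet> T y"
  assumes "subspace S" "T ` S \<subseteq> S"
  shows "\<exists>B\<subseteq>S. finite B \<and> span B = S \<and> (\<forall>a\<in>B. \<forall>b\<in>B. a \<bullet> b = (if a = b then 1 else 0)) \<and>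
    (\<forall>b\<in>B. \<exists>l. T b = l *\<^sub>R b)"
  using assms(3,4)
proof (induction "dim S" arbitrary: S rule: less_induct)
  case less
  show ?case
  proof (cases "S = {0}")
    case True then show ?thesis by (intro exI[of _ "{}"]) auto
  next
    case False
    obtain v l where v: "v \<in> S" "norm v = 1" "T v = l *\<^sub>R v"
      using self_adjoint_eigenvector[OF assms(1) sym less.prems False] by blast
    have vv: "v \<bullet> v = 1" using v(2) by (simp add: norm_eq_1)
    define S' where "S' = {x \<in> S. v \<bullet> x = 0}"
    have S': "subspace S'" using less.prems(1)
      by (auto simp: S'_def subspace_def inner_add_right)
    have "v \<notin> S'" using vv by (simp add: S'_def)
    then have "S' \<subset> S" using v(1) unfolding S'_def by blast
    then have "dim S' < dim S"
      using S' less.prems(1) by (metis dim_psubset span_eq_iff)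
    moreover have "T ` S' \<subseteq> S'"
    proof
      fix y assume "y \<in> T ` S'"
      then obtain x where x: "x \<in> S'" "y = T x" by blast
      have "v \<bullet> T x = T v \<bullet> x" by (simp add: sym)
      also have "\<dots> = 0" using x by (simp add: v(3) S'_def)
      finally show "y \<in> S'" using x less.prems(2) by (auto simp: S'_def)
    qed
    ultimately obtain B where B: "B \<subseteq> S'" "finite B" "span B = S'"
      "\<forall>a\<in>B. \<forall>b\<in>B. a \<bullet> b = (if a = b then 1 else 0)" "\<forall>b\<in>B. \<exists>l. T b = l *\<^sub>R b"
      using less.hyps[of S'] S' by blast
    have vB: "v \<bullet> b = 0" "b \<bullet> v = 0" if "b \<in> B" for b
      using that B(1) by (auto simp: S'_def inner_commute)
    have "span (insert v B) = S"
    proof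
      show "span (insert v B) \<subseteq> S"
        using B(1) v(1) less.prems(1) by (intro span_minimal) (auto simp: S'_def)
      show "S \<subseteq> span (insert v B)"
      proof
        fix x assume x: "x \<in> S"
        have "x - (v \<bullet> x) *\<^sub>R v \<in> S'" using x v(1) less.prems(1) vv
          by (auto simp: S'_def inner_diff_right intro!: subspace_diff subspace_scale)
        then have "x - (v \<bullet> x) *\<^sub>R v \<in> span B" using B(3) by simp
        then show "x \<in> span (insert v B)" using span_insert by blast
      qed
    qed
    moreover have "insert v B \<subseteq> S" using B(1) v(1) by (auto simp: S'_def)
    moreover have "\<forall>a\<in>insert v B. \<forall>b\<in>insert v B. a \<bullet> b = (if a = b then 1 else 0)"
      using B(4) vB vv \<open>v \<notin> S'\<close> B(1) by auto
    ultimately show ?thesis using B(2,5) v(3)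
      by (intro exI[of _ "insert v B"]) auto
  qed
qed

lemma self_adjoint_eigenbasis:
  fixes T :: "'a::euclidean_space \<Rightarrow> 'a"
  assumes "linear T" "\<And>x y. T x \<bullet> y = x \<bullet> T y"
  obtains B l where "orthonormal_set B" "\<And>b. b \<in> B \<Longrightarrow> T b = l b *\<^sub>R b"
proof -
  obtain B where B: "finite B" "span B = (UNIV :: 'a set)"
    "\<forall>a\<in>B. \<forall>b\<in>B. a \<bullet> b = (if a = b then 1 else 0)" "\<forall>b\<in>B. \<exists>l. T b = l *\<^sub>R b"
    using self_adjoint_eigenbasis_subspace[OF assms, of UNIV] by auto
  then obtain l where "\<forall>b\<in>B. T b = l b *\<^sub>R b" by metis
  with B that[of B l] show ?thesis by (auto simp: orthonormal_set_def)
qed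

lemma orthonormal_set_expand:
  assumes "orthonormal_set B"
  shows "(\<Sum>b\<in>B. (x \<bullet> b) *\<^sub>R b) = x"
proof (rule orthonormal_basis_expand)
  show "pairwise orthogonal B" "finite B" "x \<in> span B"
    using assms by (auto simp: orthonormal_set_def pairwise_def orthogonal_def)
  show "norm v = 1" if "v \<in> B" for v
    using assms that by (auto simp: orthonormal_set_def norm_eq_1)
qed

lemma orthonormal_set_inner:
  assumes "orthonormal_set B"
  shows "(\<Sum>b\<in>B. (x \<bullet> b) * (y \<bullet> b)) = x \<bullet> y"
proof -
  have "x \<bullet> y = (\<Sum>b\<in>B. (x \<bullet> b) *\<^sub>R b) \<bullet> y"
    by (simp add: orthonormal_set_expand[OF assms])
  then show ?thesis by (simp add: inner_sum_left inner_commute[of y])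
qed

lemma orthonormal_set_Basis: "orthonormal_set (Basis :: 'a::euclidean_space set)"
  by (auto simp: orthonormal_set_def inner_Basis)

text \<open>Frobenius products and squared commutator norms are traces of bilinear forms. This fact
  carries them over to an eigenbasis and also allows the index of the matrix family to be
  rotated.\<close>

lemma bilinear_trace_orthonormal:
  fixes \<phi> :: "'a::euclidean_space \<Rightarrow> 'a \<Rightarrow> real"
  assumes "bilinear \<phi>" and B: "orthonormal_set B" and C: "orthonormal_set C"
  shows "(\<Sum>b\<in>B. \<phi> b b) = (\<Sum>b\<in>C. \<phi> b b)"
proof -
  have fin: "finite B" "finite C" using B C by (auto simp: orthonormal_set_def)
  have "(\<Sum>b\<in>B. \<phi> b b) = (\<Sum>b\<in>B. \<phi> (\<Sum>c\<in>C. (b \<bullet> c) *\<^sub>R c) (\<Sum>d\<in>C. (b \<bullet> d) *\<^sub>R d))"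
    by (simp add: orthonormal_set_expand[OF C])
  also have "\<dots> = (\<Sum>b\<in>B. \<Sum>c\<in>C. \<Sum>d\<in>C. (b \<bullet> c) * (b \<bullet> d) * \<phi> c d)"
    using assms(1) by (simp add: bilinear_sum sum.cartesian_product[symmetric]
      bilinear_lmul bilinear_rmul mult.assoc)
  also have "\<dots> = (\<Sum>c\<in>C. \<Sum>d\<in>C. (\<Sum>b\<in>B. (c \<bullet> b) * (d \<bullet> b)) * \<phi> c d)"
  proof -
    have "(\<Sum>b\<in>B. \<Sum>c\<in>C. \<Sum>d\<in>C. (b \<bullet> c) * (b \<bullet> d) * \<phi> c d) =
      (\<Sum>c\<in>C. \<Sum>b\<in>B. \<Sum>d\<in>C. (b \<bullet> c) * (b \<bullet> d) * \<phi> c d)" by (rule sum.swap)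
    also have "\<dots> = (\<Sum>c\<in>C. \<Sum>d\<in>C. \<Sum>b\<in>B. (b \<bullet> c) * (b \<bullet> d) * \<phi> c d)"
      by (intro sum.cong refl sum.swap)
    finally show ?thesis by (simp add: sum_distrib_right inner_commute)
  qed
  also have "\<dots> = (\<Sum>c\<in>C. \<Sum>d\<in>C. (if c = d then \<phi> c d else 0))"
    using C by (intro sum.cong refl) (auto simp: orthonormal_set_inner[OF B] orthonormal_set_def)
  also have "\<dots> = (\<Sum>c\<in>C. \<phi> c c)" using fin by simp
  finally show ?thesis .
qed

section \<open>The commutator estimate for orthonormal symmetric matrices\<close>

text \<open>Here \<open>\<eta>\<close> stands for the spectrum of a matrix of Frobenius norm 1. The
  oriented pairs with difference above 1 all start at one point or all end at one point, and such a
  star has total excess at most 1. The 2 counts both orientations.\<close>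

lemma sum_pairs_max_diff_square_le:
  fixes \<eta> :: "'b \<Rightarrow> real"
  assumes "finite P" and le1: "(\<Sum>p\<in>P. (\<eta> p)\<^sup>2) \<le> 1"
  shows "(\<Sum>p\<in>P. \<Sum>q\<in>P. max 0 ((\<eta> p - \<eta> q)\<^sup>2 - 1)) \<le> 2"
proof -
  define E where "E = {(p, q) \<in> P \<times> P. \<eta> p - \<eta> q > 1}"
  have EP: "E \<subseteq> P \<times> P" and Eirr: "(p, p) \<notin> E" for p by (auto simp: E_def)
  have finE: "finite E" using assms(1) by (auto simp: E_def intro: finite_subset[of _ "P \<times> P"])
  have sub: "sum (\<lambda>p. (\<eta> p)\<^sup>2) A \<le> 1" if "A \<subseteq> P" for A
    using sum_mono2[OF assms(1) that, of "\<lambda>p. (\<eta> p)\<^sup>2"] le1 by simp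
  \<comment> \<open>With \<open>a\<close> the value at the centre, \<open>k\<close> leaves,
    \<open>s\<close> their sum and \<open>t\<close> their square sum,
    \<open>-2 a s \<le> a^2 + s^2\<close> and Cauchy-Schwarz \<open>s^2 \<le> k t\<close> give the
    bound \<open>(k + 1) (a^2 + t) - k\<close>, and \<open>a^2 + t \<le> 1\<close>.\<close>
  have star_bound: "(\<Sum>q\<in>J. (\<zeta> p - \<zeta> q)\<^sup>2 - 1) \<le> 1"
    if J: "J \<subseteq> P" "p \<in> P" "p \<notin> J" and \<zeta>: "\<And>q. (\<zeta> q)\<^sup>2 = (\<eta> q)\<^sup>2" for \<zeta> p J
  proof -
    have finJ: "finite J" using J assms(1) finite_subset by blast
    let ?k = "real (card J)" and ?s = "\<Sum>q\<in>J. \<zeta> q" and ?t = "\<Sum>q\<in>J. (\<zeta> q)\<^sup>2"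
    have le: "(\<zeta> p)\<^sup>2 + ?t \<le> 1"
      using sub[of "insert p J"] J finJ by (simp add: \<zeta>)
    have cs: "?s\<^sup>2 \<le> ?k * ?t" using sum_squared_le_sum_of_squares[of \<zeta> J] by (simp add: mult.commute)
    have "(\<Sum>q\<in>J. (\<zeta> p - \<zeta> q)\<^sup>2 - 1) = ?k * (\<zeta> p)\<^sup>2 - 2 * \<zeta> p * ?s + ?t - ?k"
      by (simp add: power2_diff sum.distrib sum_subtractf sum_distrib_left mult.assoc)
    also have "\<dots> \<le> ?k * (\<zeta> p)\<^sup>2 + (\<zeta> p)\<^sup>2 + ?s\<^sup>2 + ?t - ?k"
      using zero_le_power2[of "\<zeta> p + ?s"] by (simp add: power2_sum)
    also have "\<dots> \<le> (?k + 1) * ((\<zeta> p)\<^sup>2 + ?t) - ?k" using cs by (simp add: algebra_simps)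
    also have "\<dots> \<le> (?k + 1) * 1 - ?k" using le by (intro diff_right_mono mult_left_mono) auto
    finally show ?thesis by simp
  qed
  \<comment> \<open>Two disjoint pairs would each need a square sum above 1/2. Two pairs joined head
    to tail would add up to a difference above 2, hence a square sum above 2.\<close>
  have disj: False if pqrs: "p \<in> P" "q \<in> P" "r \<in> P" "s \<in> P" "\<eta> p - \<eta> q > 1" "\<eta> r - \<eta> s > 1"
    "p \<noteq> r" "q \<noteq> s" for p q r s
  proof -
    have two: "(a - b)\<^sup>2 \<le> 2 * (a\<^sup>2 + b\<^sup>2)" for a b :: real
      using zero_le_power2[of "a + b"] by (simp add: power2_sum power2_diff)
    have gt: "x\<^sup>2 > 1" if "x > 1" for x :: real
      using that by (simp add: one_less_power)
    have gt4: "x\<^sup>2 > 4" if "x > 2" for x :: real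
      using power_strict_mono[of 2 x 2] that by simp
    show False
    proof (cases "p = s \<or> q = r")
      case True
      then have "\<eta> r - \<eta> q > 2 \<or> \<eta> p - \<eta> s > 2" using pqrs(5,6) by auto
      then obtain a b where ab: "a \<in> P" "b \<in> P" "\<eta> a - \<eta> b > 2" using pqrs(1-4) by blast
      then have "a \<noteq> b" by auto
      then have "(\<eta> a)\<^sup>2 + (\<eta> b)\<^sup>2 \<le> 1" using sub[of "{a, b}"] ab by simp
      then show False using two[of "\<eta> a" "\<eta> b"] gt4[OF ab(3)] by simp
    next
      case False
      have "p \<noteq> q" "r \<noteq> s" using that by auto
      then have "(\<eta> p)\<^sup>2 + (\<eta> q)\<^sup>2 + ((\<eta> r)\<^sup>2 + (\<eta> s)\<^sup>2) \<le> 1"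
        using sub[of "{p, q, r, s}"] that False by (simp add: add.assoc)
      then show False
        using two[of "\<eta> p" "\<eta> q"] two[of "\<eta> r" "\<eta> s"] gt[OF pqrs(5)] gt[OF pqrs(6)] by simp
    qed
  qed
  have E_sum: "(\<Sum>(p, q)\<in>E. (\<eta> p - \<eta> q)\<^sup>2 - 1) \<le> 1"
  proof (cases "E = {}")
    case False
    then obtain p q where pq: "(p, q) \<in> E" by auto
    \<comment> \<open>Any two pairs share their first or share their second entry. Because this
      respects the orientation, no triangle can occur and only stars remain.\<close>
    have "(\<forall>(r, s)\<in>E. r = p) \<or> (\<forall>(r, s)\<in>E. s = q)"
    proof (rule ccontr)
      assume "\<not> ?thesis"
      then obtain r s r' s' where a: "(r, s) \<in> E" "r \<noteq> p" "(r', s') \<in> E" "s' \<noteq> q" by auto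
      have "s = q" using disj[of p q r s] a pq by (auto simp: E_def)
      moreover have "r' = p" using disj[of p q r' s'] a pq by (auto simp: E_def)
      ultimately show False using disj[of r s r' s'] a by (auto simp: E_def)
    qed
    then show ?thesis
    proof
      assume "\<forall>(r, s)\<in>E. r = p"
      then have E: "E = Pair p ` (snd ` E)" by force
      have "(\<Sum>(p, q)\<in>E. (\<eta> p - \<eta> q)\<^sup>2 - 1) = (\<Sum>q\<in>snd ` E. (\<eta> p - \<eta> q)\<^sup>2 - 1)"
        by (subst E, subst sum.reindex) (auto simp: inj_on_def)
      also have "\<dots> \<le> 1"
      proof (rule star_bound)
        show "snd ` E \<subseteq> P" "p \<in> P" using pq EP by auto
        show "p \<notin> snd ` E" using E Eirr by blast
      qed simp
      finally show ?thesis .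
    next
      assume "\<forall>(r, s)\<in>E. s = q"
      then have E: "E = (\<lambda>r. (r, q)) ` (fst ` E)" by force
      have "(\<Sum>(p, q)\<in>E. (\<eta> p - \<eta> q)\<^sup>2 - 1) = (\<Sum>r\<in>fst ` E. (\<eta> q - \<eta> r)\<^sup>2 - 1)"
        by (subst E, subst sum.reindex) (auto simp: inj_on_def power2_commute)
      also have "\<dots> \<le> 1"
      proof (rule star_bound)
        show "fst ` E \<subseteq> P" "q \<in> P" using pq EP by auto
        show "q \<notin> fst ` E" using E Eirr by blast
      qed simp
      finally show ?thesis .
    qed
  qed simp
  define E' where "E' = {(p, q) \<in> P \<times> P. \<eta> q - \<eta> p > 1}"
  have E': "E' = prod.swap ` E" unfolding E'_def E_def by force
  have E'_sum: "(\<Sum>(p, q)\<in>E'. (\<eta> p - \<eta> q)\<^sup>2 - 1) = (\<Sum>(p, q)\<in>E. (\<eta> p - \<eta> q)\<^sup>2 - 1)"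
    unfolding E' by (subst sum.reindex) (auto intro!: sum.cong power2_commute)
  have "(\<Sum>p\<in>P. \<Sum>q\<in>P. max 0 ((\<eta> p - \<eta> q)\<^sup>2 - 1)) =
    (\<Sum>(p, q)\<in>P \<times> P. max 0 ((\<eta> p - \<eta> q)\<^sup>2 - 1))" by (simp add: sum.cartesian_product)
  also have "\<dots> = (\<Sum>(p, q)\<in>E \<union> E'. (\<eta> p - \<eta> q)\<^sup>2 - 1)"
  proof -
    have small: "max 0 (r\<^sup>2 - 1) = 0" if "\<not> r > 1" "\<not> - r > 1" for r :: real
      using that by (simp add: abs_square_le_1 abs_le_iff)
    have big: "max 0 (r\<^sup>2 - 1) = r\<^sup>2 - 1" if "r > 1 \<or> - r > 1" for r :: real
      using that one_less_power[of r 2] one_less_power[of "-r" 2] by auto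
    have big': "max 0 ((\<eta> a - \<eta> b)\<^sup>2 - 1) = (\<eta> a - \<eta> b)\<^sup>2 - 1" if "(a, b) \<in> E \<union> E'" for a b
      using that by (intro big) (auto simp: E_def E'_def)
    have small': "max 0 ((\<eta> a - \<eta> b)\<^sup>2 - 1) = 0" if "(a, b) \<in> P \<times> P - (E \<union> E')" for a b
      using that by (intro small) (auto simp: E_def E'_def)
    have "finite (P \<times> P)" "E \<union> E' \<subseteq> P \<times> P" using assms(1) by (auto simp: E_def E'_def)
    then show ?thesis
    proof (rule sum.mono_neutral_cong_right)
      show "\<forall>i\<in>P \<times> P - (E \<union> E'). (case i of (p, q) \<Rightarrow> max 0 ((\<eta> p - \<eta> q)\<^sup>2 - 1)) = 0"
      proof
        fix i assume "i \<in> P \<times> P - (E \<union> E')"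
        moreover obtain a b where "i = (a, b)" by (cases i)
        ultimately show "(case i of (p, q) \<Rightarrow> max 0 ((\<eta> p - \<eta> q)\<^sup>2 - 1)) = 0"
          using small'[of a b] by (simp only: split)
      qed
      fix i assume "i \<in> E \<union> E'"
      moreover obtain a b where "i = (a, b)" by (cases i)
      ultimately show "(case i of (p, q) \<Rightarrow> max 0 ((\<eta> p - \<eta> q)\<^sup>2 - 1)) =
        (case i of (p, q) \<Rightarrow> (\<eta> p - \<eta> q)\<^sup>2 - 1)"
        using big'[of a b] by (simp only: split)
    qed
  qed
  also have "\<dots> = (\<Sum>(p, q)\<in>E. (\<eta> p - \<eta> q)\<^sup>2 - 1) + (\<Sum>(p, q)\<in>E'. (\<eta> p - \<eta> q)\<^sup>2 - 1)"
  proof (rule sum.union_disjoint)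
    show "finite E'" using finE by (simp add: E')
    show "E \<inter> E' = {}" by (auto simp: E_def E'_def)
  qed (rule finE)
  also have "\<dots> \<le> 2" using E_sum E'_sum by simp
  finally show ?thesis .
qed

text \<open>With \<open>t\<close> the minimum of \<open>x\<close>, write \<open>x = t + y\<close>.
  The terms of degree 0 and 1 in \<open>y\<close> are controlled by the row sums over
  \<open>I\<close>. Since \<open>y\<close> vanishes at the minimiser, its own quadratic form lives
  on a smaller index set. The induction may visit any subset, which is why row sums over all
  \<open>S\<close> are bounded.\<close>

lemma quadratic_form_le_square_sum:
  fixes W :: "'b \<Rightarrow> 'b \<Rightarrow> real" and x :: "'b \<Rightarrow> real"
  assumes "finite I" and sym: "\<And>a b. a \<in> I \<Longrightarrow> b \<in> I \<Longrightarrow> W a b = W b a"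
    and x: "\<And>a. a \<in> I \<Longrightarrow> 0 \<le> x a"
    and W: "\<And>S a. S \<subseteq> I \<Longrightarrow> a \<in> S \<Longrightarrow> (\<Sum>b\<in>S. W a b) \<le> card S"
  shows "(\<Sum>a\<in>I. \<Sum>b\<in>I. W a b * x a * x b) \<le> (\<Sum>a\<in>I. x a)\<^sup>2"
  using assms
proof (induction "card I" arbitrary: I x rule: less_induct)
  case less
  show ?case
  proof (cases "I = {}")
    case False
    define t where "t = Min (x ` I)"
    obtain c where c: "c \<in> I" "x c = t"
      using Min_in[of "x ` I"] less.prems(1) False unfolding t_def by fastforce
    have t_le: "t \<le> x a" if "a \<in> I" for a using that less.prems(1) by (simp add: t_def)
    have t0: "t \<ge> 0" using c less.prems(3) by auto
    define y where "y = (\<lambda>a. x a - t)"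
    define J where "J = I - {c}"
    have y: "y c = 0" "\<And>a. a \<in> I \<Longrightarrow> 0 \<le> y a" using c t_le by (auto simp: y_def)
    have J: "finite J" "card J < card I" "J \<subseteq> I"
      using less.prems(1) c by (auto simp: J_def simp del: card_Diff_insert card_Diff_singleton_if card_Diff_singleton intro: card_Diff1_less)
    have IJ: "I = insert c J" "c \<notin> J" using c by (auto simp: J_def)
    have IH: "(\<Sum>a\<in>J. \<Sum>b\<in>J. W a b * y a * y b) \<le> (\<Sum>a\<in>J. y a)\<^sup>2"
    proof (rule less.hyps[OF J(2) J(1)])
      show "W a b = W b a" if "a \<in> J" "b \<in> J" for a b
        using that J(3) less.prems(2)[of a b] by blast
      show "0 \<le> y a" if "a \<in> J" for a using that J(3) y(2) by blast
      show "(\<Sum>b\<in>S. W a b) \<le> card S" if "S \<subseteq> J" "a \<in> S" for S a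
        using that J(3) less.prems(4)[of S a] by blast
    qed
    have yI: "(\<Sum>a\<in>I. \<Sum>b\<in>I. W a b * y a * y b) \<le> (\<Sum>a\<in>I. y a)\<^sup>2"
      using IH IJ J(1) y(1) by simp
    let ?n = "real (card I)"
    have one: "(\<Sum>a\<in>I. \<Sum>b\<in>I. W a b) \<le> ?n * ?n"
      using sum_mono[of I "\<lambda>a. \<Sum>b\<in>I. W a b" "\<lambda>_. ?n"] less.prems(4) by auto
    have cross: "(\<Sum>a\<in>I. \<Sum>b\<in>I. W a b * y a) \<le> ?n * (\<Sum>a\<in>I. y a)"
    proof -
      have "(\<Sum>a\<in>I. \<Sum>b\<in>I. W a b * y a) = (\<Sum>a\<in>I. (\<Sum>b\<in>I. W a b) * y a)"
        by (simp add: sum_distrib_right)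
      also have "\<dots> \<le> (\<Sum>a\<in>I. ?n * y a)"
        using less.prems(4) y(2) by (intro sum_mono mult_right_mono) auto
      finally show ?thesis by (simp add: sum_distrib_left)
    qed
    have cross': "(\<Sum>a\<in>I. \<Sum>b\<in>I. W a b * y b) = (\<Sum>a\<in>I. \<Sum>b\<in>I. W a b * y a)"
      by (subst sum.swap, intro sum.cong refl) (metis less.prems(2))
    have "(\<Sum>a\<in>I. \<Sum>b\<in>I. W a b * x a * x b) =
      (\<Sum>a\<in>I. \<Sum>b\<in>I. t\<^sup>2 * W a b + t * (W a b * y a) + t * (W a b * y b) + W a b * y a * y b)"
      by (intro sum.cong refl) (simp add: y_def power2_eq_square algebra_simps)
    also have "\<dots> = t\<^sup>2 * (\<Sum>a\<in>I. \<Sum>b\<in>I. W a b) + 2 * t * (\<Sum>a\<in>I. \<Sum>b\<in>I. W a b * y a)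
       + (\<Sum>a\<in>I. \<Sum>b\<in>I. W a b * y a * y b)"
      by (simp add: sum.distrib sum_distrib_left[symmetric] cross')
    also have "\<dots> \<le> t\<^sup>2 * (?n * ?n) + 2 * t * (?n * (\<Sum>a\<in>I. y a)) + (\<Sum>a\<in>I. y a)\<^sup>2"
      using one cross yI t0 by (intro add_mono mult_left_mono) auto
    also have "\<dots> = (?n * t + (\<Sum>a\<in>I. y a))\<^sup>2" by (simp add: power2_eq_square algebra_simps)
    also have "?n * t + (\<Sum>a\<in>I. y a) = (\<Sum>a\<in>I. x a)" by (simp add: y_def sum_subtractf)
    finally show ?thesis .
  qed simp
qed

text \<open>Matrices enter as functions of their entries, with the Frobenius product as a finite
  sum. The inequality is the nonnegativity of the squared residual.\<close>

lemma bessel_finite_functions: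
  fixes m :: "'s \<Rightarrow> 'x \<Rightarrow> real"
  assumes "finite S" "finite X"
    and on: "\<And>s t. s \<in> S \<Longrightarrow> t \<in> S \<Longrightarrow> (\<Sum>x\<in>X. m s x * m t x) = (if s = t then 1 else 0)"
  shows "(\<Sum>s\<in>S. (\<Sum>x\<in>X. m s x * e x)\<^sup>2) \<le> (\<Sum>x\<in>X. (e x)\<^sup>2)"
proof -
  define c where "c = (\<lambda>s. \<Sum>x\<in>X. m s x * e x)"
  have cross: "(\<Sum>x\<in>X. e x * (\<Sum>s\<in>S. c s * m s x)) = (\<Sum>s\<in>S. (c s)\<^sup>2)"
  proof -
    have "(\<Sum>x\<in>X. e x * (\<Sum>s\<in>S. c s * m s x)) = (\<Sum>s\<in>S. \<Sum>x\<in>X. c s * (m s x * e x))"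
      by (subst sum.swap) (simp add: sum_distrib_left mult_ac)
    then show ?thesis by (simp add: sum_distrib_left[symmetric] c_def power2_eq_square)
  qed
  have quad: "(\<Sum>x\<in>X. (\<Sum>s\<in>S. c s * m s x)\<^sup>2) = (\<Sum>s\<in>S. (c s)\<^sup>2)"
  proof -
    have "(\<Sum>x\<in>X. (\<Sum>s\<in>S. c s * m s x)\<^sup>2) =
      (\<Sum>x\<in>X. \<Sum>s\<in>S. \<Sum>t\<in>S. c s * c t * (m s x * m t x))"
      by (simp add: power2_eq_square sum_product mult_ac)
    also have "\<dots> = (\<Sum>s\<in>S. \<Sum>t\<in>S. c s * c t * (\<Sum>x\<in>X. m s x * m t x))"
      by (subst sum.swap, intro sum.cong refl, subst sum.swap) (simp add: sum_distrib_left)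
    also have "\<dots> = (\<Sum>s\<in>S. \<Sum>t\<in>S. if s = t then c s * c t else 0)"
      by (intro sum.cong refl) (simp add: on)
    finally show ?thesis using assms(1) by (simp add: power2_eq_square)
  qed
  have "0 \<le> (\<Sum>x\<in>X. (e x - (\<Sum>s\<in>S. c s * m s x))\<^sup>2)" by (intro sum_nonneg) simp
  also have "\<dots> = (\<Sum>x\<in>X. (e x)\<^sup>2) - 2 * (\<Sum>x\<in>X. e x * (\<Sum>s\<in>S. c s * m s x))
      + (\<Sum>x\<in>X. (\<Sum>s\<in>S. c s * m s x)\<^sup>2)"
    by (simp add: power2_diff sum.distrib sum_subtractf sum_distrib_left mult.assoc)
  finally show ?thesis using cross quad by (simp add: c_def)
qed

text \<open>In an eigenbasis of \<open>A \<alpha>\<close> the squared commutator with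
  \<open>A s\<close> is the sum of the squared entries of \<open>A s\<close> with weights
  \<open>(\<eta> p - \<eta> q)^2\<close>. The part 1 of each weight yields
  \<open>card S - 1\<close>, since \<open>s = \<alpha>\<close> contributes nothing, and the excess
  yields at most 1.\<close>

lemma sum_norm_commutator_square_le:
  fixes A :: "'s \<Rightarrow> 'n::euclidean_space \<Rightarrow> 'n"
  assumes "finite S" "\<alpha> \<in> S" and lin: "\<And>s. s \<in> S \<Longrightarrow> linear (A s)"
    and sym: "\<And>s x y. s \<in> S \<Longrightarrow> A s x \<bullet> y = x \<bullet> A s y"
    and on: "\<And>s t. s \<in> S \<Longrightarrow> t \<in> S \<Longrightarrow> (\<Sum>b\<in>Basis. A s b \<bullet> A t b) = (if s = t then 1 else 0)"
  shows "(\<Sum>s\<in>S. \<Sum>b\<in>Basis. (norm (A \<alpha> (A s b) - A s (A \<alpha> b)))\<^sup>2) \<le> card S"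
proof -
  obtain P \<eta> where P: "orthonormal_set P" and \<eta>: "\<And>p. p \<in> P \<Longrightarrow> A \<alpha> p = \<eta> p *\<^sub>R p"
    using self_adjoint_eigenbasis[of "A \<alpha>"] lin[OF assms(2)] sym[OF assms(2)] by blast
  have finP: "finite P" and PP: "\<And>p q. p \<in> P \<Longrightarrow> q \<in> P \<Longrightarrow> p \<bullet> q = (if p = q then 1 else 0)"
    using P by (auto simp: orthonormal_set_def)
  have bil: "bilinear (\<lambda>x y. T x \<bullet> U y)" if "linear T" "linear U" for T U :: "'n \<Rightarrow> 'n"
    using that by (auto simp: bilinear_def linear_iff inner_add_left inner_add_right)
  have toP: "(\<Sum>b\<in>Basis. T b \<bullet> U b) = (\<Sum>p\<in>P. T p \<bullet> U p)" if "linear T" "linear U" for T U :: "'n \<Rightarrow> 'n"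
    by (rule bilinear_trace_orthonormal[OF bil[OF that] orthonormal_set_Basis P])
  define m where "m = (\<lambda>s (p, q). A s p \<bullet> q)"
  have mm: "(\<Sum>x\<in>P \<times> P. m s x * m t x) = (if s = t then 1 else 0)" if "s \<in> S" "t \<in> S" for s t
  proof -
    have "(\<Sum>x\<in>P \<times> P. m s x * m t x) = (\<Sum>p\<in>P. \<Sum>q\<in>P. (A s p \<bullet> q) * (A t p \<bullet> q))"
      by (simp add: m_def sum.cartesian_product split_beta)
    then show ?thesis
      using on[OF that] toP[OF lin lin, OF that] by (simp add: orthonormal_set_inner[OF P])
  qed
  define S' where "S' = S - {\<alpha>}"
  define R where "R = (\<lambda>p q. \<Sum>s\<in>S'. (A s p \<bullet> q)\<^sup>2)"
  have R0: "0 \<le> R p q" for p q by (simp add: R_def sum_nonneg)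
  \<comment> \<open>The test matrix \<open>E\<close> has entry 1 at \<open>(p, q)\<close> and at
    \<open>(q, p)\<close>. Its squared norm is 2 and its product with the symmetric
    \<open>A s\<close> is twice an entry, so Bessel reads \<open>4 * R p q \<le> 2\<close>.\<close>
  have R_half: "R p q \<le> 1 / 2" if pq: "p \<in> P" "q \<in> P" "p \<noteq> q" for p q
  proof -
    have pick: "r * ((if a then 1 else 0) + (if b then 1 else 0)) = (if a then r else 0) + (if b then r else 0)"
      for r :: real and a b by simp
    define E where "E = (\<lambda>x. (if x = (p, q) then 1 else 0) + (if x = (q, p) then 1 else 0 :: real))"
    have "(\<Sum>s\<in>S'. (\<Sum>x\<in>P \<times> P. m s x * E x)\<^sup>2) \<le> (\<Sum>x\<in>P \<times> P. (E x)\<^sup>2)"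
      using mm assms(1) finP by (intro bessel_finite_functions) (auto simp: S'_def)
    also have "(\<Sum>x\<in>P \<times> P. (E x)\<^sup>2) = (\<Sum>x\<in>P \<times> P. E x)"
      using pq(3) by (intro sum.cong refl) (simp add: E_def)
    also have "\<dots> = 2" using pq finP by (simp add: E_def sum.distrib)
    also have "(\<Sum>s\<in>S'. (\<Sum>x\<in>P \<times> P. m s x * E x)\<^sup>2) = (\<Sum>s\<in>S'. 4 * (A s p \<bullet> q)\<^sup>2)"
    proof (intro sum.cong refl)
      fix s assume "s \<in> S'"
      then have "s \<in> S" by (simp add: S'_def)
      have "(\<Sum>x\<in>P \<times> P. m s x * E x) =
        (\<Sum>x\<in>P \<times> P. (if x = (p, q) then m s x else 0) + (if x = (q, p) then m s x else 0))"
        by (simp only: E_def pick)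
      also have "\<dots> = A s p \<bullet> q + A s q \<bullet> p"
        using pq finP by (simp add: sum.distrib m_def)
      also have "A s q \<bullet> p = A s p \<bullet> q" using sym[OF \<open>s \<in> S\<close>, of q p] by (simp add: inner_commute)
      finally show "(\<Sum>x\<in>P \<times> P. m s x * E x)\<^sup>2 = 4 * (A s p \<bullet> q)\<^sup>2"
        by (simp add: power2_eq_square)
    qed
    finally show ?thesis by (simp add: R_def sum_distrib_left[symmetric])
  qed
  have \<eta>1: "(\<Sum>p\<in>P. (\<eta> p)\<^sup>2) = 1"
  proof -
    have "(\<Sum>p\<in>P. (\<eta> p)\<^sup>2) = (\<Sum>p\<in>P. A \<alpha> p \<bullet> A \<alpha> p)"
      by (intro sum.cong refl) (simp add: \<eta> PP power2_eq_square)
    then show ?thesis using toP[OF lin lin, of \<alpha> \<alpha>] on[of \<alpha> \<alpha>] assms(2) by simp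
  qed
  have comm: "(\<Sum>b\<in>Basis. (norm (A \<alpha> (A s b) - A s (A \<alpha> b)))\<^sup>2) =
    (\<Sum>p\<in>P. \<Sum>q\<in>P. (\<eta> p - \<eta> q)\<^sup>2 * (A s p \<bullet> q)\<^sup>2)" if s: "s \<in> S" for s
  proof -
    let ?T = "\<lambda>x. A \<alpha> (A s x) - A s (A \<alpha> x)"
    have "linear ?T"
      using lin[OF s] lin[OF assms(2)] by (auto simp: linear_iff algebra_simps)
    have "(\<Sum>b\<in>Basis. (norm (?T b))\<^sup>2) = (\<Sum>p\<in>P. ?T p \<bullet> ?T p)"
      using toP[OF \<open>linear ?T\<close> \<open>linear ?T\<close>] by (simp add: power2_norm_eq_inner)
    also have "\<dots> = (\<Sum>p\<in>P. \<Sum>q\<in>P. (?T p \<bullet> q) * (?T p \<bullet> q))"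
      by (simp add: orthonormal_set_inner[OF P])
    also have "\<dots> = (\<Sum>p\<in>P. \<Sum>q\<in>P. (\<eta> p - \<eta> q)\<^sup>2 * (A s p \<bullet> q)\<^sup>2)"
    proof (intro sum.cong refl)
      fix p q assume pq: "p \<in> P" "q \<in> P"
      have "?T p \<bullet> q = A s p \<bullet> A \<alpha> q - \<eta> p * (A s p \<bullet> q)"
        using sym[OF assms(2)] linear_scale[OF lin[OF s]] by (simp add: \<eta>[OF pq(1)] inner_diff_left)
      also have "\<dots> = (\<eta> q - \<eta> p) * (A s p \<bullet> q)"
        by (simp add: \<eta>[OF pq(2)] algebra_simps)
      finally have Tpq: "?T p \<bullet> q = (\<eta> q - \<eta> p) * (A s p \<bullet> q)" .
      show "(?T p \<bullet> q) * (?T p \<bullet> q) = (\<eta> p - \<eta> q)\<^sup>2 * (A s p \<bullet> q)\<^sup>2"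
        unfolding Tpq by (simp add: power2_eq_square algebra_simps)
    qed
    finally show ?thesis .
  qed
  have "(\<Sum>s\<in>S. \<Sum>b\<in>Basis. (norm (A \<alpha> (A s b) - A s (A \<alpha> b)))\<^sup>2) =
    (\<Sum>s\<in>S'. \<Sum>b\<in>Basis. (norm (A \<alpha> (A s b) - A s (A \<alpha> b)))\<^sup>2)"
    using assms(1,2) by (simp add: S'_def sum.remove[of S \<alpha>])
  also have "\<dots> = (\<Sum>s\<in>S'. \<Sum>p\<in>P. \<Sum>q\<in>P. (\<eta> p - \<eta> q)\<^sup>2 * (A s p \<bullet> q)\<^sup>2)"
    by (intro sum.cong refl comm) (simp add: S'_def)
  also have "\<dots> = (\<Sum>p\<in>P. \<Sum>s\<in>S'. \<Sum>q\<in>P. (\<eta> p - \<eta> q)\<^sup>2 * (A s p \<bullet> q)\<^sup>2)"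
    by (rule sum.swap)
  also have "\<dots> = (\<Sum>p\<in>P. \<Sum>q\<in>P. \<Sum>s\<in>S'. (\<eta> p - \<eta> q)\<^sup>2 * (A s p \<bullet> q)\<^sup>2)"
    by (intro sum.cong refl sum.swap)
  also have "\<dots> = (\<Sum>p\<in>P. \<Sum>q\<in>P. ((\<eta> p - \<eta> q)\<^sup>2 - 1) * R p q + R p q)"
    by (simp add: R_def sum_distrib_left[symmetric] algebra_simps)
  also have "\<dots> = (\<Sum>p\<in>P. \<Sum>q\<in>P. ((\<eta> p - \<eta> q)\<^sup>2 - 1) * R p q) + (\<Sum>p\<in>P. \<Sum>q\<in>P. R p q)"
    by (simp add: sum.distrib)
  also have "\<dots> \<le> (\<Sum>p\<in>P. \<Sum>q\<in>P. max 0 ((\<eta> p - \<eta> q)\<^sup>2 - 1) * (1 / 2)) + (\<Sum>p\<in>P. \<Sum>q\<in>P. R p q)"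
  proof (intro add_right_mono sum_mono)
    fix p q assume pq: "p \<in> P" "q \<in> P"
    show "((\<eta> p - \<eta> q)\<^sup>2 - 1) * R p q \<le> max 0 ((\<eta> p - \<eta> q)\<^sup>2 - 1) * (1 / 2)"
    \<comment> \<open>The bound 1/2 concerns off-diagonal entries; on the diagonal the excess is -1,
      so the left side is nonpositive.\<close>
    proof (cases "p = q")
      case False
      have "((\<eta> p - \<eta> q)\<^sup>2 - 1) * R p q \<le> max 0 ((\<eta> p - \<eta> q)\<^sup>2 - 1) * R p q"
        using R0 by (intro mult_right_mono) auto
      also have "\<dots> \<le> max 0 ((\<eta> p - \<eta> q)\<^sup>2 - 1) * (1 / 2)"
        using R_half[OF pq False] by (intro mult_left_mono) auto
      finally show ?thesis .
    qed (simp add: R0)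
  qed
  also have "(\<Sum>p\<in>P. \<Sum>q\<in>P. R p q) = card S'"
  proof -
    have "(\<Sum>p\<in>P. \<Sum>q\<in>P. R p q) = (\<Sum>x\<in>P \<times> P. \<Sum>s\<in>S'. m s x * m s x)"
      unfolding R_def m_def power2_eq_square
      by (subst sum.cartesian_product) (simp add: split_beta)
    also have "\<dots> = (\<Sum>s\<in>S'. \<Sum>x\<in>P \<times> P. m s x * m s x)" by (rule sum.swap)
    also have "\<dots> = (\<Sum>s\<in>S'. 1)" by (intro sum.cong refl) (simp add: mm S'_def)
    finally show ?thesis by simp
  qed
  also have "(\<Sum>p\<in>P. \<Sum>q\<in>P. max 0 ((\<eta> p - \<eta> q)\<^sup>2 - 1) * (1 / 2)) \<le> 1"
    using sum_pairs_max_diff_square_le[OF finP, of \<eta>] \<eta>1 by (simp add: sum_divide_distrib[symmetric])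
  also have "1 + real (card S') = card S"
    using card_Suc_Diff1[OF assms(1,2)] by (simp add: S'_def)
  finally show ?thesis by simp
qed

text \<open>The index of the family is a vector on which \<open>A\<close> depends linearly, so it
  can be rotated. An eigenbasis \<open>O'\<close> of the Gram form \<open>\<tau>\<close> makes the
  matrices mutually orthogonal, and normalising them reduces the claim to the orthonormal case with
  weights \<open>\<tau> \<xi> \<xi>\<close>.\<close>

theorem ddvv_inequality:
  fixes A :: "'a::euclidean_space \<Rightarrow> 'n::euclidean_space \<Rightarrow> 'n"
  assumes "bilinear A" and sym: "\<And>\<xi> x y. A \<xi> x \<bullet> y = x \<bullet> A \<xi> y"
  shows "(\<Sum>\<xi>\<in>Basis. \<Sum>\<zeta>\<in>Basis. \<Sum>b\<in>Basis. (norm (A \<xi> (A \<zeta> b) - A \<zeta> (A \<xi> b)))\<^sup>2)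
    \<le> (\<Sum>\<xi>\<in>Basis. \<Sum>b\<in>Basis. (norm (A \<xi> b))\<^sup>2)\<^sup>2"
proof -
  have lin: "linear (A \<xi>)" for \<xi> using assms(1) by (simp add: bilinear_def)
  have add: "A (\<xi> + \<zeta>) x = A \<xi> x + A \<zeta> x" and scale: "A (r *\<^sub>R \<xi>) x = r *\<^sub>R A \<xi> x" for r \<xi> \<zeta> x
    using assms(1) by (auto simp: bilinear_ladd bilinear_lmul)
  have addr: "A \<xi> (x + y) = A \<xi> x + A \<xi> y" and scaler: "A \<xi> (r *\<^sub>R x) = r *\<^sub>R A \<xi> x" for r \<xi> x y
    using assms(1) by (auto simp: bilinear_radd bilinear_rmul)
  define \<tau> where "\<tau> = (\<lambda>\<xi> \<zeta>. \<Sum>b\<in>Basis. A \<xi> b \<bullet> A \<zeta> b)"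
  define C where "C = (\<lambda>\<xi> \<zeta>. \<Sum>b\<in>Basis. (norm (A \<xi> (A \<zeta> b) - A \<zeta> (A \<xi> b)))\<^sup>2)"
  have bil_\<tau>: "bilinear \<tau>"
    by (auto simp: bilinear_def linear_iff \<tau>_def add scale inner_add_left inner_add_right
      sum.distrib sum_distrib_left)
  define T where "T = (\<lambda>\<xi>. \<Sum>b\<in>Basis. \<tau> \<xi> b *\<^sub>R b)"
  have T: "T \<xi> \<bullet> \<zeta> = \<tau> \<xi> \<zeta>" for \<xi> \<zeta>
  proof -
    have "\<tau> \<xi> \<zeta> = \<tau> \<xi> (\<Sum>b\<in>Basis. (\<zeta> \<bullet> b) *\<^sub>R b)" by (simp add: euclidean_representation)
    also have "\<dots> = (\<Sum>b\<in>Basis. (\<zeta> \<bullet> b) * \<tau> \<xi> b)"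
      using bil_\<tau> by (simp add: bilinear_def linear_sum linear_scale)
    finally show ?thesis by (simp add: T_def inner_sum_left mult.commute inner_commute[of \<zeta>])
  qed
  have "linear T"
    using bil_\<tau> by (auto simp: T_def linear_iff bilinear_ladd bilinear_lmul scaleR_add_left
      sum.distrib scaleR_sum_right)
  have \<tau>_sym: "\<tau> \<xi> \<zeta> = \<tau> \<zeta> \<xi>" for \<xi> \<zeta> by (simp add: \<tau>_def inner_commute)
  have "T x \<bullet> y = x \<bullet> T y" for x y
    using T[of x y] T[of y x] \<tau>_sym[of x y] by (simp add: inner_commute)
  then obtain O' l where O': "orthonormal_set O'" and l: "\<And>b. b \<in> O' \<Longrightarrow> T b = l b *\<^sub>R b"
    using self_adjoint_eigenbasis[OF \<open>linear T\<close>] by blast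
  have finO: "finite O'" using O' by (simp add: orthonormal_set_def)
  have \<tau>0: "\<tau> x y = 0" if "x \<in> O'" "y \<in> O'" "x \<noteq> y" for x y
    using T[of x y] l[of x] that O' by (auto simp: orthonormal_set_def)
  have \<tau>_pos: "0 \<le> \<tau> x x" for x by (simp add: \<tau>_def sum_nonneg)
  have \<tau>_zero: "A x = (\<lambda>_. 0)" if "\<tau> x x = 0" for x
  proof -
    have "\<forall>b\<in>Basis. A x b = 0"
      using that by (simp add: \<tau>_def sum_nonneg_eq_0_iff)
    then show ?thesis using linear_eq_stdbasis[OF lin[of x] linear_zero] by auto
  qed
  have C_sym: "C \<xi> \<zeta> = C \<zeta> \<xi>" for \<xi> \<zeta> by (simp add: C_def norm_minus_commute)
  \<comment> \<open>For fixed \<open>\<zeta>\<close>, \<open>C \<xi> \<zeta>\<close> is the diagonal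
    of a bilinear form in \<open>\<xi>\<close>, which permits the change of basis in one index at a
    time.\<close>
  have bilC: "bilinear (\<lambda>\<xi> \<xi>'. \<Sum>b\<in>Basis. (A \<xi> (A \<zeta> b) - A \<zeta> (A \<xi> b)) \<bullet> (A \<xi>' (A \<zeta> b) - A \<zeta> (A \<xi>' b)))" for \<zeta>
    unfolding bilinear_def linear_iff
    by (simp add: add scale addr scaler inner_add_left inner_add_right inner_diff_left
      inner_diff_right sum.distrib sum_subtractf sum_distrib_left algebra_simps)
  have C_trace: "(\<Sum>\<xi>\<in>Basis. C \<xi> \<zeta>) = (\<Sum>\<xi>\<in>O'. C \<xi> \<zeta>)" for \<zeta>
    unfolding C_def power2_norm_eq_inner
    by (rule bilinear_trace_orthonormal[OF bilC orthonormal_set_Basis O'])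
  \<comment> \<open>The squared commutators of the normalised matrices. If
    \<open>\<tau> x x = 0\<close> then \<open>A x = 0\<close>, and both \<open>C\<close> and the
    quotient vanish, the latter by the convention for division by 0.\<close>
  define W where "W = (\<lambda>x y. C x y / (\<tau> x x * \<tau> y y))"
  have "(\<Sum>\<xi>\<in>Basis. \<Sum>\<zeta>\<in>Basis. C \<xi> \<zeta>) = (\<Sum>\<zeta>\<in>Basis. \<Sum>\<xi>\<in>O'. C \<xi> \<zeta>)"
    by (subst sum.swap) (simp add: C_trace)
  also have "\<dots> = (\<Sum>\<xi>\<in>O'. \<Sum>\<zeta>\<in>Basis. C \<zeta> \<xi>)"
    by (subst sum.swap, intro sum.cong refl C_sym)
  also have "\<dots> = (\<Sum>\<xi>\<in>O'. \<Sum>\<zeta>\<in>O'. C \<zeta> \<xi>)" by (simp only: C_trace)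
  also have "\<dots> = (\<Sum>\<xi>\<in>O'. \<Sum>\<zeta>\<in>O'. C \<xi> \<zeta>)" by (rule sum.swap)
  also have "\<dots> = (\<Sum>\<xi>\<in>O'. \<Sum>\<zeta>\<in>O'. W \<xi> \<zeta> * \<tau> \<xi> \<xi> * \<tau> \<zeta> \<zeta>)"
  proof (intro sum.cong refl)
    fix \<xi> \<zeta>
    show "C \<xi> \<zeta> = W \<xi> \<zeta> * \<tau> \<xi> \<xi> * \<tau> \<zeta> \<zeta>"
    proof (cases "\<tau> \<xi> \<xi> = 0 \<or> \<tau> \<zeta> \<zeta> = 0")
      case True
      then have "C \<xi> \<zeta> = 0"
        using \<tau>_zero[of \<xi>] \<tau>_zero[of \<zeta>] linear_0[OF lin] by (auto simp: C_def)
      then show ?thesis using True by auto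
    qed (simp add: W_def)
  qed
  also have "\<dots> \<le> (\<Sum>\<xi>\<in>O'. \<tau> \<xi> \<xi>)\<^sup>2"
  proof (rule quadratic_form_le_square_sum[OF finO])
    show "W a b = W b a" for a b by (simp add: W_def C_sym mult.commute)
    fix S a assume S: "S \<subseteq> O'" "a \<in> S"
    show "(\<Sum>b\<in>S. W a b) \<le> card S"
    proof (cases "\<tau> a a = 0")
      case True then show ?thesis by (simp add: W_def)
    next
      case False
      define S' where "S' = {b \<in> S. \<tau> b b \<noteq> 0}"
      have finS: "finite S" using S(1) finO finite_subset by blast
      define A' where "A' = (\<lambda>b x. (1 / sqrt (\<tau> b b)) *\<^sub>R A b x)"
      have "(\<Sum>b\<in>S. W a b) = (\<Sum>b\<in>S'. W a b)"
        using finS by (intro sum.mono_neutral_right) (auto simp: S'_def W_def)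
      also have "\<dots> = (\<Sum>b\<in>S'. \<Sum>x\<in>Basis. (norm (A' a (A' b x) - A' b (A' a x)))\<^sup>2)"
      proof (intro sum.cong refl)
        fix b
        have "A' a (A' b x) - A' b (A' a x) =
          (1 / (sqrt (\<tau> a a) * sqrt (\<tau> b b))) *\<^sub>R (A a (A b x) - A b (A a x))" for x
          by (simp add: A'_def scaler scaleR_diff_right mult.commute)
        then show "W a b = (\<Sum>x\<in>Basis. (norm (A' a (A' b x) - A' b (A' a x)))\<^sup>2)"
          using \<tau>_pos by (simp add: W_def C_def power_mult_distrib power_divide sum_divide_distrib)
      qed
      also have "\<dots> \<le> card S'"
      proof (rule sum_norm_commutator_square_le)
        show "finite S'" "a \<in> S'" using finS False S(2) by (auto simp: S'_def)
        show "linear (A' s)" for s by (auto simp: A'_def linear_iff addr scaler scaleR_add_right)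
        show "A' s x \<bullet> y = x \<bullet> A' s y" for s x y by (simp add: A'_def sym)
        show "(\<Sum>b\<in>Basis. A' s b \<bullet> A' t b) = (if s = t then 1 else 0)" if "s \<in> S'" "t \<in> S'" for s t
        proof -
          have "(\<Sum>b\<in>Basis. A' s b \<bullet> A' t b) = \<tau> s t / (sqrt (\<tau> s s) * sqrt (\<tau> t t))"
            by (simp add: A'_def \<tau>_def sum_divide_distrib mult.commute)
          moreover have "s \<in> O'" "t \<in> O'" using that S(1) by (auto simp: S'_def)
          ultimately show ?thesis using \<tau>0[of s t] \<tau>_pos[of s] that by (auto simp: S'_def)
        qed
      qed
      also have "\<dots> \<le> card S" using finS by (auto simp: S'_def intro: card_mono)
      finally show ?thesis .
    qed
  qed (rule \<tau>_pos)
  also have "(\<Sum>\<xi>\<in>O'. \<tau> \<xi> \<xi>) = (\<Sum>\<xi>\<in>Basis. \<tau> \<xi> \<xi>)"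
    by (rule bilinear_trace_orthonormal[OF bil_\<tau> O' orthonormal_set_Basis])
  finally show ?thesis by (simp add: C_def \<tau>_def power2_norm_eq_inner)
qed

corollary ddvv_inequality_components:
  fixes b :: "'r \<Rightarrow> 'i \<Rightarrow> 'i \<Rightarrow> real"
    and \<beta> :: "'i \<Rightarrow> 'n::euclidean_space" and \<gamma> :: "'r \<Rightarrow> 'a::euclidean_space"
  assumes \<beta>: "bij_betw \<beta> I Basis" and \<gamma>: "inj_on \<gamma> R" "\<gamma> ` R \<subseteq> Basis"
    and sym: "\<And>r i j. b r i j = b r j i"
  shows "(\<Sum>r\<in>R. \<Sum>s\<in>R. \<Sum>i\<in>I. \<Sum>j\<in>I. (\<Sum>k\<in>I. b r i k * b s k j - b s i k * b r k j)\<^sup>2)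
    \<le> (\<Sum>r\<in>R. \<Sum>i\<in>I. \<Sum>j\<in>I. (b r i j)\<^sup>2)\<^sup>2"
proof -
  have finI: "finite I" using \<beta> bij_betw_finite finite_Basis by blast
  have finR: "finite R" using \<gamma> finite_Basis finite_subset finite_imageD by metis
  have \<beta>\<beta>: "\<beta> i \<bullet> \<beta> j = (if i = j then 1 else 0)" if "i \<in> I" "j \<in> I" for i j
    using \<beta> that by (subst inner_Basis) (auto simp: bij_betw_def inj_on_def)
  have \<gamma>\<gamma>: "\<gamma> r \<bullet> \<gamma> s = (if r = s then 1 else 0)" if "r \<in> R" "s \<in> R" for r s
    using \<gamma> that by (subst inner_Basis) (auto simp: inj_on_def subset_iff)
  define B where "B = (\<lambda>r x. \<Sum>i\<in>I. \<Sum>j\<in>I. ((x \<bullet> \<beta> i) * b r i j) *\<^sub>R \<beta> j)"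
  define A where "A = (\<lambda>\<xi> x. \<Sum>r\<in>R. (\<xi> \<bullet> \<gamma> r) *\<^sub>R B r x)"
  have linB: "linear (B r)" for r
    by (auto simp: linear_iff B_def inner_add_left distrib_right scaleR_add_left sum.distrib
      scaleR_sum_right mult.assoc)
  have bil: "bilinear A"
    using linB by (auto simp: bilinear_def linear_iff A_def inner_add_left scaleR_add_left
      scaleR_add_right sum.distrib scaleR_sum_right mult.commute mult.left_commute)
  have symB: "B r x \<bullet> y = x \<bullet> B r y" for r x y
  proof -
    have "B r x \<bullet> y = (\<Sum>i\<in>I. \<Sum>j\<in>I. (x \<bullet> \<beta> i) * b r i j * (\<beta> j \<bullet> y))"
      by (simp add: B_def inner_sum_left)
    also have "\<dots> = (\<Sum>i\<in>I. \<Sum>j\<in>I. (x \<bullet> \<beta> j) * b r j i * (\<beta> i \<bullet> y))" by (rule sum.swap)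
    also have "\<dots> = (\<Sum>i\<in>I. \<Sum>j\<in>I. (y \<bullet> \<beta> i) * b r i j * (x \<bullet> \<beta> j))"
      by (intro sum.cong refl) (simp add: sym[of r] inner_commute mult.commute mult.left_commute)
    also have "\<dots> = x \<bullet> B r y" by (simp add: B_def inner_sum_right)
    finally show ?thesis .
  qed
  have symA: "A \<xi> x \<bullet> y = x \<bullet> A \<xi> y" for \<xi> x y
    by (simp add: A_def inner_sum_left inner_sum_right symB)
  have A\<gamma>: "A (\<gamma> r) = B r" if "r \<in> R" for r
  proof
    fix x
    have "A (\<gamma> r) x = (\<Sum>s\<in>R. if r = s then B s x else 0)"
      unfolding A_def using that by (intro sum.cong refl) (simp add: \<gamma>\<gamma>)
    then show "A (\<gamma> r) x = B r x" using that finR by simp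
  qed
  have A0: "A \<xi> x = 0" if "\<xi> \<in> Basis - \<gamma> ` R" for \<xi> x
  proof -
    have "\<xi> \<bullet> \<gamma> r = 0" if "r \<in> R" for r
      using that \<gamma> \<open>\<xi> \<in> Basis - \<gamma> ` R\<close> by (subst inner_Basis) auto
    then show ?thesis by (simp add: A_def)
  qed
  have B\<beta>: "B r (\<beta> i) = (\<Sum>j\<in>I. b r i j *\<^sub>R \<beta> j)" if "i \<in> I" for r i
  proof -
    have "B r (\<beta> i) = (\<Sum>k\<in>I. if i = k then \<Sum>j\<in>I. b r k j *\<^sub>R \<beta> j else 0)"
      unfolding B_def using that by (intro sum.cong refl) (simp add: \<beta>\<beta>)
    then show ?thesis using that finI by simp
  qed
  have nrm: "(norm (\<Sum>j\<in>I. c j *\<^sub>R \<beta> j))\<^sup>2 = (\<Sum>j\<in>I. (c j)\<^sup>2)" for c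
  proof -
    have "(norm (\<Sum>j\<in>I. c j *\<^sub>R \<beta> j))\<^sup>2 = (\<Sum>i\<in>I. \<Sum>j\<in>I. if i = j then c i * c j else 0)"
      unfolding power2_norm_eq_inner inner_sum_left inner_sum_right
      by (intro sum.cong refl) (simp add: \<beta>\<beta>)
    then show ?thesis using finI by (simp add: power2_eq_square)
  qed
  have BB: "B r (B s (\<beta> i)) = (\<Sum>j\<in>I. (\<Sum>k\<in>I. b s i k * b r k j) *\<^sub>R \<beta> j)" if "i \<in> I" for r s i
  proof -
    have "B r (B s (\<beta> i)) = (\<Sum>k\<in>I. b s i k *\<^sub>R (\<Sum>j\<in>I. b r k j *\<^sub>R \<beta> j))"
      using that linB[of r] by (simp add: B\<beta> linear_sum linear_scale)
    also have "\<dots> = (\<Sum>j\<in>I. \<Sum>k\<in>I. (b s i k * b r k j) *\<^sub>R \<beta> j)"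
      by (simp add: scaleR_sum_right) (rule sum.swap)
    finally show ?thesis by (simp add: scaleR_sum_left)
  qed
  have comm: "(\<Sum>x\<in>Basis. (norm (A (\<gamma> r) (A (\<gamma> s) x) - A (\<gamma> s) (A (\<gamma> r) x)))\<^sup>2) =
    (\<Sum>i\<in>I. \<Sum>j\<in>I. (\<Sum>k\<in>I. b r i k * b s k j - b s i k * b r k j)\<^sup>2)" if "r \<in> R" "s \<in> R" for r s
  proof -
    have "B r (B s (\<beta> i)) - B s (B r (\<beta> i)) =
      (\<Sum>j\<in>I. (\<Sum>k\<in>I. b s i k * b r k j - b r i k * b s k j) *\<^sub>R \<beta> j)" if "i \<in> I" for i
      using that by (simp add: BB sum_subtractf scaleR_diff_left)
    then have "(norm (B r (B s (\<beta> i)) - B s (B r (\<beta> i))))\<^sup>2 =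
      (\<Sum>j\<in>I. (\<Sum>k\<in>I. b r i k * b s k j - b s i k * b r k j)\<^sup>2)" if "i \<in> I" for i
      using that by (simp add: nrm sum_subtractf power2_commute)
    then show ?thesis
      using that by (simp add: A\<gamma> sum.reindex_bij_betw[OF \<beta>, symmetric])
  qed
  have to_R: "(\<Sum>\<xi>\<in>Basis. h \<xi>) = (\<Sum>r\<in>R. h (\<gamma> r))" if "\<And>\<xi>. \<xi> \<in> Basis - \<gamma> ` R \<Longrightarrow> h \<xi> = 0"
    for h :: "'a \<Rightarrow> real"
  proof -
    have "(\<Sum>\<xi>\<in>Basis. h \<xi>) = (\<Sum>\<xi>\<in>\<gamma> ` R. h \<xi>)"
      using \<gamma>(2) that by (intro sum.mono_neutral_right) auto
    then show ?thesis by (simp add: sum.reindex[OF \<gamma>(1)])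
  qed
  have A00: "A \<xi> 0 = 0" for \<xi> using bil by (simp add: bilinear_rzero)
  have "(\<Sum>\<xi>\<in>Basis. \<Sum>\<zeta>\<in>Basis. \<Sum>x\<in>Basis. (norm (A \<xi> (A \<zeta> x) - A \<zeta> (A \<xi> x)))\<^sup>2) =
    (\<Sum>r\<in>R. \<Sum>s\<in>R. \<Sum>x\<in>Basis. (norm (A (\<gamma> r) (A (\<gamma> s) x) - A (\<gamma> s) (A (\<gamma> r) x)))\<^sup>2)"
    by (subst to_R, simp add: A0 A00, intro sum.cong refl, rule to_R) (simp add: A0 A00)
  also have "\<dots> = (\<Sum>r\<in>R. \<Sum>s\<in>R. \<Sum>i\<in>I. \<Sum>j\<in>I. (\<Sum>k\<in>I. b r i k * b s k j - b s i k * b r k j)\<^sup>2)"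
    by (intro sum.cong refl comm)
  finally have lhs: "(\<Sum>\<xi>\<in>Basis. \<Sum>\<zeta>\<in>Basis. \<Sum>x\<in>Basis. (norm (A \<xi> (A \<zeta> x) - A \<zeta> (A \<xi> x)))\<^sup>2) = \<dots>" .
  have "(\<Sum>\<xi>\<in>Basis. \<Sum>x\<in>Basis. (norm (A \<xi> x))\<^sup>2) = (\<Sum>r\<in>R. \<Sum>x\<in>Basis. (norm (A (\<gamma> r) x))\<^sup>2)"
    by (rule to_R) (simp add: A0)
  also have "\<dots> = (\<Sum>r\<in>R. \<Sum>i\<in>I. \<Sum>j\<in>I. (b r i j)\<^sup>2)"
    by (intro sum.cong refl) (simp add: A\<gamma> sum.reindex_bij_betw[OF \<beta>, symmetric] B\<beta> nrm)
  finally show ?thesis using ddvv_inequality[OF bil symA] lhs by simp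
qed

section \<open>Derivatives of fields along maps\<close>

lemma smooth_on_imp_differentiable:
  assumes "smooth_on S f" "x \<in> S"
  shows "f differentiable (at x)"
  using assms(1)[unfolded smooth_on_def, rule_format, of "Suc 0"] assms(2) by simp

lemma smooth_on_differential:
  assumes "smooth_on S f"
  shows "smooth_on S (\<lambda>x. differential f x v)"
  unfolding smooth_on_def
proof
  fix k show "Ck_on k S (\<lambda>x. differential f x v)"
    using assms[unfolded smooth_on_def, rule_format, of "Suc k"] by simp
qed

lemma smooth_on_has_derivative:
  assumes "smooth_on S f" "x \<in> S"
  shows "(f has_derivative differential f x) (at x)"
  using smooth_on_imp_differentiable[OF assms] frechet_derivative_works by blast

section \<open>Symmetry of second derivatives\<close>

text \<open>Apply the mean value theorem to the first difference in direction \<open>w\<close>, as a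
  function along \<open>v\<close>. The linear approximation of \<open>f' y v\<close> at
  \<open>u\<close> then yields the main term \<open>t^2 * D w\<close>.\<close>

lemma second_difference_bound:
  fixes f :: "'a::real_normed_vector \<Rightarrow> real"
  assumes S: "ball u r \<subseteq> S" "0 < r"
    and f: "\<And>y. y \<in> S \<Longrightarrow> (f has_derivative f' y) (at y)"
    and D: "((\<lambda>y. f' y v) has_derivative D) (at u)" and "0 < e"
  shows "\<exists>d>0. \<forall>t. 0 < t \<and> t < d \<longrightarrow>
    \<bar>f (u + t *\<^sub>R v + t *\<^sub>R w) - f (u + t *\<^sub>R v) - f (u + t *\<^sub>R w) + f u - t\<^sup>2 * D w\<bar>
      \<le> e * t\<^sup>2 * (2 * norm v + norm w)"
proof -
  obtain d where d: "0 < d" and est: "\<And>y. norm (y - u) < d \<Longrightarrow> \<bar>f' y v - f' u v - D (y - u)\<bar> \<le> e * norm (y - u)"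
    using D \<open>0 < e\<close> unfolding has_derivative_at_alt real_norm_def by blast
  have linD: "linear D" using D has_derivative_linear by blast
  define N where "N = norm v + norm w + 1"
  have N: "N > 0" by (simp add: N_def add_nonneg_pos)
  \<comment> \<open>Keeps the parallelogram spanned by \<open>t *\<^sub>R v\<close> and
    \<open>t *\<^sub>R w\<close> inside the ball and inside the range of the estimate for
    \<open>D\<close>.\<close>
  define d' where "d' = min d r / N"
  have "d' > 0" using d S(2) N by (simp add: d'_def)
  moreover have "\<bar>f (u + t *\<^sub>R v + t *\<^sub>R w) - f (u + t *\<^sub>R v) - f (u + t *\<^sub>R w) + f u - t\<^sup>2 * D w\<bar>
      \<le> e * t\<^sup>2 * (2 * norm v + norm w)" if t: "0 < t" "t < d'" for t
  proof -
    have small: "norm (s *\<^sub>R v + s' *\<^sub>R w) < min d r" if "0 \<le> s" "s \<le> t" "0 \<le> s'" "s' \<le> t" for s s'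
    proof -
      have "norm (s *\<^sub>R v + s' *\<^sub>R w) \<le> s * norm v + s' * norm w"
        using norm_triangle_ineq[of "s *\<^sub>R v" "s' *\<^sub>R w"] that by simp
      also have "\<dots> \<le> t * norm v + t * norm w" using that by (intro add_mono mult_right_mono) auto
      also have "\<dots> \<le> t * N" using t by (simp add: N_def algebra_simps)
      also have "\<dots> < d' * N" using t N by simp
      finally show ?thesis using N by (simp add: d'_def)
    qed
    have inS: "u + s *\<^sub>R v + s' *\<^sub>R w \<in> S" if "0 \<le> s" "s \<le> t" "0 \<le> s'" "s' \<le> t" for s s'
    proof -
      have "dist u (u + z) = norm z" for z by (simp add: dist_norm)
      then have "u + s *\<^sub>R v + s' *\<^sub>R w \<in> ball u r"
        using small[OF that] by (simp only: mem_ball add.assoc)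
      then show ?thesis using S(1) by blast
    qed
    define \<phi> where "\<phi> = (\<lambda>s. f (u + s *\<^sub>R v + t *\<^sub>R w) - f (u + s *\<^sub>R v))"
    have der: "(\<phi> has_real_derivative f' (u + s *\<^sub>R v + t *\<^sub>R w) v - f' (u + s *\<^sub>R v) v) (at s)"
      if "0 \<le> s" "s \<le> t" for s
    proof -
      have 1: "u + s *\<^sub>R v + t *\<^sub>R w \<in> S" "u + s *\<^sub>R v \<in> S"
        using inS[of s t] inS[of s 0] that t by auto
      have "((\<lambda>s. f (u + s *\<^sub>R v + t *\<^sub>R w)) has_derivative (\<lambda>h. f' (u + s *\<^sub>R v + t *\<^sub>R w) (h *\<^sub>R v))) (at s)"
        by (rule has_derivative_compose[of "\<lambda>s. u + s *\<^sub>R v + t *\<^sub>R w" "\<lambda>h. h *\<^sub>R v" s UNIV f, OF _ f[OF 1(1)]])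
           (auto intro!: derivative_eq_intros)
      moreover have "((\<lambda>s. f (u + s *\<^sub>R v)) has_derivative (\<lambda>h. f' (u + s *\<^sub>R v) (h *\<^sub>R v))) (at s)"
        by (rule has_derivative_compose[of "\<lambda>s. u + s *\<^sub>R v" "\<lambda>h. h *\<^sub>R v" s UNIV f, OF _ f[OF 1(2)]])
           (auto intro!: derivative_eq_intros)
      ultimately have "(\<phi> has_derivative (\<lambda>h. f' (u + s *\<^sub>R v + t *\<^sub>R w) (h *\<^sub>R v) - f' (u + s *\<^sub>R v) (h *\<^sub>R v))) (at s)"
        unfolding \<phi>_def by (rule has_derivative_diff)
      moreover have "f' (u + s *\<^sub>R v + t *\<^sub>R w) (h *\<^sub>R v) = h * f' (u + s *\<^sub>R v + t *\<^sub>R w) v"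
        "f' (u + s *\<^sub>R v) (h *\<^sub>R v) = h * f' (u + s *\<^sub>R v) v" for h
        using linear_scale[OF has_derivative_linear[OF f[OF 1(1)]]]
          linear_scale[OF has_derivative_linear[OF f[OF 1(2)]]] by simp_all
      ultimately show ?thesis
        unfolding has_field_derivative_def
        by (auto elim!: has_derivative_eq_rhs simp: fun_eq_iff right_diff_distrib left_diff_distrib mult.commute)
    qed
    obtain s where s: "0 < s" "s < t" "\<phi> t - \<phi> 0 = (t - 0) * (f' (u + s *\<^sub>R v + t *\<^sub>R w) v - f' (u + s *\<^sub>R v) v)"
      using MVT2[of 0 t \<phi> "\<lambda>s. f' (u + s *\<^sub>R v + t *\<^sub>R w) v - f' (u + s *\<^sub>R v) v"] der t by auto
    let ?a = "f' (u + s *\<^sub>R v + t *\<^sub>R w) v - f' u v - D (s *\<^sub>R v + t *\<^sub>R w)"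
    let ?b = "f' (u + s *\<^sub>R v) v - f' u v - D (s *\<^sub>R v)"
    have "D (s *\<^sub>R v + t *\<^sub>R w) - D (s *\<^sub>R v) = t * D w"
      using linD by (simp add: linear_add linear_scale)
    then have eq: "\<phi> t - \<phi> 0 - t\<^sup>2 * D w = t * (?a - ?b)"
      by (simp add: s(3) power2_eq_square algebra_simps)
    have "\<bar>?a\<bar> \<le> e * norm (s *\<^sub>R v + t *\<^sub>R w)"
      using est[of "u + s *\<^sub>R v + t *\<^sub>R w"] small[of s t] s t by (simp add: add.assoc)
    also have "\<dots> \<le> e * (t * norm v + t * norm w)"
    proof (intro mult_left_mono)
      have "norm (s *\<^sub>R v + t *\<^sub>R w) \<le> s * norm v + t * norm w"
        using norm_triangle_ineq[of "s *\<^sub>R v" "t *\<^sub>R w"] s t by simp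
      also have "\<dots> \<le> t * norm v + t * norm w" using s by (intro add_right_mono mult_right_mono) auto
      finally show "norm (s *\<^sub>R v + t *\<^sub>R w) \<le> t * norm v + t * norm w" .
    qed (use \<open>0 < e\<close> in simp)
    finally have a: "\<bar>?a\<bar> \<le> e * (t * norm v + t * norm w)" .
    have "\<bar>?b\<bar> \<le> e * norm (s *\<^sub>R v)"
      using est[of "u + s *\<^sub>R v"] small[of s 0] s t by simp
    also have "\<dots> \<le> e * (t * norm v)" using s \<open>0 < e\<close> by (intro mult_left_mono) (auto intro: mult_right_mono)
    finally have b: "\<bar>?b\<bar> \<le> e * (t * norm v)" .
    have "\<bar>\<phi> t - \<phi> 0 - t\<^sup>2 * D w\<bar> = t * \<bar>?a - ?b\<bar>" using t by (simp only: eq abs_mult)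
    also have "\<dots> \<le> t * (e * (t * norm v + t * norm w) + e * (t * norm v))"
      using a b t by (intro mult_left_mono) auto
    also have "\<dots> = e * t\<^sup>2 * (2 * norm v + norm w)" by (simp add: power2_eq_square algebra_simps)
    finally show ?thesis by (simp add: \<phi>_def algebra_simps)
  qed
  ultimately show ?thesis by blast
qed

text \<open>The second difference of \<open>f\<close> is symmetric in \<open>v\<close> and
  \<open>w\<close>, and both \<open>t^2 * D w\<close> and \<open>t^2 * E v\<close> approximate it to
  higher order than \<open>t^2\<close>.\<close>

lemma second_derivative_symmetric_real:
  fixes f :: "'a::real_normed_vector \<Rightarrow> real"
  assumes "open S" "u \<in> S"
    and f: "\<And>y. y \<in> S \<Longrightarrow> (f has_derivative f' y) (at y)"
    and D: "((\<lambda>y. f' y v) has_derivative D) (at u)"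
    and E: "((\<lambda>y. f' y w) has_derivative E) (at u)"
  shows "D w = E v"
proof (rule ccontr)
  assume ne: "D w \<noteq> E v"
  obtain r where r: "ball u r \<subseteq> S" "0 < r" using assms(1,2) open_contains_ball by blast
  define N where "N = 3 * norm v + 3 * norm w + 1"
  have N: "N > 0" by (simp add: N_def add_nonneg_pos)
  \<comment> \<open>Makes the combined error, relative to \<open>t^2\<close>, at most half of the
    assumed gap.\<close>
  define e where "e = \<bar>D w - E v\<bar> / (2 * N)"
  have e: "e > 0" using ne N by (simp add: e_def)
  obtain d1 where d1: "d1 > 0" "\<And>t. 0 < t \<Longrightarrow> t < d1 \<Longrightarrow>
    \<bar>f (u + t *\<^sub>R v + t *\<^sub>R w) - f (u + t *\<^sub>R v) - f (u + t *\<^sub>R w) + f u - t\<^sup>2 * D w\<bar>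
      \<le> e * t\<^sup>2 * (2 * norm v + norm w)"
    using second_difference_bound[OF r f D e] by blast
  obtain d2 where d2: "d2 > 0" "\<And>t. 0 < t \<Longrightarrow> t < d2 \<Longrightarrow>
    \<bar>f (u + t *\<^sub>R w + t *\<^sub>R v) - f (u + t *\<^sub>R w) - f (u + t *\<^sub>R v) + f u - t\<^sup>2 * E v\<bar>
      \<le> e * t\<^sup>2 * (2 * norm w + norm v)"
    using second_difference_bound[OF r f E e] by blast
  define t where "t = min d1 d2 / 2"
  have t: "0 < t" "t < d1" "t < d2" using d1(1) d2(1) by (auto simp: t_def)
  have "f (u + t *\<^sub>R w + t *\<^sub>R v) = f (u + t *\<^sub>R v + t *\<^sub>R w)" by (simp only: add_ac)
  then have "\<bar>t\<^sup>2 * D w - t\<^sup>2 * E v\<bar> \<le> e * t\<^sup>2 * (2 * norm v + norm w) + e * t\<^sup>2 * (2 * norm w + norm v)"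
    using d1(2)[OF t(1,2)] d2(2)[OF t(1,3)] by linarith
  also have "\<dots> = t\<^sup>2 * (e * (3 * norm v + 3 * norm w))" by (simp add: algebra_simps)
  finally have "t\<^sup>2 * \<bar>D w - E v\<bar> \<le> t\<^sup>2 * (e * (3 * norm v + 3 * norm w))"
    by (simp add: right_diff_distrib[symmetric] abs_mult)
  then have "\<bar>D w - E v\<bar> \<le> e * (3 * norm v + 3 * norm w)" using t(1) by simp
  also have "\<dots> \<le> e * N" using e by (simp add: N_def)
  also have "\<dots> = \<bar>D w - E v\<bar> / 2" using N by (simp add: e_def)
  finally show False using ne by simp
qed

lemma second_differential_symmetric:
  fixes f :: "'a::euclidean_space \<Rightarrow> 'b::euclidean_space"
  assumes "open S" "smooth_on S f" "u \<in> S"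
  shows "differential (\<lambda>y. differential f y v) u w = differential (\<lambda>y. differential f y w) u v"
proof (rule euclidean_eqI)
  fix b :: 'b assume "b \<in> Basis"
  have 1: "((\<lambda>y. f y \<bullet> b) has_derivative (\<lambda>h. differential f y h \<bullet> b)) (at y)" if "y \<in> S" for y
    using smooth_on_has_derivative[OF assms(2) that] by (rule has_derivative_inner_left)
  have 2: "((\<lambda>y. differential f y v \<bullet> b) has_derivative (\<lambda>h. differential (\<lambda>y. differential f y v) u h \<bullet> b)) (at u)" for v
    using smooth_on_has_derivative[OF smooth_on_differential[OF assms(2)] assms(3)]
    by (rule has_derivative_inner_left)
  show "differential (\<lambda>y. differential f y v) u w \<bullet> b = differential (\<lambda>y. differential f y w) u v \<bullet> b"
    by (rule second_derivative_symmetric_real[OF assms(1,3) 1 2 2])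
qed

section \<open>Product rules for pointwise bilinear families\<close>

lemma bilinear_expand:
  fixes B :: "'b::euclidean_space \<Rightarrow> 'c::euclidean_space \<Rightarrow> 'd::real_vector"
  assumes "bilinear B"
  shows "B v w = (\<Sum>a\<in>Basis. \<Sum>b\<in>Basis. ((v \<bullet> a) * (w \<bullet> b)) *\<^sub>R B a b)"
proof -
  have "B v w = B (\<Sum>a\<in>Basis. (v \<bullet> a) *\<^sub>R a) (\<Sum>b\<in>Basis. (w \<bullet> b) *\<^sub>R b)"
    by (simp add: euclidean_representation)
  also have "\<dots> = (\<Sum>(a, b)\<in>Basis \<times> Basis. B ((v \<bullet> a) *\<^sub>R a) ((w \<bullet> b) *\<^sub>R b))"
    using assms by (rule bilinear_sum)
  also have "\<dots> = (\<Sum>a\<in>Basis. \<Sum>b\<in>Basis. B ((v \<bullet> a) *\<^sub>R a) ((w \<bullet> b) *\<^sub>R b))"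
    by (simp add: sum.cartesian_product)
  finally show ?thesis by (simp add: bilinear_lmul[OF assms] bilinear_rmul[OF assms] mult.commute)
qed

lemma differential_bilinear_expand:
  fixes B :: "'a::euclidean_space \<Rightarrow> 'b::euclidean_space \<Rightarrow> 'c::euclidean_space \<Rightarrow> 'd::real_normed_vector"
  assumes "open U" "u \<in> U" and bil: "\<And>y. y \<in> U \<Longrightarrow> bilinear (B y)"
    and diff: "\<And>v w. (\<lambda>y. B y v w) differentiable (at u)"
  shows "frechet_derivative (\<lambda>y. B y v w) (at u) z =
    (\<Sum>a\<in>Basis. \<Sum>b\<in>Basis. ((v \<bullet> a) * (w \<bullet> b)) *\<^sub>R frechet_derivative (\<lambda>y. B y a b) (at u) z)"
proof -
  have "((\<lambda>y. \<Sum>a\<in>Basis. \<Sum>b\<in>Basis. ((v \<bullet> a) * (w \<bullet> b)) *\<^sub>R B y a b) has_derivative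
    (\<lambda>z. \<Sum>a\<in>Basis. \<Sum>b\<in>Basis. ((v \<bullet> a) * (w \<bullet> b)) *\<^sub>R frechet_derivative (\<lambda>y. B y a b) (at u) z)) (at u)"
    using diff frechet_derivative_works by (intro has_derivative_sum has_derivative_scaleR_right) blast
  then have "((\<lambda>y. B y v w) has_derivative
    (\<lambda>z. \<Sum>a\<in>Basis. \<Sum>b\<in>Basis. ((v \<bullet> a) * (w \<bullet> b)) *\<^sub>R frechet_derivative (\<lambda>y. B y a b) (at u) z)) (at u)"
    by (rule has_derivative_transform_within_open[OF _ assms(1,2)])
      (rule bilinear_expand[OF bil, symmetric])
  then show ?thesis by (simp flip: frechet_derivative_at)
qed

lemma bilinear_differential:
  fixes B :: "'a::euclidean_space \<Rightarrow> 'b::euclidean_space \<Rightarrow> 'c::euclidean_space \<Rightarrow> 'd::real_normed_vector"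
  assumes "open U" "u \<in> U" and bil: "\<And>y. y \<in> U \<Longrightarrow> bilinear (B y)"
    and diff: "\<And>v w. (\<lambda>y. B y v w) differentiable (at u)"
  shows "bilinear (\<lambda>v w. frechet_derivative (\<lambda>y. B y v w) (at u) z)"
proof -
  define E where "E = (\<lambda>a b. frechet_derivative (\<lambda>y. B y a b) (at u) z)"
  have E: "frechet_derivative (\<lambda>y. B y v w) (at u) z =
    (\<Sum>a\<in>Basis. \<Sum>b\<in>Basis. ((v \<bullet> a) * (w \<bullet> b)) *\<^sub>R E a b)" for v w
    unfolding E_def by (rule differential_bilinear_expand[OF assms])
  show ?thesis
    unfolding bilinear_def linear_iff E
    by (simp add: inner_add_left distrib_right distrib_left scaleR_add_left sum.distrib
      scaleR_sum_right mult.assoc mult.left_commute)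
qed

text \<open>Metrics and Christoffel symbols are given as bilinear maps at each point, differentiable
  in the point for fixed arguments. Expansion in a basis reduces the three-term rule to products of
  finitely many coefficients.\<close>

lemma has_derivative_bilinear_field:
  fixes B :: "'a::euclidean_space \<Rightarrow> 'b::euclidean_space \<Rightarrow> 'c::euclidean_space \<Rightarrow> 'd::real_normed_vector"
    and \<phi> :: "'n::real_normed_vector \<Rightarrow> 'a"
  assumes "open U" "\<phi> x \<in> U" and bil: "\<And>y. y \<in> U \<Longrightarrow> bilinear (B y)"
    and diff: "\<And>v w. (\<lambda>y. B y v w) differentiable (at (\<phi> x))"
    and \<phi>: "(\<phi> has_derivative \<phi>') (at x)"
    and \<xi>: "(\<xi> has_derivative \<xi>') (at x)" and \<eta>: "(\<eta> has_derivative \<eta>') (at x)"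
  shows "((\<lambda>y. B (\<phi> y) (\<xi> y) (\<eta> y)) has_derivative
    (\<lambda>h. frechet_derivative (\<lambda>y. B y (\<xi> x) (\<eta> x)) (at (\<phi> x)) (\<phi>' h) + B (\<phi> x) (\<xi>' h) (\<eta> x)
      + B (\<phi> x) (\<xi> x) (\<eta>' h))) (at x)"
proof -
  have B: "((\<lambda>y. B (\<phi> y) a b) has_derivative (\<lambda>h. frechet_derivative (\<lambda>y. B y a b) (at (\<phi> x)) (\<phi>' h))) (at x)" for a b
    using has_derivative_compose[OF \<phi> frechet_derivative_works[THEN iffD1, OF diff]] .
  have c: "((\<lambda>y. (\<xi> y \<bullet> a) * (\<eta> y \<bullet> b)) has_derivative
     (\<lambda>h. (\<xi> x \<bullet> a) * (\<eta>' h \<bullet> b) + (\<xi>' h \<bullet> a) * (\<eta> x \<bullet> b))) (at x)" for a b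
    by (intro has_derivative_mult has_derivative_inner_left \<xi> \<eta>)
  have "((\<lambda>y. \<Sum>a\<in>Basis. \<Sum>b\<in>Basis. ((\<xi> y \<bullet> a) * (\<eta> y \<bullet> b)) *\<^sub>R B (\<phi> y) a b) has_derivative
    (\<lambda>h. \<Sum>a\<in>Basis. \<Sum>b\<in>Basis.
      ((\<xi> x \<bullet> a) * (\<eta> x \<bullet> b)) *\<^sub>R frechet_derivative (\<lambda>y. B y a b) (at (\<phi> x)) (\<phi>' h) +
      ((\<xi> x \<bullet> a) * (\<eta>' h \<bullet> b) + (\<xi>' h \<bullet> a) * (\<eta> x \<bullet> b)) *\<^sub>R B (\<phi> x) a b)) (at x)"
    by (intro has_derivative_sum has_derivative_scaleR B c)
  also have "(\<lambda>h. \<Sum>a\<in>Basis. \<Sum>b\<in>Basis.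
      ((\<xi> x \<bullet> a) * (\<eta> x \<bullet> b)) *\<^sub>R frechet_derivative (\<lambda>y. B y a b) (at (\<phi> x)) (\<phi>' h) +
      ((\<xi> x \<bullet> a) * (\<eta>' h \<bullet> b) + (\<xi>' h \<bullet> a) * (\<eta> x \<bullet> b)) *\<^sub>R B (\<phi> x) a b) =
    (\<lambda>h. frechet_derivative (\<lambda>y. B y (\<xi> x) (\<eta> x)) (at (\<phi> x)) (\<phi>' h) + B (\<phi> x) (\<xi>' h) (\<eta> x)
      + B (\<phi> x) (\<xi> x) (\<eta>' h))"
  proof
    fix h
    have "frechet_derivative (\<lambda>y. B y (\<xi> x) (\<eta> x)) (at (\<phi> x)) (\<phi>' h) =
      (\<Sum>a\<in>Basis. \<Sum>b\<in>Basis. ((\<xi> x \<bullet> a) * (\<eta> x \<bullet> b)) *\<^sub>R frechet_derivative (\<lambda>y. B y a b) (at (\<phi> x)) (\<phi>' h))"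
      by (rule differential_bilinear_expand[OF assms(1-4)])
    moreover have "B (\<phi> x) (\<xi>' h) (\<eta> x) = (\<Sum>a\<in>Basis. \<Sum>b\<in>Basis. ((\<xi>' h \<bullet> a) * (\<eta> x \<bullet> b)) *\<^sub>R B (\<phi> x) a b)"
      "B (\<phi> x) (\<xi> x) (\<eta>' h) = (\<Sum>a\<in>Basis. \<Sum>b\<in>Basis. ((\<xi> x \<bullet> a) * (\<eta>' h \<bullet> b)) *\<^sub>R B (\<phi> x) a b)"
      by (rule bilinear_expand[OF bil[OF assms(2)]])+
    ultimately show "(\<Sum>a\<in>Basis. \<Sum>b\<in>Basis.
      ((\<xi> x \<bullet> a) * (\<eta> x \<bullet> b)) *\<^sub>R frechet_derivative (\<lambda>y. B y a b) (at (\<phi> x)) (\<phi>' h) +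
      ((\<xi> x \<bullet> a) * (\<eta>' h \<bullet> b) + (\<xi>' h \<bullet> a) * (\<eta> x \<bullet> b)) *\<^sub>R B (\<phi> x) a b) =
      frechet_derivative (\<lambda>y. B y (\<xi> x) (\<eta> x)) (at (\<phi> x)) (\<phi>' h) + B (\<phi> x) (\<xi>' h) (\<eta> x)
        + B (\<phi> x) (\<xi> x) (\<eta>' h)"
      by (simp add: sum.distrib scaleR_add_left)
  qed
  finally have *: "((\<lambda>y. \<Sum>a\<in>Basis. \<Sum>b\<in>Basis. ((\<xi> y \<bullet> a) * (\<eta> y \<bullet> b)) *\<^sub>R B (\<phi> y) a b) has_derivative
    (\<lambda>h. frechet_derivative (\<lambda>y. B y (\<xi> x) (\<eta> x)) (at (\<phi> x)) (\<phi>' h) + B (\<phi> x) (\<xi>' h) (\<eta> x)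
      + B (\<phi> x) (\<xi> x) (\<eta>' h))) (at x)" .
  have "\<forall>\<^sub>F y in at x. \<phi> y \<in> U"
    using has_derivative_continuous[OF \<phi>] assms(1,2)
    by (auto simp: continuous_within intro: topological_tendstoD)
  then have "\<forall>\<^sub>F y in at x. (\<Sum>a\<in>Basis. \<Sum>b\<in>Basis. ((\<xi> y \<bullet> a) * (\<eta> y \<bullet> b)) *\<^sub>R B (\<phi> y) a b) = B (\<phi> y) (\<xi> y) (\<eta> y)"
    by eventually_elim (rule bilinear_expand[OF bil, symmetric])
  then show ?thesis
    by (rule has_derivative_transform_eventually[OF *])
      (rule bilinear_expand[OF bil[OF assms(2)], symmetric], simp)
qed

text \<open>The bilinear rule for \<open>w *\<^sub>R L y v\<close>, with the constant 1 as the
  second field.\<close>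

lemma has_derivative_linear_field:
  fixes L :: "'a::euclidean_space \<Rightarrow> 'b::euclidean_space \<Rightarrow> 'd::real_normed_vector"
    and \<phi> :: "'n::real_normed_vector \<Rightarrow> 'a"
  assumes "open U" "\<phi> x \<in> U" and lin: "\<And>y. y \<in> U \<Longrightarrow> linear (L y)"
    and diff: "\<And>v. (\<lambda>y. L y v) differentiable (at (\<phi> x))"
    and \<phi>: "(\<phi> has_derivative \<phi>') (at x)" and \<xi>: "(\<xi> has_derivative \<xi>') (at x)"
  shows "((\<lambda>y. L (\<phi> y) (\<xi> y)) has_derivative
    (\<lambda>h. frechet_derivative (\<lambda>y. L y (\<xi> x)) (at (\<phi> x)) (\<phi>' h) + L (\<phi> x) (\<xi>' h))) (at x)"
proof -
  have "((\<lambda>y. (1::real) *\<^sub>R L (\<phi> y) (\<xi> y)) has_derivative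
    (\<lambda>h. frechet_derivative (\<lambda>y. (1::real) *\<^sub>R L y (\<xi> x)) (at (\<phi> x)) (\<phi>' h) + 1 *\<^sub>R L (\<phi> x) (\<xi>' h)
      + 0 *\<^sub>R L (\<phi> x) (\<xi> x))) (at x)"
  proof (rule has_derivative_bilinear_field[OF assms(1,2) _ _ \<phi> \<xi>, where \<eta> = "\<lambda>_. 1::real" and \<eta>' = "\<lambda>_. 0"
      and B = "\<lambda>y v w. w *\<^sub>R L y v"])
    show "bilinear (\<lambda>v w. w *\<^sub>R L y v)" if "y \<in> U" for y
      using lin[OF that] by (auto simp: bilinear_def linear_iff scaleR_add_right scaleR_add_left)
    show "(\<lambda>y. w *\<^sub>R L y v) differentiable at (\<phi> x)" for v w
      using diff by simp
  qed simp
  then show ?thesis by simp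
qed

section \<open>Levi-Civita connection and curvature in a chart\<close>

text \<open>At a zero of \<open>h\<close>, continuity of \<open>p\<close> does the work of
  differentiability, because \<open>(p y - p u) * h' (y - u)\<close> is already of higher order.
  This is the last stage of the bootstrap for implicit solutions.\<close>

lemma has_derivative_mult_continuous_vanishing:
  fixes h p :: "'a::real_normed_vector \<Rightarrow> real"
  assumes h: "(h has_derivative h') (at u)" and "h u = 0" and p: "isCont p u"
  shows "((\<lambda>y. p y * h y) has_derivative (\<lambda>z. p u * h' z)) (at u)"
proof -
  have lin: "bounded_linear h'" using h has_derivative_bounded_linear by blast
  obtain K where K: "\<And>z. norm (h' z) \<le> norm z * K" "K > 0"
    using bounded_linear.pos_bounded[OF lin] by blast
  show ?thesis
    unfolding has_derivative_at_alt
  proof (intro conjI allI impI)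
    show "bounded_linear (\<lambda>z. p u * h' z)" using lin by (rule bounded_linear_mult_right[THEN bounded_linear_compose])
    fix e :: real assume e: "e > 0"
    define M where "M = \<bar>p u\<bar> + 1 + K"
    have M: "M > 0" using K by (simp add: M_def add_nonneg_pos)
    define e' where "e' = min 1 (e / (2 * M))"
    have e': "0 < e'" "e' \<le> 1" using e M by (auto simp: e'_def)
    have e'M: "e' * (2 * M) \<le> e"
    proof -
      have "e' * (2 * M) \<le> e / (2 * M) * (2 * M)" using M by (intro mult_right_mono) (auto simp: e'_def)
      then show ?thesis using M by simp
    qed
    obtain d1 where d1: "d1 > 0" "\<And>y. norm (y - u) < d1 \<Longrightarrow> norm (h y - h u - h' (y - u)) \<le> e' * norm (y - u)"
      using h e'(1) unfolding has_derivative_at_alt by blast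
    obtain d2 where d2: "d2 > 0" "\<And>y. norm (y - u) < d2 \<Longrightarrow> \<bar>p y - p u\<bar> < e'"
      using p e'(1) unfolding continuous_at_eps_delta dist_norm real_norm_def by blast
    have "norm (p y * h y - p u * h u - p u * h' (y - u)) \<le> e * norm (y - u)"
      if y: "norm (y - u) < min d1 d2" for y
    proof -
      have 1: "\<bar>h y - h' (y - u)\<bar> \<le> e' * norm (y - u)" using d1(2)[of y] y \<open>h u = 0\<close> by simp
      have 2: "\<bar>p y - p u\<bar> \<le> e'" using d2(2)[of y] y by simp
      have 3: "\<bar>h' (y - u)\<bar> \<le> K * norm (y - u)" using K(1)[of "y - u"] by (simp add: mult.commute)
      have py: "\<bar>p y\<bar> \<le> \<bar>p u\<bar> + 1" using 2 e' by linarith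
      have "p y * h y - p u * h u - p u * h' (y - u) = p y * (h y - h' (y - u)) + (p y - p u) * h' (y - u)"
        using \<open>h u = 0\<close> by (simp add: algebra_simps)
      also have "\<bar>\<dots>\<bar> \<le> \<bar>p y\<bar> * \<bar>h y - h' (y - u)\<bar> + \<bar>p y - p u\<bar> * \<bar>h' (y - u)\<bar>"
        by (simp add: abs_triangle_ineq flip: abs_mult)
      also have "\<dots> \<le> (\<bar>p u\<bar> + 1) * (e' * norm (y - u)) + e' * (K * norm (y - u))"
        using 1 2 3 py by (intro add_mono mult_mono) auto
      also have "\<dots> = e' * M * norm (y - u)" by (simp add: M_def algebra_simps)
      also have "\<dots> \<le> e * norm (y - u)" using e'M mult_pos_pos[OF e'(1) M] by (intro mult_right_mono) (linarith, simp)
      finally show ?thesis by simp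
    qed
    then show "\<exists>d>0. \<forall>y. norm (y - u) < d \<longrightarrow> norm (p y * h y - p u * h u - p u * h' (y - u)) \<le> e * norm (y - u)"
      using d1(1) d2(1) by (intro exI[of _ "min d1 d2"]) auto
  qed
qed

text \<open>
  The equation at \<open>y\<close>, tested against the dual basis of \<open>g u\<close>, expresses \<open>c y\<close> through \<open>k y\<close> and
  \<open>(g y - g u) (c y)\<close>. This gives local boundedness of \<open>c\<close>, then continuity, then differentiability.
\<close>

lemma differentiable_bilinear_solution:
  fixes g :: "'a::euclidean_space \<Rightarrow> 'b::euclidean_space \<Rightarrow> 'b \<Rightarrow> real" and c :: "'a \<Rightarrow> 'b"
  assumes U: "open U" "u \<in> U" and bil: "\<And>y. y \<in> U \<Longrightarrow> bilinear (g y)"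
    and dual: "\<And>e. e \<in> Basis \<Longrightarrow> \<exists>d. \<forall>x. g u x d = x \<bullet> e"
    and g: "\<And>a b. (\<lambda>y. g y a b) differentiable (at u)"
    and c: "\<And>y z. y \<in> U \<Longrightarrow> g y (c y) z = k y z"
    and k: "\<And>z. (\<lambda>y. k y z) differentiable (at u)"
  shows "c differentiable (at u)"
proof -
  obtain d where d: "\<And>e x. e \<in> Basis \<Longrightarrow> g u x (d e) = x \<bullet> e" using dual by metis
  \<comment> \<open>The deviation of the metric at \<open>y\<close> from the metric at
    \<open>u\<close>; it vanishes at \<open>u\<close>, which is the zero that the preceding product
    rule asks for.\<close>
  define h where "h = (\<lambda>e a y. g y a (d e) - g u a (d e))"
  have hu: "h e a u = 0" for e a by (simp add: h_def)
  have h_diff: "(h e a) differentiable (at u)" for e a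
    unfolding h_def by (intro differentiable_diff g differentiable_const)
  have h_lim: "(h e a \<longlongrightarrow> 0) (at u)" for e a
    using differentiable_imp_continuous_within[OF h_diff[of e a]] by (simp add: continuous_within hu)
  have k_lim: "((\<lambda>y. k y z) \<longlongrightarrow> k u z) (at u)" for z
    using differentiable_imp_continuous_within[OF k[of z]] by (simp add: continuous_within)
  have eq: "c y \<bullet> e = k y (d e) - (\<Sum>a\<in>Basis. (c y \<bullet> a) * h e a y)" if "y \<in> U" "e \<in> Basis" for y e
  proof -
    have "(\<Sum>a\<in>Basis. (c y \<bullet> a) * g z a (d e)) = g z (c y) (d e)" if "z \<in> U" for z
    proof -
      have lin: "linear (\<lambda>x. g z x (d e))" using bil[OF that] by (simp add: bilinear_def)
      have "g z (c y) (d e) = g z (\<Sum>a\<in>Basis. (c y \<bullet> a) *\<^sub>R a) (d e)" by (simp add: euclidean_representation)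
      also have "\<dots> = (\<Sum>a\<in>Basis. (c y \<bullet> a) * g z a (d e))"
        by (simp only: linear_sum[OF lin] linear_scale[OF lin] real_scaleR_def)
      finally show ?thesis by simp
    qed
    then have "(\<Sum>a\<in>Basis. (c y \<bullet> a) * h e a y) = g y (c y) (d e) - g u (c y) (d e)"
      using that U(2) by (simp add: h_def right_diff_distrib sum_subtractf)
    then show ?thesis using c[OF that(1)] d[OF that(2)] by simp
  qed
  define M where "M = (\<lambda>y. \<Sum>e\<in>Basis. \<bar>c y \<bullet> e\<bar>)"
  define H where "H = (\<lambda>y. \<Sum>e\<in>Basis. \<Sum>a\<in>Basis. \<bar>h e a y\<bar>)"
  define Q where "Q = (\<lambda>y. \<Sum>e\<in>Basis. \<bar>k y (d e)\<bar>)"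
  have nearU: "\<forall>\<^sub>F y in at u. y \<in> U" using U by (rule eventually_at_in_open')
  have "(H \<longlongrightarrow> (\<Sum>e\<in>(Basis::'b set). \<Sum>a\<in>(Basis::'b set). \<bar>0\<bar>)) (at u)"
    unfolding H_def by (intro tendsto_intros h_lim)
  then have H_small: "\<forall>\<^sub>F y in at u. H y < 1 / 2" by (rule order_tendstoD) simp
  have "(Q \<longlongrightarrow> (\<Sum>e\<in>Basis. \<bar>k u (d e)\<bar>)) (at u)"
    unfolding Q_def by (intro tendsto_intros k_lim)
  then have Q_bd: "\<forall>\<^sub>F y in at u. Q y < Q u + 1" by (rule order_tendstoD) (simp add: Q_def)
  \<comment> \<open>Near \<open>u\<close> the coefficient sum \<open>H\<close> is below 1/2, so the
    term that contains \<open>c\<close> itself is at most half of \<open>M\<close> and is absorbed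
    on the left.\<close>
  have M_bd: "\<forall>\<^sub>F y in at u. M y \<le> 2 * (Q u + 1)"
    using nearU H_small Q_bd
  proof eventually_elim
    case (elim y)
    have ca: "\<bar>c y \<bullet> a\<bar> \<le> M y" if "a \<in> Basis" for a
      unfolding M_def using that by (intro member_le_sum) auto
    have "M y \<le> (\<Sum>e\<in>Basis. \<bar>k y (d e)\<bar> + (\<Sum>a\<in>Basis. M y * \<bar>h e a y\<bar>))"
      unfolding M_def
    proof (rule sum_mono)
      fix e :: 'b assume e: "e \<in> Basis"
      have "\<bar>c y \<bullet> e\<bar> \<le> \<bar>k y (d e)\<bar> + \<bar>\<Sum>a\<in>Basis. (c y \<bullet> a) * h e a y\<bar>"
        unfolding eq[OF elim(1) e] by (rule abs_triangle_ineq4)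
      also have "\<bar>\<Sum>a\<in>Basis. (c y \<bullet> a) * h e a y\<bar> \<le> (\<Sum>a\<in>Basis. \<bar>(c y \<bullet> a) * h e a y\<bar>)"
        by (rule sum_abs)
      also have "\<dots> \<le> (\<Sum>a\<in>Basis. M y * \<bar>h e a y\<bar>)"
        using ca by (intro sum_mono) (simp add: abs_mult mult_right_mono)
      finally show "\<bar>c y \<bullet> e\<bar> \<le> \<bar>k y (d e)\<bar> + (\<Sum>a\<in>Basis. (\<Sum>e\<in>Basis. \<bar>c y \<bullet> e\<bar>) * \<bar>h e a y\<bar>)"
        by (simp add: M_def)
    qed
    also have "\<dots> = Q y + M y * H y" by (simp add: Q_def H_def sum.distrib sum_distrib_left)
    also have "\<dots> \<le> Q y + M y * (1 / 2)"
      using elim(2) by (intro add_left_mono mult_left_mono) (auto simp: M_def intro: sum_nonneg)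
    finally show "M y \<le> 2 * (Q u + 1)" using elim(3) by simp
  qed
  have ch: "((\<lambda>y. (c y \<bullet> a) * h e a y) \<longlongrightarrow> 0) (at u)" if "a \<in> Basis" for e a
  proof (rule tendsto_0_le[OF h_lim[of e a], where K = "2 * (Q u + 1)"])
    show "\<forall>\<^sub>F y in at u. norm ((c y \<bullet> a) * h e a y) \<le> norm (h e a y) * (2 * (Q u + 1))"
      using M_bd
    proof eventually_elim
      case (elim y)
      have "\<bar>c y \<bullet> a\<bar> \<le> M y" unfolding M_def using that by (intro member_le_sum) auto
      then have "\<bar>c y \<bullet> a\<bar> \<le> 2 * (Q u + 1)" using elim by simp
      from mult_right_mono[OF this abs_ge_zero[of "h e a y"]]
      show ?case by (simp add: abs_mult mult.commute)
    qed
  qed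
  have cont: "isCont (\<lambda>y. c y \<bullet> e) u" if e: "e \<in> Basis" for e
  proof -
    have "((\<lambda>y. k y (d e) - (\<Sum>a\<in>Basis. (c y \<bullet> a) * h e a y)) \<longlongrightarrow> k u (d e) - (\<Sum>a\<in>(Basis::'b set). 0)) (at u)"
      by (intro tendsto_diff tendsto_sum k_lim ch)
    moreover have "\<forall>\<^sub>F y in at u. k y (d e) - (\<Sum>a\<in>Basis. (c y \<bullet> a) * h e a y) = c y \<bullet> e"
      using nearU by eventually_elim (simp add: eq e)
    moreover have "c u \<bullet> e = k u (d e)" using eq[OF U(2) e] by (simp add: hu)
    ultimately show ?thesis unfolding isCont_def by (simp add: tendsto_cong)
  qed
  have "(\<lambda>y. c y \<bullet> e) differentiable (at u)" if e: "e \<in> Basis" for e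
  proof -
    have "(\<lambda>y. (c y \<bullet> a) * h e a y) differentiable (at u)" if "a \<in> Basis" for a
      using has_derivative_mult_continuous_vanishing[OF frechet_derivative_works[THEN iffD1, OF h_diff] hu cont[OF that]]
      unfolding differentiable_def by blast
    then have "(\<lambda>y. k y (d e) - (\<Sum>a\<in>Basis. (c y \<bullet> a) * h e a y)) differentiable (at u)"
      by (intro differentiable_diff k differentiable_sum) auto
    then obtain D where "((\<lambda>y. k y (d e) - (\<Sum>a\<in>Basis. (c y \<bullet> a) * h e a y)) has_derivative D) (at u)"
      unfolding differentiable_def by blast
    then have "((\<lambda>y. c y \<bullet> e) has_derivative D) (at u)"
      by (rule has_derivative_transform_within_open[OF _ U]) (simp add: eq e)
    then show ?thesis unfolding differentiable_def by blast
  qed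
  then show ?thesis by (subst differentiable_componentwise_within) auto
qed

section \<open>The Levi-Civita connection of a metric on an open set\<close>

locale smooth_metric =
  fixes U :: "'a::euclidean_space set" and g :: "'a \<Rightarrow> 'a \<Rightarrow> 'a \<Rightarrow> real"
  assumes U: "open U"
    and bilinear_g: "\<And>u. u \<in> U \<Longrightarrow> bilinear (g u)"
    and g_sym: "\<And>u v w. u \<in> U \<Longrightarrow> g u v w = g u w v"
    and g_pos: "\<And>u v. u \<in> U \<Longrightarrow> v \<noteq> 0 \<Longrightarrow> 0 < g u v v"
    and g_smooth: "\<And>v w. smooth_on U (\<lambda>u. g u v w)"
begin

lemmas g_simps = bilinear_ladd[OF bilinear_g] bilinear_radd[OF bilinear_g]
  bilinear_lmul[OF bilinear_g] bilinear_rmul[OF bilinear_g]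
  bilinear_lsub[OF bilinear_g] bilinear_rsub[OF bilinear_g]
  bilinear_lzero[OF bilinear_g] bilinear_rzero[OF bilinear_g]

lemma g_sum_left: "u \<in> U \<Longrightarrow> g u (sum h A) z = (\<Sum>a\<in>A. g u (h a) z)"
  using linear_sum[of "\<lambda>x. g u x z"] bilinear_g by (auto simp: bilinear_def)

lemma g_sum_right: "u \<in> U \<Longrightarrow> g u z (sum h A) = (\<Sum>a\<in>A. g u z (h a))"
  using linear_sum[of "g u z"] bilinear_g by (auto simp: bilinear_def)

lemma g_nonneg: "u \<in> U \<Longrightarrow> 0 \<le> g u v v"
  using g_pos[of u v] by (cases "v = 0") (auto simp: g_simps)

lemma g_eqI:
  assumes "u \<in> U" "\<And>z. g u v z = g u w z"
  shows "v = w"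
proof -
  have "g u (v - w) (v - w) = 0" using assms by (simp add: g_simps)
  then show ?thesis using g_pos[OF assms(1), of "v - w"] by force
qed

lemma riesz:
  assumes "u \<in> U" "linear l"
  shows "\<exists>!b. \<forall>z. g u b z = l z"
proof -
  define G where "G = (\<lambda>b. \<Sum>c\<in>Basis. g u b c *\<^sub>R c)"
  have G: "G b \<bullet> z = g u b z" for b z
  proof -
    have lin: "linear (g u b)" using bilinear_g[OF assms(1)] by (simp add: bilinear_def)
    have "g u b z = g u b (\<Sum>c\<in>Basis. (z \<bullet> c) *\<^sub>R c)" by (simp add: euclidean_representation)
    also have "\<dots> = (\<Sum>c\<in>Basis. (z \<bullet> c) * g u b c)"
      by (simp only: linear_sum[OF lin] linear_scale[OF lin] real_scaleR_def)
    finally show ?thesis by (simp add: G_def inner_sum_left inner_commute[of z] mult.commute)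
  qed
  have "linear G"
    using assms(1) by (auto simp: linear_iff G_def g_simps scaleR_add_left sum.distrib scaleR_sum_right)
  moreover have "inj G"
  proof (rule injI)
    fix x y assume "G x = G y"
    then show "x = y" using g_eqI[OF assms(1), of x y] G by metis
  qed
  ultimately have "surj G" by (intro linear_injective_imp_surjective) auto
  then obtain b where b: "G b = (\<Sum>c\<in>Basis. l c *\<^sub>R c)" by (metis surjD)
  have "g u b z = l z" for z
  proof -
    have "g u b z = (\<Sum>c\<in>Basis. l c *\<^sub>R c) \<bullet> z" using G[of b z] b by simp
    also have "\<dots> = (\<Sum>c\<in>Basis. (z \<bullet> c) * l c)" by (simp add: inner_sum_left inner_commute[of z] mult.commute)
    also have "\<dots> = l (\<Sum>c\<in>Basis. (z \<bullet> c) *\<^sub>R c)"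
      by (simp only: linear_sum[OF assms(2)] linear_scale[OF assms(2)] real_scaleR_def)
    finally show ?thesis by (simp add: euclidean_representation)
  qed
  then show ?thesis using g_eqI[OF assms(1)] by (intro ex1I[of _ b]) auto
qed

definition dg :: "'a \<Rightarrow> 'a \<Rightarrow> 'a \<Rightarrow> 'a \<Rightarrow> real" where
  "dg u z v w = differential (\<lambda>y. g y v w) u z"

lemma g_differentiable: "u \<in> U \<Longrightarrow> (\<lambda>y. g y v w) differentiable (at u)"
  using smooth_on_imp_differentiable[OF g_smooth] .

lemma linear_dg: "u \<in> U \<Longrightarrow> linear (\<lambda>z. dg u z v w)"
  unfolding dg_def using linear_frechet_derivative[OF g_differentiable] .

lemma bilinear_dg: "u \<in> U \<Longrightarrow> bilinear (dg u z)"
  using bilinear_differential[OF U, of u g z] bilinear_g g_differentiable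
  unfolding dg_def[abs_def] by simp

lemma dg_sym: "u \<in> U \<Longrightarrow> dg u z v w = dg u z w v"
  unfolding dg_def
  by (rule fun_cong[OF frechet_derivative_transform_within_open[OF g_differentiable U]])
    (auto simp: g_sym)

lemmas dg_simps = bilinear_ladd[OF bilinear_dg] bilinear_radd[OF bilinear_dg]
  bilinear_lmul[OF bilinear_dg] bilinear_rmul[OF bilinear_dg]
  linear_add[OF linear_dg] linear_scale[OF linear_dg]

lemma dg_differentiable: "u \<in> U \<Longrightarrow> (\<lambda>y. dg y z v w) differentiable (at u)"
  unfolding dg_def using smooth_on_imp_differentiable[OF smooth_on_differential[OF g_smooth]] .

abbreviation \<Gamma> where "\<Gamma> \<equiv> christoffel g"

text \<open>Gives the definite description in \<open>christoffel\<close> its meaning: the right-hand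
  side is linear in \<open>z\<close>, hence represented by exactly one vector.\<close>

lemma koszul:
  assumes "u \<in> U"
  shows "2 * g u (\<Gamma> u v w) z = dg u v w z + dg u w v z - dg u z v w"
proof -
  define l where "l = (\<lambda>z. (dg u v w z + dg u w v z - dg u z v w) / 2)"
  have "linear l" using assms by (auto simp: l_def linear_iff dg_simps field_simps)
  then have ex: "\<exists>!b. \<forall>z. g u b z = l z" using riesz[OF assms] by blast
  have "(\<forall>z. 2 * g u b z = differential (\<lambda>y. g y w z) u v + differential (\<lambda>y. g y v z) u w
    - differential (\<lambda>y. g y v w) u z) \<longleftrightarrow> (\<forall>z. g u b z = l z)" for b
    by (auto simp: l_def dg_def field_simps)
  then have "\<Gamma> u v w = (THE b. \<forall>z. g u b z = l z)" by (simp add: christoffel_def)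
  then have "\<forall>z. g u (\<Gamma> u v w) z = l z" using theI'[OF ex] by simp
  then have "g u (\<Gamma> u v w) z = l z" by blast
  then show ?thesis by (simp add: l_def)
qed

lemma christoffel_sym: "u \<in> U \<Longrightarrow> \<Gamma> u v w = \<Gamma> u w v"
proof (rule g_eqI)
  fix z assume "u \<in> U"
  then show "g u (\<Gamma> u v w) z = g u (\<Gamma> u w v) z"
    using koszul[of u v w z] koszul[of u w v z] dg_sym[of u z v w] by simp
qed

lemma bilinear_christoffel:
  assumes "u \<in> U" shows "bilinear (\<Gamma> u)"
proof -
  have "linear (\<lambda>w. \<Gamma> u v w)" for v
  proof (rule linearI)
    show "\<Gamma> u v (w + w') = \<Gamma> u v w + \<Gamma> u v w'" for w w'
    proof (rule g_eqI[OF assms])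
      show "g u (\<Gamma> u v (w + w')) z = g u (\<Gamma> u v w + \<Gamma> u v w') z" for z
        using koszul[OF assms, of v "w + w'" z] koszul[OF assms, of v w z] koszul[OF assms, of v w' z]
        by (simp add: g_simps dg_simps assms)
    qed
    show "\<Gamma> u v (r *\<^sub>R w) = r *\<^sub>R \<Gamma> u v w" for r w
    proof (rule g_eqI[OF assms])
      fix z
      have "2 * g u (\<Gamma> u v (r *\<^sub>R w)) z = r * (2 * g u (\<Gamma> u v w) z)"
        unfolding koszul[OF assms] by (simp add: dg_simps assms algebra_simps)
      then show "g u (\<Gamma> u v (r *\<^sub>R w)) z = g u (r *\<^sub>R \<Gamma> u v w) z"
        by (simp add: g_simps assms)
    qed
  qed
  then show ?thesis
    unfolding bilinear_def using christoffel_sym[OF assms] by simp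
qed

text \<open>The symbols are accessible only as solutions of the Koszul equation, whose coefficients
  and right-hand side are differentiable in the point.\<close>

lemma christoffel_differentiable:
  assumes "u \<in> U" shows "(\<lambda>y. \<Gamma> y v w) differentiable (at u)"
proof (rule differentiable_bilinear_solution[OF U assms bilinear_g])
  show "\<exists>d. \<forall>x. g u x d = x \<bullet> e" for e
  proof -
    have "linear (\<lambda>x. x \<bullet> e)" by (simp add: linear_iff inner_add_left)
    then show ?thesis using riesz[OF assms, of "\<lambda>x. x \<bullet> e"] g_sym[OF assms] by metis
  qed
  show "g y (\<Gamma> y v w) z = (dg y v w z + dg y w v z - dg y z v w) / 2" if "y \<in> U" for y z
    using koszul[OF that, of v w z] by simp
  show "(\<lambda>y. (dg y v w z + dg y w v z - dg y z v w) / 2) differentiable at u" for z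
    by (intro differentiable_divide differentiable_diff differentiable_add dg_differentiable assms) auto
qed (use g_differentiable[OF assms] in auto)

text \<open>Add the Koszul equations for \<open>(z, v, w)\<close> and \<open>(z, w, v)\<close>: the
  derivatives in the directions \<open>v\<close> and \<open>w\<close> cancel.\<close>

lemma metric_compatible:
  assumes "u \<in> U"
  shows "dg u z v w = g u (\<Gamma> u z v) w + g u v (\<Gamma> u z w)"
  using koszul[OF assms, of z v w] koszul[OF assms, of z w v] g_sym[OF assms, of v "\<Gamma> u z w"]
    dg_sym[OF assms, of z v w] by simp

end

section \<open>Sectional curvature determines the curvature tensor\<close>

text \<open>Polarisation of an algebraic curvature tensor whose sectional values vanish. It will be
  applied to the difference between the curvature tensor and the constant curvature model.\<close>

lemma curvature_form_zero:
  fixes T :: "'v::ab_group_add \<Rightarrow> 'v \<Rightarrow> 'v \<Rightarrow> 'v \<Rightarrow> real"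
  assumes add1: "\<And>v v' w z x. T (v + v') w z x = T v w z x + T v' w z x"
    and add2: "\<And>v w w' z x. T v (w + w') z x = T v w z x + T v w' z x"
    and add3: "\<And>v w z z' x. T v w (z + z') x = T v w z x + T v w z' x"
    and add4: "\<And>v w z x x'. T v w z (x + x') = T v w z x + T v w z x'"
    and anti1: "\<And>v w z x. T v w z x = - T w v z x"
    and anti2: "\<And>v w z x. T v w z x = - T v w x z"
    and bianchi: "\<And>v w z x. T v w z x + T w z v x + T z v w x = 0"
    and diag: "\<And>v w. T v w w v = 0"
  shows "T v w z x = 0"
proof -
  \<comment> \<open>The octahedron argument: in a combination of four cyclic sums the antisymmetries
    cancel everything except two terms related by pair exchange.\<close>
  have pair: "T v w z x = T z x v w" for v w z x
    using bianchi[of v w z x] bianchi[of w z x v] bianchi[of z x v w] bianchi[of x v w z]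
      anti1[of w z v x] anti1[of z v w x] anti2[of w z v x] anti2[of z v w x]
      anti2[of z x w v] anti2[of x w z v] anti2[of w z x v] anti1[of x v z w] anti1[of z x v w]
      anti2[of x v z w] anti2[of v z x w] anti2[of z x v w] anti1[of v z x w]
      anti2[of v w x z] anti2[of x v w z] anti2[of w x v z] anti1[of x v w z] anti1[of w x v z] anti1[of v w x z]
      anti1[of x w z v] anti2[of v w z x] anti1[of v w z x] anti1[of w z x v]
    by linarith
  \<comment> \<open>Polarise \<open>diag\<close> in \<open>v\<close>; pair symmetry equates the two
    mixed terms.\<close>
  have swap: "T v w w x = 0" for v w x
  proof -
    have "T (v + x) w w (v + x) = 0" by (rule diag)
    then have "T v w w x + T x w w v = 0" unfolding add1 add4 by (simp add: diag)
    moreover have "T x w w v = T v w w x" using pair[of x w w v] anti1[of w v x w] anti2[of v w x w] by simp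
    ultimately show ?thesis by simp
  qed
  \<comment> \<open>Polarise in the repeated middle argument. Now \<open>T\<close> alternates in its
    first three arguments, so the Bianchi sum is \<open>3 * T v w z x\<close>.\<close>
  have anti: "T v w z x = - T v z w x" for v w z x
    using swap[of v "w + z" x] unfolding add2 add3 by (simp add: swap)
  show ?thesis
    using bianchi[of v w z x] anti[of v w z x] anti1[of w z v x] anti[of z w v x] anti1[of z v w x]
      anti[of v z w x] anti1[of v z w x] by linarith
qed

context smooth_metric begin

text \<open>The curvature tensor on constant coordinate fields, whose brackets vanish, with the sign
  for which \<open>g u (Rm u v w w) v\<close> is positive on spheres when \<open>v\<close> and
  \<open>w\<close> are independent.\<close>

definition Rm :: "'a \<Rightarrow> 'a \<Rightarrow> 'a \<Rightarrow> 'a \<Rightarrow> 'a" where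
  "Rm u v w z = differential (\<lambda>y. \<Gamma> y w z) u v - differential (\<lambda>y. \<Gamma> y v z) u w
    + \<Gamma> u v (\<Gamma> u w z) - \<Gamma> u w (\<Gamma> u v z)"

lemmas christoffel_simps = bilinear_ladd[OF bilinear_christoffel] bilinear_radd[OF bilinear_christoffel]
  bilinear_lmul[OF bilinear_christoffel] bilinear_rmul[OF bilinear_christoffel]
  bilinear_lsub[OF bilinear_christoffel] bilinear_rsub[OF bilinear_christoffel]
  bilinear_lzero[OF bilinear_christoffel] bilinear_rzero[OF bilinear_christoffel]

lemma linear_differential_christoffel:
  "u \<in> U \<Longrightarrow> linear (\<lambda>x. differential (\<lambda>y. \<Gamma> y v w) u x)"
  using linear_frechet_derivative[OF christoffel_differentiable] .

lemma bilinear_differential_christoffel: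
  "u \<in> U \<Longrightarrow> bilinear (\<lambda>v w. differential (\<lambda>y. \<Gamma> y v w) u x)"
  using bilinear_differential[OF U, of u \<Gamma> x] bilinear_christoffel christoffel_differentiable by simp

lemma differential_christoffel_sym:
  "u \<in> U \<Longrightarrow> differential (\<lambda>y. \<Gamma> y v w) u x = differential (\<lambda>y. \<Gamma> y w v) u x"
  by (rule fun_cong[OF frechet_derivative_transform_within_open[OF christoffel_differentiable U]])
    (auto simp: christoffel_sym)

lemmas differential_christoffel_simps =
  linear_add[OF linear_differential_christoffel] linear_scale[OF linear_differential_christoffel]
  bilinear_ladd[OF bilinear_differential_christoffel] bilinear_radd[OF bilinear_differential_christoffel]

lemma Rm_add:
  assumes "u \<in> U"
  shows "Rm u (v + v') w z = Rm u v w z + Rm u v' w z"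
    and "Rm u v (w + w') z = Rm u v w z + Rm u v w' z"
    and "Rm u v w (z + z') = Rm u v w z + Rm u v w z'"
  unfolding Rm_def using assms
  by (simp_all add: differential_christoffel_simps christoffel_simps)

lemma Rm_antisym: "Rm u v w z = - Rm u w v z"
  by (simp add: Rm_def)

lemma Rm_bianchi:
  assumes "u \<in> U"
  shows "Rm u v w z + Rm u w z v + Rm u z v w = 0"
  unfolding Rm_def using assms
  by (simp add: differential_christoffel_sym[of u w z] differential_christoffel_sym[of u v z]
      differential_christoffel_sym[of u v w] christoffel_sym[of u w z] christoffel_sym[of u v z]
      christoffel_sym[of u v w])

text \<open>Differentiating the metric compatibility condition once more, the second derivatives of
  \<open>g\<close> cancel by symmetry.\<close>

lemma Rm_skew:
  assumes u: "u \<in> U"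
  shows "g u (Rm u v w z) x = - g u (Rm u v w x) z"
proof -
  have D\<Gamma>: "((\<lambda>y. \<Gamma> y a b) has_derivative differential (\<lambda>y. \<Gamma> y a b) u) (at u)" for a b
    using christoffel_differentiable[OF u] frechet_derivative_works by blast
  have second: "differential (\<lambda>y. dg y w z x) u v =
    g u (\<Gamma> u v (\<Gamma> u w z)) x + g u (\<Gamma> u w z) (\<Gamma> u v x) + g u (differential (\<lambda>y. \<Gamma> y w z) u v) x
    + (g u (\<Gamma> u v z) (\<Gamma> u w x) + g u z (\<Gamma> u v (\<Gamma> u w x)) + g u z (differential (\<lambda>y. \<Gamma> y w x) u v))"
    for v w
  proof -
    have "((\<lambda>y. g y (\<Gamma> y w z) x + g y z (\<Gamma> y w x)) has_derivative
      (\<lambda>h. (dg u h (\<Gamma> u w z) x + g u (differential (\<lambda>y. \<Gamma> y w z) u h) x + g u (\<Gamma> u w z) 0) +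
           (dg u h z (\<Gamma> u w x) + g u 0 (\<Gamma> u w x) + g u z (differential (\<lambda>y. \<Gamma> y w x) u h)))) (at u)"
      unfolding dg_def
      by (intro has_derivative_add has_derivative_bilinear_field[OF U u bilinear_g g_differentiable[OF u] has_derivative_ident]
          D\<Gamma> has_derivative_const)
    then have "((\<lambda>y. dg y w z x) has_derivative
      (\<lambda>h. (dg u h (\<Gamma> u w z) x + g u (differential (\<lambda>y. \<Gamma> y w z) u h) x + g u (\<Gamma> u w z) 0) +
           (dg u h z (\<Gamma> u w x) + g u 0 (\<Gamma> u w x) + g u z (differential (\<lambda>y. \<Gamma> y w x) u h)))) (at u)"
      by (rule has_derivative_transform_within_open[OF _ U u]) (simp add: metric_compatible)
    from fun_cong[OF frechet_derivative_at[OF this], of v, symmetric] show ?thesis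
      using u by (simp add: metric_compatible g_simps)
  qed
  have "differential (\<lambda>y. dg y w z x) u v = differential (\<lambda>y. dg y v z x) u w"
    unfolding dg_def by (rule second_differential_symmetric[OF U g_smooth u])
  then have "g u (Rm u v w z) x + g u z (Rm u v w x) = 0"
    unfolding second Rm_def using u by (simp add: g_simps)
  then show ?thesis using g_sym[OF u, of z "Rm u v w x"] by simp
qed

text \<open>The space form condition speaks of independent pairs; for degenerate planes the diagonal
  value vanishes by the antisymmetries alone.\<close>

lemma g_Rm_scale_diag:
  assumes "u \<in> U" and dep: "v = 0 \<or> (\<exists>r. w = r *\<^sub>R v)"
  shows "g u (Rm u v w w) v = 0"
proof -
  have z: "g u (Rm u v' w' z) z = 0" for v' w' z using Rm_skew[OF assms(1), of v' w' z z] by simp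
  have 0: "Rm u v' v' z = 0" for v' z by (simp add: Rm_def)
  from dep show ?thesis
  proof
    assume "v = 0" then show ?thesis using assms by (simp add: g_simps)
  next
    assume "\<exists>r. w = r *\<^sub>R v"
    then obtain r where w: "w = r *\<^sub>R v" ..
    have "Rm u v (r *\<^sub>R v) z = r *\<^sub>R Rm u v v z" for z
      using assms(1) bilinear_lmul[OF bilinear_differential_christoffel] unfolding Rm_def
      by (simp add: differential_christoffel_simps christoffel_simps algebra_simps)
    then show ?thesis using assms by (simp add: w 0 g_simps)
  qed
qed

text \<open>The difference from the model tensor has all curvature symmetries and vanishing
  sectional values, so polarisation kills it.\<close>

lemma Rm_constant_curvature:
  assumes u: "u \<in> U"
    and K: "\<And>v w. v \<noteq> w \<Longrightarrow> independent {v, w} \<Longrightarrow>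
      g u (Rm u v w w) v / (g u v v * g u w w - (g u v w)\<^sup>2) = c"
  shows "g u (Rm u v w z) x = c * (g u w z * g u v x - g u v z * g u w x)"
proof -
  define T where "T = (\<lambda>v w z x. g u (Rm u v w z) x - c * (g u w z * g u v x - g u v z * g u w x))"
  have "T v w z x = 0"
  proof (rule curvature_form_zero[where T = T])
    fix v w z x v' w' z' x'
    show "T (v + v') w z x = T v w z x + T v' w z x" "T v (w + w') z x = T v w z x + T v w' z x"
      "T v w (z + z') x = T v w z x + T v w z' x" "T v w z (x + x') = T v w z x + T v w z x'"
      using u by (simp_all add: T_def Rm_add g_simps algebra_simps)
    show "T v w z x = - T w v z x"
      using u Rm_antisym[of u v w z] by (simp add: T_def g_simps bilinear_lneg[OF bilinear_g] algebra_simps)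
    show "T v w z x = - T v w x z"
      using u Rm_skew[OF u, of v w z x] by (simp add: T_def algebra_simps)
    have "g u (Rm u v w z + Rm u w z v + Rm u z v w) x = 0"
      unfolding Rm_bianchi[OF u] using u by (simp add: g_simps)
    then show "T v w z x + T w z v x + T z v w x = 0"
      using u g_sym[OF u, of w z] g_sym[OF u, of v z] g_sym[OF u, of v w]
      by (simp add: T_def g_simps algebra_simps)
    show "T v w w v = 0"
    proof (cases "v \<noteq> w \<and> independent {v, w}")
      case True
      \<comment> \<open>Positivity of the Gram determinant, needed to clear the denominator in
        \<open>K\<close>; \<open>w - r *\<^sub>R v\<close> is the part of \<open>w\<close>
        orthogonal to \<open>v\<close>.\<close>
      have pos: "g u v v * g u w w - (g u v w)\<^sup>2 > 0"
      proof -
        have "v \<noteq> 0" using True dependent_zero[of "{v, w}"] by auto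
        then have v: "g u v v > 0" by (rule g_pos[OF u])
        define r where "r = g u v w / g u v v"
        have "w - r *\<^sub>R v \<noteq> 0"
        proof
          assume "w - r *\<^sub>R v = 0"
          then have "w \<in> span {v}" by (auto simp: span_singleton)
          moreover have "independent (insert w {v})" using True by (simp add: insert_commute)
          ultimately show False using True by (metis independent_insert singletonD)
        qed
        then have "0 < g u v v * g u (w - r *\<^sub>R v) (w - r *\<^sub>R v)" using g_pos[OF u] v by simp
        also have "\<dots> = g u v v * g u w w - (g u v w)\<^sup>2"
          using u v g_sym[OF u, of w v] by (simp add: g_simps r_def power2_eq_square field_simps)
        finally show ?thesis .
      qed
      then have "g u (Rm u v w w) v = c * (g u v v * g u w w - (g u v w)\<^sup>2)"
        using K[of v w] True by (auto simp: field_simps)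
      then show ?thesis using g_sym[OF u, of w v] by (simp add: T_def power2_eq_square algebra_simps)
    next
      case False
      have dep: "v = 0 \<or> (\<exists>r. w = r *\<^sub>R v)"
      proof (rule ccontr)
        assume n: "\<not> ?thesis"
        then have "v \<noteq> w" by (metis scaleR_one)
        have "w \<notin> span {v}" using n by (auto simp: span_singleton)
        then have "independent {w, v}" using n by (simp add: independent_insert)
        then show False using False \<open>v \<noteq> w\<close> by (simp add: insert_commute)
      qed
      then have "g u w w * g u v v - g u v w * g u w v = 0"
        using u by (auto simp: g_simps)
      then show ?thesis using g_Rm_scale_diag[OF u dep] by (simp add: T_def)
    qed
  qed
  then show ?thesis by (simp add: T_def)
qed

end

section \<open>Gauss and Ricci equations\<close>

text \<open>Used for two maps: the identity, which gives the sectional curvature of \<open>g\<close>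
  itself, and the immersion in coordinates.\<close>

locale smooth_metric_map = smooth_metric U g
  for U :: "'a::euclidean_space set" and g +
  fixes W :: "'n::euclidean_space set" and f :: "'n \<Rightarrow> 'a"
  assumes W: "open W" and f_in: "\<And>y. y \<in> W \<Longrightarrow> f y \<in> U" and f_smooth: "smooth_on W f"
begin

lemma f_has_derivative: "y \<in> W \<Longrightarrow> (f has_derivative differential f y) (at y)"
  by (rule smooth_on_has_derivative[OF f_smooth])

lemma linear_df: "y \<in> W \<Longrightarrow> linear (differential f y)"
  using f_has_derivative has_derivative_linear by blast

lemmas df_simps = linear_add[OF linear_df] linear_scale[OF linear_df] linear_diff[OF linear_df]
  linear_0[OF linear_df] linear_sum[OF linear_df]

lemma has_derivative_along:
  assumes "smooth_on W \<xi>" "x \<in> W" "(Y has_derivative Y') (at x)"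
  shows "((\<lambda>y. differential \<xi> y (Y y)) has_derivative
    (\<lambda>h. differential (\<lambda>y. differential \<xi> y (Y x)) x h + differential \<xi> x (Y' h))) (at x)"
  using has_derivative_linear_field[OF W assms(2) linear_frechet_derivative[OF smooth_on_imp_differentiable[OF assms(1)]]
      smooth_on_imp_differentiable[OF smooth_on_differential[OF assms(1)] assms(2)] has_derivative_ident assms(3)] .

lemma cov_deriv_has_derivative:
  assumes "smooth_on W \<xi>" "x \<in> W" "(Y has_derivative Y') (at x)"
  shows "(cov_deriv g f Y \<xi> has_derivative (\<lambda>h.
    differential (\<lambda>y. differential \<xi> y (Y x)) x h + differential \<xi> x (Y' h)
    + (differential (\<lambda>y. \<Gamma> y (differential f x (Y x)) (\<xi> x)) (f x) (differential f x h)
    + \<Gamma> (f x) (differential (\<lambda>y. differential f y (Y x)) x h + differential f x (Y' h)) (\<xi> x)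
    + \<Gamma> (f x) (differential f x (Y x)) (differential \<xi> x h)))) (at x)"
  unfolding cov_deriv_def[abs_def]
  by (intro has_derivative_add has_derivative_along assms f_smooth
    has_derivative_bilinear_field[OF U f_in[OF assms(2)] bilinear_christoffel
      christoffel_differentiable[OF f_in[OF assms(2)]] f_has_derivative[OF assms(2)]]
    smooth_on_has_derivative[OF assms(1,2)])

text \<open>The second derivatives of \<open>\<xi>\<close> and of \<open>f\<close> cancel by
  symmetry, and the derivatives of \<open>X\<close> and \<open>Y\<close> cancel against the bracket
  term. What remains is the pulled-back curvature tensor.\<close>

lemma curvature_along:
  assumes \<xi>: "smooth_on W \<xi>" and x: "x \<in> W"
    and X: "X differentiable (at x)" and Y: "Y differentiable (at x)"
  shows "curvature_op (cov_deriv g f) X Y \<xi> x =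
    Rm (f x) (differential f x (X x)) (differential f x (Y x)) (\<xi> x)"
proof -
  note der = cov_deriv_has_derivative[OF \<xi> x frechet_derivative_works[THEN iffD1, OF X]]
    cov_deriv_has_derivative[OF \<xi> x frechet_derivative_works[THEN iffD1, OF Y]]
  note eq = frechet_derivative_at[OF der(1), symmetric] frechet_derivative_at[OF der(2), symmetric]
  have fx: "f x \<in> U" by (rule f_in[OF x])
  have l\<xi>: "linear (differential \<xi> x)" by (rule linear_frechet_derivative[OF smooth_on_imp_differentiable[OF \<xi> x]])
  have s\<xi>: "differential (\<lambda>y. differential \<xi> y (Y x)) x (X x) = differential (\<lambda>y. differential \<xi> y (X x)) x (Y x)"
    by (rule second_differential_symmetric[OF W \<xi> x])
  have sf: "differential (\<lambda>y. differential f y (Y x)) x (X x) = differential (\<lambda>y. differential f y (X x)) x (Y x)"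
    by (rule second_differential_symmetric[OF W f_smooth x])
  show ?thesis
    unfolding curvature_op_def cov_deriv_def[of _ _ _ "cov_deriv _ _ _ _"] eq
    unfolding cov_deriv_def lie_bracket_def Rm_def
    using fx x by (simp add: christoffel_simps df_simps linear_diff[OF l\<xi>] s\<xi> sf)
qed

lemma metric_along:
  assumes x: "x \<in> W" and \<xi>: "\<xi> differentiable (at x)" and \<eta>: "\<eta> differentiable (at x)"
  shows "((\<lambda>y. g (f y) (\<xi> y) (\<eta> y)) has_derivative
    (\<lambda>h. g (f x) (cov_deriv g f (\<lambda>_. h) \<xi> x) (\<eta> x) + g (f x) (\<xi> x) (cov_deriv g f (\<lambda>_. h) \<eta> x))) (at x)"
proof -
  have fx: "f x \<in> U" by (rule f_in[OF x])
  have "((\<lambda>y. g (f y) (\<xi> y) (\<eta> y)) has_derivative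
    (\<lambda>h. dg (f x) (differential f x h) (\<xi> x) (\<eta> x) + g (f x) (differential \<xi> x h) (\<eta> x)
      + g (f x) (\<xi> x) (differential \<eta> x h))) (at x)"
    unfolding dg_def
    by (intro has_derivative_bilinear_field[OF U fx bilinear_g g_differentiable[OF fx] f_has_derivative[OF x]]
      frechet_derivative_works[THEN iffD1] \<xi> \<eta>)
  then show ?thesis
    by (rule has_derivative_eq_rhs) (simp add: fun_eq_iff metric_compatible fx cov_deriv_def g_simps)
qed

text \<open>The ambient covariant derivative in direction \<open>v\<close> of the tangent field
  \<open>differential f y w\<close> with constant \<open>w\<close>. Its tangential part will be the
  Christoffel symbol of the induced metric, its normal part the second fundamental form.\<close>

definition hess :: "'n \<Rightarrow> 'n \<Rightarrow> 'n \<Rightarrow> 'a" where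
  "hess y v w = differential (\<lambda>y. differential f y w) y v + \<Gamma> (f y) (differential f y v) (differential f y w)"

lemma hess_sym: "y \<in> W \<Longrightarrow> hess y v w = hess y w v"
  by (simp add: hess_def christoffel_sym f_in second_differential_symmetric[OF W f_smooth, of y w])

lemma cov_deriv_tangent:
  assumes "x \<in> W" "Y differentiable (at x)"
  shows "cov_deriv g f X (\<lambda>y. differential f y (Y y)) x = hess x (X x) (Y x) + differential f x (differential Y x (X x))"
  using frechet_derivative_at[OF has_derivative_along[OF f_smooth assms(1) frechet_derivative_works[THEN iffD1, OF assms(2)]], symmetric]
  by (simp add: cov_deriv_def hess_def)

lemma cov_deriv_tangent_const:
  assumes "x \<in> W"
  shows "cov_deriv g f X (\<lambda>y. differential f y w) x = hess x (X x) w"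
  by (simp add: cov_deriv_def hess_def)

lemma tangent_differentiable:
  assumes "x \<in> W" "Y differentiable (at x)"
  shows "(\<lambda>y. differential f y (Y y)) differentiable (at x)"
  using has_derivative_along[OF f_smooth assms(1) frechet_derivative_works[THEN iffD1, OF assms(2)]]
  unfolding differentiable_def by blast

lemma hess_differentiable: "x \<in> W \<Longrightarrow> (\<lambda>y. hess y v w) differentiable (at x)"
proof -
  assume x: "x \<in> W"
  have "cov_deriv g f (\<lambda>_. v) (\<lambda>y. differential f y w) differentiable (at x)"
    using cov_deriv_has_derivative[OF smooth_on_differential[OF f_smooth] x has_derivative_const]
    unfolding differentiable_def by blast
  then show ?thesis by (simp add: hess_def[abs_def] cov_deriv_def[abs_def])
qed

lemma linear_hess: "y \<in> W \<Longrightarrow> linear (\<lambda>v. hess y v w)"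
  using linear_frechet_derivative[OF smooth_on_imp_differentiable[OF smooth_on_differential[OF f_smooth]], of y w]
  by (auto simp: linear_iff hess_def christoffel_simps df_simps f_in algebra_simps)

lemma bilinear_hess: "y \<in> W \<Longrightarrow> bilinear (hess y)"
  unfolding bilinear_def using linear_hess[of y] hess_sym[of y] by simp

end

section \<open>Gauss, Weingarten and Ricci equations in an orthonormal frame\<close>

locale framed_immersion = smooth_metric_map U g W f
  for U :: "'a::euclidean_space set" and g and W :: "'n::euclidean_space set" and f +
  fixes e :: "nat \<Rightarrow> 'n \<Rightarrow> 'n"
  assumes frame: "orthonormal_tangent_frame g f W e"
begin

lemma frame_smooth: "k \<in> {1..DIM('n)} \<Longrightarrow> smooth_on W (e k)"
  using frame by (simp add: orthonormal_tangent_frame_def)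

lemma frame_orthonormal:
  "y \<in> W \<Longrightarrow> k \<in> {1..DIM('n)} \<Longrightarrow> l \<in> {1..DIM('n)} \<Longrightarrow>
    g (f y) (differential f y (e k y)) (differential f y (e l y)) = (if k = l then 1 else 0)"
  using frame by (simp add: orthonormal_tangent_frame_def induced_metric_def)

text \<open>Orthonormality makes the map \<open>T\<close> from coordinates to frame combinations
  injective, and the frame has \<open>DIM('n)\<close> members, so \<open>T\<close> is onto.\<close>

lemma frame_expand:
  assumes y: "y \<in> W"
  shows "v = (\<Sum>k\<in>{1..DIM('n)}. g (f y) (differential f y v) (differential f y (e k y)) *\<^sub>R e k y)"
proof -
  have fy: "f y \<in> U" by (rule f_in[OF y])
  obtain \<beta> :: "nat \<Rightarrow> 'n" where \<beta>: "bij_betw \<beta> {1..DIM('n)} Basis"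
    using finite_same_card_bij[of "{1..DIM('n)}" "Basis :: 'n set"] by auto
  define T where "T = (\<lambda>x. \<Sum>k\<in>{1..DIM('n)}. (x \<bullet> \<beta> k) *\<^sub>R e k y)"
  have lin: "linear T"
    by (auto simp: T_def linear_iff inner_add_left scaleR_add_left sum.distrib scaleR_sum_right)
  have coord: "g (f y) (differential f y (T x)) (differential f y (e l y)) = x \<bullet> \<beta> l" if "l \<in> {1..DIM('n)}" for x l
  proof -
    have "g (f y) (differential f y (T x)) (differential f y (e l y)) =
      (\<Sum>k\<in>{1..DIM('n)}. (x \<bullet> \<beta> k) * g (f y) (differential f y (e k y)) (differential f y (e l y)))"
      unfolding T_def using fy y by (simp add: df_simps g_sum_left g_simps)
    also have "\<dots> = (\<Sum>k\<in>{1..DIM('n)}. if k = l then x \<bullet> \<beta> k else 0)"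
      by (intro sum.cong refl) (simp only: frame_orthonormal[OF y _ that], simp)
    finally have "g (f y) (differential f y (T x)) (differential f y (e l y)) =
      (\<Sum>k\<in>{1..DIM('n)}. if k = l then x \<bullet> \<beta> k else 0)" .
    then show ?thesis using that by simp
  qed
  have "inj T"
  proof (subst linear_injective_0[OF lin], intro allI impI)
    fix x assume "T x = 0"
    then have "x \<bullet> \<beta> l = 0" if "l \<in> {1..DIM('n)}" for l using coord[OF that, of x] y fy by (simp add: df_simps g_simps)
    then have "x \<bullet> b = 0" if "b \<in> Basis" for b
      using bij_betw_imp_surj_on[OF \<beta>] that by (metis imageE)
    then show "x = 0" using euclidean_all_zero_iff by blast
  qed
  then have "surj T" using lin by (intro linear_injective_imp_surjective) auto
  then obtain x where x: "v = T x" by blast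
  have "T x = (\<Sum>k\<in>{1..DIM('n)}. g (f y) (differential f y (T x)) (differential f y (e k y)) *\<^sub>R e k y)"
    by (subst T_def, intro sum.cong refl) (simp only: coord)
  then show ?thesis using x by simp
qed

text \<open>The preimage under \<open>differential f y\<close> of the orthogonal projection of
  \<open>w\<close> to the tangent space. Written in the frame, its differentiability in
  \<open>y\<close> is visible, unlike that of the definite description
  \<open>normal_part\<close>.\<close>

definition tangent_coords :: "'n \<Rightarrow> 'a \<Rightarrow> 'n" where
  "tangent_coords y w = (\<Sum>k\<in>{1..DIM('n)}. g (f y) w (differential f y (e k y)) *\<^sub>R e k y)"

lemma df_tangent_coords:
  "y \<in> W \<Longrightarrow> differential f y (tangent_coords y w) =
    (\<Sum>k\<in>{1..DIM('n)}. g (f y) w (differential f y (e k y)) *\<^sub>R differential f y (e k y))"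
  by (simp add: tangent_coords_def df_simps)

lemma g_df_tangent_coords:
  assumes "y \<in> W"
  shows "g (f y) (differential f y (tangent_coords y w)) (differential f y v) = g (f y) w (differential f y v)"
proof -
  note fy = f_in[OF assms]
  let ?E = "\<lambda>k. differential f y (e k y)"
  have "differential f y v = (\<Sum>k\<in>{1..DIM('n)}. g (f y) (differential f y v) (?E k) *\<^sub>R ?E k)"
    by (subst frame_expand[OF assms, of v]) (simp only: df_simps assms)
  then have "g (f y) w (differential f y v) = g (f y) w (\<Sum>k\<in>{1..DIM('n)}. g (f y) (differential f y v) (?E k) *\<^sub>R ?E k)"
    by simp
  also have "\<dots> = (\<Sum>k\<in>{1..DIM('n)}. g (f y) w (?E k) * g (f y) (?E k) (differential f y v))"
    using fy by (simp add: g_sum_right g_simps g_sym[OF fy, of "differential f y v"] mult.commute)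
  also have "\<dots> = g (f y) (differential f y (tangent_coords y w)) (differential f y v)"
    using fy assms by (simp add: df_tangent_coords g_sum_left g_simps)
  finally show ?thesis ..
qed

lemma tangent_coords_unique:
  assumes "y \<in> W" "\<And>z. g (f y) (differential f y b) (differential f y z) = g (f y) w (differential f y z)"
  shows "b = tangent_coords y w"
  unfolding tangent_coords_def
  by (subst frame_expand[OF assms(1), of b]) (simp add: assms(2))

lemma normal_part_eq:
  assumes y: "y \<in> W"
  shows "normal_part g f y w = w - differential f y (tangent_coords y w)"
  unfolding normal_part_def
proof (rule the_equality)
  note fy = f_in[OF y]
  show "w - differential f y (tangent_coords y w) \<in> normal_space g f y \<and>
      w - (w - differential f y (tangent_coords y w)) \<in> range (differential f y)"
    using fy by (auto simp: normal_space_def g_simps g_df_tangent_coords y)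
  fix \<xi> assume \<xi>: "\<xi> \<in> normal_space g f y \<and> w - \<xi> \<in> range (differential f y)"
  then obtain b where b: "w - \<xi> = differential f y b" by blast
  have "b = tangent_coords y w"
    using y b[symmetric] \<xi> fy by (intro tangent_coords_unique) (auto simp: normal_space_def g_simps)
  then show "\<xi> = w - differential f y (tangent_coords y w)" using b by (simp add: algebra_simps)
qed

lemma normal_part_normal: "y \<in> W \<Longrightarrow> normal_part g f y w \<in> normal_space g f y"
  by (simp add: normal_part_eq normal_space_def g_simps f_in g_df_tangent_coords)

lemma g_normal_tangent:
  "\<eta> \<in> normal_space g f y \<Longrightarrow> g (f y) \<eta> (differential f y v) = 0"
  by (simp add: normal_space_def)

lemma g_normal_part:
  assumes "y \<in> W" "\<eta> \<in> normal_space g f y"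
  shows "g (f y) (normal_part g f y w) \<eta> = g (f y) w \<eta>"
  using assms g_sym[OF f_in, of y "differential f y (tangent_coords y w)" \<eta>]
  by (simp add: normal_part_eq g_simps f_in g_normal_tangent)

lemma normal_part_add_tangent:
  assumes "y \<in> W"
  shows "normal_part g f y (w + differential f y v) = normal_part g f y w"
proof -
  have "tangent_coords y (w + differential f y v) = tangent_coords y w + v"
    by (rule tangent_coords_unique[OF assms, symmetric])
      (simp add: assms df_simps g_simps f_in g_df_tangent_coords)
  then show ?thesis by (simp add: normal_part_eq assms df_simps)
qed

lemma tangent_coords_differentiable:
  assumes "x \<in> W" "\<xi> differentiable (at x)"
  shows "(\<lambda>y. tangent_coords y (\<xi> y)) differentiable (at x)"
proof -
  have "(\<lambda>y. g (f y) (\<xi> y) (differential f y (e k y)) *\<^sub>R e k y) differentiable (at x)" if k: "k \<in> {1..DIM('n)}" for k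
  proof -
    have e: "e k differentiable (at x)" by (rule smooth_on_imp_differentiable[OF frame_smooth[OF k] assms(1)])
    have "(\<lambda>y. g (f y) (\<xi> y) (differential f y (e k y))) differentiable (at x)"
      using metric_along[OF assms tangent_differentiable[OF assms(1) e]] unfolding differentiable_def by blast
    then show ?thesis using e by (rule differentiable_scaleR)
  qed
  then show ?thesis unfolding tangent_coords_def by (intro differentiable_sum) auto
qed

definition sff :: "'n \<Rightarrow> 'n \<Rightarrow> 'n \<Rightarrow> 'a" where
  "sff y v w = normal_part g f y (hess y v w)"

text \<open>Differentiating the coefficients of \<open>Y\<close> only adds a tangential term, which
  the normal part discards.\<close>

lemma second_fundamental_form_eq_sff:
  assumes "x \<in> W" "Y differentiable (at x)"
  shows "second_fundamental_form g f X Y x = sff x (X x) (Y x)"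
  by (simp add: second_fundamental_form_def cov_deriv_tangent assms sff_def normal_part_add_tangent)

lemma sff_sym: "y \<in> W \<Longrightarrow> sff y v w = sff y w v"
  by (simp add: sff_def hess_sym)

lemma sff_normal: "y \<in> W \<Longrightarrow> sff y v w \<in> normal_space g f y"
  by (simp add: sff_def normal_part_normal)

lemma sff_eq: "y \<in> W \<Longrightarrow> sff y v w = hess y v w - differential f y (tangent_coords y (hess y v w))"
  by (simp add: sff_def normal_part_eq)

lemma sff_differentiable: "x \<in> W \<Longrightarrow> (\<lambda>y. sff y v w) differentiable (at x)"
proof -
  assume x: "x \<in> W"
  have "(\<lambda>y. hess y v w - differential f y (tangent_coords y (hess y v w))) differentiable (at x)"
    by (intro differentiable_diff hess_differentiable tangent_differentiable tangent_coords_differentiable x)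
  then obtain D where "((\<lambda>y. hess y v w - differential f y (tangent_coords y (hess y v w))) has_derivative D) (at x)"
    unfolding differentiable_def by blast
  then have "((\<lambda>y. sff y v w) has_derivative D) (at x)"
    by (rule has_derivative_transform_within_open[OF _ W x]) (simp add: sff_eq)
  then show ?thesis unfolding differentiable_def by blast
qed

text \<open>By symmetry of \<open>hess\<close> the Koszul combination for the induced metric
  collapses to twice the product of \<open>hess y v w\<close> with a tangent vector: the induced
  connection is the tangential part of the ambient one.\<close>

lemma christoffel_induced:
  assumes y: "y \<in> W"
  shows "christoffel (induced_metric g f) y v w = tangent_coords y (hess y v w)"
proof -
  note fy = f_in[OF y]
  have D: "differential (\<lambda>y. induced_metric g f y a b) y z =
    g (f y) (hess y z a) (differential f y b) + g (f y) (differential f y a) (hess y z b)" for a b z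
    using fun_cong[OF frechet_derivative_at[OF metric_along[OF y
      smooth_on_imp_differentiable[OF smooth_on_differential[OF f_smooth] y]
      smooth_on_imp_differentiable[OF smooth_on_differential[OF f_smooth] y], of a b]], of z]
    by (simp add: induced_metric_def cov_deriv_tangent_const y)
  have koszul: "differential (\<lambda>y. induced_metric g f y w z) y v + differential (\<lambda>y. induced_metric g f y v z) y w
     - differential (\<lambda>y. induced_metric g f y v w) y z = 2 * g (f y) (hess y v w) (differential f y z)" for z
    unfolding D using hess_sym[OF y, of v w] hess_sym[OF y, of v z] hess_sym[OF y, of w z]
      g_sym[OF fy, of "differential f y w"] by simp
  show ?thesis
    unfolding christoffel_def koszul
  proof (rule the_equality)
    show "\<forall>z. 2 * induced_metric g f y (tangent_coords y (hess y v w)) z = 2 * g (f y) (hess y v w) (differential f y z)"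
      by (simp add: induced_metric_def g_df_tangent_coords y)
    fix b assume "\<forall>z. 2 * induced_metric g f y b z = 2 * g (f y) (hess y v w) (differential f y z)"
    then show "b = tangent_coords y (hess y v w)"
      by (intro tangent_coords_unique y) (simp add: induced_metric_def)
  qed
qed

lemma cov_deriv_zero: "y \<in> W \<Longrightarrow> \<xi> differentiable (at y) \<Longrightarrow> X y = 0 \<Longrightarrow> cov_deriv g f X \<xi> y = 0"
  using linear_0[OF linear_frechet_derivative, of \<xi> "at y"] by (simp add: cov_deriv_def df_simps christoffel_simps f_in)

lemma cov_deriv_cong_field:
  assumes "y \<in> W" "\<xi> differentiable (at y)" "\<And>z. z \<in> W \<Longrightarrow> \<xi> z = \<zeta> z"
  shows "cov_deriv g f X \<xi> y = cov_deriv g f X \<zeta> y"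
  using frechet_derivative_transform_within_open[OF assms(2) W assms(1,3)] assms(1,3)
  by (simp add: cov_deriv_def)

lemma cov_deriv_diff:
  assumes "y \<in> W" "\<xi> differentiable (at y)" "\<zeta> differentiable (at y)"
  shows "cov_deriv g f X (\<lambda>z. \<xi> z - \<zeta> z) y = cov_deriv g f X \<xi> y - cov_deriv g f X \<zeta> y"
  using frechet_derivative_at[OF has_derivative_diff[OF assms(2,3)[unfolded frechet_derivative_works]], symmetric] assms(1)
  by (simp add: cov_deriv_def christoffel_simps f_in)

text \<open>The Weingarten equation, obtained by differentiating the orthogonality of
  \<open>\<zeta>\<close> to the tangent field \<open>differential f y z\<close>.\<close>

lemma g_cov_deriv_normal:
  assumes x: "x \<in> W" and \<zeta>: "\<zeta> differentiable (at x)" "\<And>y. y \<in> W \<Longrightarrow> \<zeta> y \<in> normal_space g f y"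
  shows "g (f x) (cov_deriv g f X \<zeta> x) (differential f x z) = - g (f x) (\<zeta> x) (sff x (X x) z)"
proof -
  have dz: "(\<lambda>y. differential f y z) differentiable (at x)"
    by (rule smooth_on_imp_differentiable[OF smooth_on_differential[OF f_smooth] x])
  have "((\<lambda>y. 0) has_derivative (\<lambda>h. g (f x) (cov_deriv g f (\<lambda>_. h) \<zeta> x) (differential f x z)
      + g (f x) (\<zeta> x) (cov_deriv g f (\<lambda>_. h) (\<lambda>y. differential f y z) x))) (at x)"
    by (rule has_derivative_transform_within_open[OF metric_along[OF x \<zeta>(1) dz] W x])
      (simp add: g_normal_tangent \<zeta>(2))
  from fun_cong[OF has_derivative_unique[OF this has_derivative_const], of "X x"]
  have "g (f x) (cov_deriv g f X \<zeta> x) (differential f x z) + g (f x) (\<zeta> x) (hess x (X x) z) = 0"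
    by (simp add: cov_deriv_tangent_const x) (simp add: cov_deriv_def)
  moreover have "g (f x) (\<zeta> x) (hess x (X x) z) = g (f x) (\<zeta> x) (sff x (X x) z)"
    using g_normal_part[OF x \<zeta>(2)[OF x], of "hess x (X x) z"] g_sym[OF f_in[OF x], of "\<zeta> x"]
    by (simp add: sff_def)
  ultimately show ?thesis by simp
qed

text \<open>Differentiate the splitting of \<open>hess\<close> into tangential and normal part once
  more. The normal summand returns through the Weingarten equation as a quadratic term in
  \<open>sff\<close>.\<close>

lemma gauss_equation:
  assumes x: "x \<in> W"
  shows "induced_metric g f x (curvature_op (cov_deriv (induced_metric g f) (\<lambda>y. y)) (\<lambda>_. v) (\<lambda>_. w) (\<lambda>_. w) x) v =
    g (f x) (Rm (f x) (differential f x v) (differential f x w) (differential f x w)) (differential f x v)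
    + g (f x) (sff x v v) (sff x w w) - g (f x) (sff x v w) (sff x v w)"
proof -
  note fx = f_in[OF x]
  let ?C = "\<lambda>y a b. tangent_coords y (hess y a b)"
  let ?c = "cov_deriv (induced_metric g f) (\<lambda>y. y)"
  let ?R = "curvature_op ?c (\<lambda>_. v) (\<lambda>_. w) (\<lambda>_. w) x"
  have cc: "?c (\<lambda>_. a) (\<lambda>_. b) y = ?C y a b" if "y \<in> W" for a b y
    by (simp add: cov_deriv_def christoffel_induced that)
  have Cd: "(\<lambda>y. ?C y a b) differentiable (at x)" for a b
    by (intro tangent_coords_differentiable hess_differentiable x)
  have Cdiff: "differential (?c (\<lambda>_. a) (\<lambda>_. b)) x = differential (\<lambda>y. ?C y a b) x" for a b
    by (rule frechet_derivative_transform_within_open[OF Cd W x, symmetric]) (simp add: cc)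
  have C0: "?C x 0 w = 0"
    using x fx linear_0[OF linear_hess[OF x], of w] by (simp add: tangent_coords_def g_simps)
  have R: "?R = differential (\<lambda>y. ?C y w w) x v + ?C x v (?C x w w)
      - (differential (\<lambda>y. ?C y v w) x w + ?C x w (?C x v w))"
  proof -
    have "?c (lie_bracket (\<lambda>_. v) (\<lambda>_. w)) (\<lambda>_. w) x = 0"
      by (simp add: cov_deriv_def lie_bracket_def christoffel_induced x C0)
    then show ?thesis
      unfolding curvature_op_def
      by (subst (1 2) cov_deriv_def) (simp add: Cdiff cc x christoffel_induced)
  qed
  \<comment> \<open>Compares a second covariant derivative of the induced metric with the ambient
    one; they differ by one product of second fundamental forms. Exchanging the directions
    \<open>v\<close>, \<open>w\<close> and subtracting gives the equation.\<close>
  have key: "g (f x) (differential f x (differential (\<lambda>y. ?C y a b) x z + ?C x z (?C x a b))) (differential f x t)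
    = g (f x) (cov_deriv g f (\<lambda>_. z) (cov_deriv g f (\<lambda>_. a) (\<lambda>y. differential f y b)) x) (differential f x t)
      + g (f x) (sff x a b) (sff x z t)" for a b z t
  proof -
    have "cov_deriv g f (\<lambda>_. z) (\<lambda>y. differential f y (?C y a b)) x =
      cov_deriv g f (\<lambda>_. z) (\<lambda>y. hess y a b - sff y a b) x"
      by (rule cov_deriv_cong_field[OF x tangent_differentiable[OF x Cd]]) (simp add: sff_eq)
    also have "\<dots> = cov_deriv g f (\<lambda>_. z) (\<lambda>y. hess y a b) x - cov_deriv g f (\<lambda>_. z) (\<lambda>y. sff y a b) x"
      by (rule cov_deriv_diff[OF x hess_differentiable[OF x] sff_differentiable[OF x]])
    finally have "hess x z (?C x a b) + differential f x (differential (\<lambda>y. ?C y a b) x z) =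
      cov_deriv g f (\<lambda>_. z) (\<lambda>y. hess y a b) x - cov_deriv g f (\<lambda>_. z) (\<lambda>y. sff y a b) x"
      by (simp add: cov_deriv_tangent[OF x Cd])
    moreover have "g (f x) (cov_deriv g f (\<lambda>_. z) (\<lambda>y. sff y a b) x) (differential f x t) = - g (f x) (sff x a b) (sff x z t)"
      by (rule g_cov_deriv_normal[OF x sff_differentiable[OF x]]) (rule sff_normal)
    moreover have "g (f x) (differential f x (?C x z (?C x a b))) (differential f x t) = g (f x) (hess x z (?C x a b)) (differential f x t)"
      by (rule g_df_tangent_coords[OF x])
    moreover have "cov_deriv g f (\<lambda>_. a) (\<lambda>y. differential f y b) = (\<lambda>y. hess y a b)"
      by (simp add: fun_eq_iff hess_def cov_deriv_def)
    ultimately show ?thesis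
      using fx x g_simps(1)[OF fx, of "hess x z (?C x a b)" "differential f x (differential (\<lambda>y. ?C y a b) x z)" "differential f x t"]
      by (simp add: df_simps g_simps)
  qed
  have "curvature_op (cov_deriv g f) (\<lambda>_. v) (\<lambda>_. w) (\<lambda>y. differential f y w) x =
    Rm (f x) (differential f x v) (differential f x w) (differential f x w)"
    by (rule curvature_along[OF smooth_on_differential[OF f_smooth] x]) simp_all
  then have "cov_deriv g f (\<lambda>_. v) (cov_deriv g f (\<lambda>_. w) (\<lambda>y. differential f y w)) x
    - cov_deriv g f (\<lambda>_. w) (cov_deriv g f (\<lambda>_. v) (\<lambda>y. differential f y w)) x =
    Rm (f x) (differential f x v) (differential f x w) (differential f x w)"
    using cov_deriv_zero[OF x smooth_on_imp_differentiable[OF smooth_on_differential[OF f_smooth] x],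
      of "lie_bracket (\<lambda>_. v) (\<lambda>_. w)" w]
    by (simp add: curvature_op_def lie_bracket_def)
  then have "g (f x) (cov_deriv g f (\<lambda>_. v) (cov_deriv g f (\<lambda>_. w) (\<lambda>y. differential f y w)) x) (differential f x v)
    - g (f x) (cov_deriv g f (\<lambda>_. w) (cov_deriv g f (\<lambda>_. v) (\<lambda>y. differential f y w)) x) (differential f x v) =
    g (f x) (Rm (f x) (differential f x v) (differential f x w) (differential f x w)) (differential f x v)"
    using g_simps(5)[OF fx] by metis
  then show ?thesis
    unfolding induced_metric_def R
    using key[of w w v v] key[of v w w v] g_simps(5)[OF fx] sff_sym[OF x, of w v] g_sym[OF fx, of "sff x w w"]
    by (simp add: df_simps[OF x] add_diff_eq del: g_simps)
qed


text \<open>Antisymmetrising second normal derivatives in \<open>X\<close> and \<open>Y\<close>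
  leaves the ambient curvature and the commutator of the two shape operators, here written out in
  the frame.\<close>

lemma ricci_equation:
  assumes x: "x \<in> W" and X: "smooth_on W X" and Y: "smooth_on W Y"
    and \<xi>: "smooth_on W \<xi>" "\<And>y. y \<in> W \<Longrightarrow> \<xi> y \<in> normal_space g f y"
    and \<eta>: "\<eta> x \<in> normal_space g f x"
  shows "normal_curvature g f X Y \<xi> \<eta> x =
    g (f x) (Rm (f x) (differential f x (X x)) (differential f x (Y x)) (\<xi> x)) (\<eta> x)
    + (\<Sum>k=1..DIM('n). g (f x) (sff x (Y x) (e k x)) (\<xi> x) * g (f x) (sff x (X x) (e k x)) (\<eta> x)
        - g (f x) (sff x (X x) (e k x)) (\<xi> x) * g (f x) (sff x (Y x) (e k x)) (\<eta> x))"
proof -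
  note fx = f_in[OF x]
  have \<xi>d: "\<xi> differentiable (at y)" if "y \<in> W" for y by (rule smooth_on_imp_differentiable[OF \<xi>(1) that])
  \<comment> \<open>The inner normal connection differs from the full one by the tangential part
    \<open>t\<close>. Its derivative has normal component \<open>hess x (A x) (t x)\<close>, up to a
    normal projection, and the Weingarten equation supplies the frame coefficients of
    \<open>t\<close>.\<close>
  have shift: "g (f x) (normal_connection g f A (normal_connection g f B \<xi>) x) (\<eta> x) =
    g (f x) (cov_deriv g f A (cov_deriv g f B \<xi>) x) (\<eta> x)
    + (\<Sum>k=1..DIM('n). g (f x) (sff x (B x) (e k x)) (\<xi> x) * g (f x) (sff x (A x) (e k x)) (\<eta> x))"
    if B: "smooth_on W B" for A B
  proof -
    define t where "t = (\<lambda>y. tangent_coords y (cov_deriv g f B \<xi> y))"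
    have Bd: "B differentiable (at x)" by (rule smooth_on_imp_differentiable[OF B x])
    have D: "cov_deriv g f B \<xi> differentiable (at x)"
      using cov_deriv_has_derivative[OF \<xi>(1) x frechet_derivative_works[THEN iffD1, OF Bd]]
      unfolding differentiable_def by blast
    have td: "t differentiable (at x)"
      unfolding t_def by (rule tangent_coords_differentiable[OF x D])
    have dft: "(\<lambda>y. differential f y (t y)) differentiable (at x)" by (rule tangent_differentiable[OF x td])
    have diff: "(\<lambda>y. cov_deriv g f B \<xi> y - differential f y (t y)) differentiable (at x)"
      by (intro differentiable_diff D dft)
    have "cov_deriv g f A (normal_connection g f B \<xi>) x = cov_deriv g f A (\<lambda>y. cov_deriv g f B \<xi> y - differential f y (t y)) x"
      by (rule cov_deriv_cong_field[OF x diff, symmetric])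
        (simp add: normal_connection_def normal_part_eq t_def)
    also have "\<dots> = cov_deriv g f A (cov_deriv g f B \<xi>) x - cov_deriv g f A (\<lambda>y. differential f y (t y)) x"
      by (rule cov_deriv_diff[OF x D dft])
    also have "cov_deriv g f A (\<lambda>y. differential f y (t y)) x = hess x (A x) (t x) + differential f x (differential t x (A x))"
      by (rule cov_deriv_tangent[OF x td])
    finally have "g (f x) (normal_connection g f A (normal_connection g f B \<xi>) x) (\<eta> x) =
      g (f x) (cov_deriv g f A (cov_deriv g f B \<xi>) x) (\<eta> x) - g (f x) (hess x (A x) (t x)) (\<eta> x)"
      using g_normal_tangent[OF \<eta>] g_sym[OF fx, of "differential f x (differential t x (A x))"]
      by (simp add: normal_connection_def[of _ _ _ "normal_connection _ _ _ _"] g_normal_part[OF x \<eta>] g_simps fx)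
    also have "g (f x) (hess x (A x) (t x)) (\<eta> x) =
      (\<Sum>k=1..DIM('n). g (f x) (cov_deriv g f B \<xi> x) (differential f x (e k x)) * g (f x) (hess x (A x) (e k x)) (\<eta> x))"
    proof -
      have lin: "linear (hess x (A x))" using bilinear_hess[OF x] by (simp add: bilinear_def)
      show ?thesis
        unfolding t_def tangent_coords_def linear_sum[OF lin] linear_scale[OF lin]
        using fx by (simp add: g_sum_left g_simps)
    qed
    also have "\<dots> = (\<Sum>k=1..DIM('n). - (g (f x) (sff x (B x) (e k x)) (\<xi> x) * g (f x) (sff x (A x) (e k x)) (\<eta> x)))"
      using g_cov_deriv_normal[OF x \<xi>d[OF x] \<xi>(2)] g_sym[OF fx, of "\<xi> x"]
      by (simp add: sff_def g_normal_part[OF x \<eta>])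
    finally show ?thesis by (simp add: sum_negf)
  qed
  have "normal_curvature g f X Y \<xi> \<eta> x =
     g (f x) (normal_connection g f X (normal_connection g f Y \<xi>) x) (\<eta> x)
     - g (f x) (normal_connection g f Y (normal_connection g f X \<xi>) x) (\<eta> x)
     - g (f x) (cov_deriv g f (lie_bracket X Y) \<xi> x) (\<eta> x)"
    using fx by (simp add: normal_curvature_def curvature_op_def g_simps)
      (simp add: normal_connection_def[of _ _ "lie_bracket _ _"] g_normal_part[OF x \<eta>])
  also have "\<dots> = g (f x) (curvature_op (cov_deriv g f) X Y \<xi> x) (\<eta> x)
     + (\<Sum>k=1..DIM('n). g (f x) (sff x (Y x) (e k x)) (\<xi> x) * g (f x) (sff x (X x) (e k x)) (\<eta> x))
     - (\<Sum>k=1..DIM('n). g (f x) (sff x (X x) (e k x)) (\<xi> x) * g (f x) (sff x (Y x) (e k x)) (\<eta> x))"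
    using fx by (simp add: shift X Y curvature_op_def g_simps)
  also have "curvature_op (cov_deriv g f) X Y \<xi> x =
    Rm (f x) (differential f x (X x)) (differential f x (Y x)) (\<xi> x)"
    by (rule curvature_along[OF \<xi>(1) x smooth_on_imp_differentiable[OF X x] smooth_on_imp_differentiable[OF Y x]])
  finally show ?thesis by (simp add: sum_subtractf)
qed

end

section \<open>Riemannian products and space forms\<close>

text \<open>Openness of \<open>S\<close> makes derivatives at its points depend only on values in
  \<open>S\<close>, so the induction can pass to the differentials.\<close>

lemma Ck_on_cong:
  assumes "open S" "\<And>x. x \<in> S \<Longrightarrow> f x = g x" "Ck_on k S f"
  shows "Ck_on k S g"
  using assms(2,3)
proof (induction k arbitrary: f g)
  case 0
  then show ?case using continuous_on_cong[of S S f g] by simp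
next
  case (Suc k)
  have d: "f differentiable (at x)" if "x \<in> S" for x using Suc.prems(2) that by simp
  have D: "differential f x = differential g x" if "x \<in> S" for x
    by (rule frechet_derivative_transform_within_open[OF d assms(1)]) (use that Suc.prems(1) in auto)
  have "g differentiable (at x)" if "x \<in> S" for x
    using d[OF that] has_derivative_transform_within_open[OF _ assms(1) that, of f _ UNIV g] Suc.prems(1)
    unfolding differentiable_def by blast
  moreover have "Ck_on k S (\<lambda>x. differential g x v)" for v
    by (rule Suc.IH[of "\<lambda>x. differential f x v"]) (use Suc.prems(2) D in auto)
  ultimately show ?case by simp
qed

lemma Ck_on_subset:
  assumes "Ck_on k S f" "T \<subseteq> S"
  shows "Ck_on k T f"
  using assms by (induction k arbitrary: f) (auto intro: continuous_on_subset)

lemma smooth_on_subset: "smooth_on S f \<Longrightarrow> T \<subseteq> S \<Longrightarrow> smooth_on T f"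
  by (auto simp: smooth_on_def intro: Ck_on_subset)

lemma Ck_on_const: "Ck_on k S (\<lambda>_. c)"
  by (induction k arbitrary: c) auto

lemma smooth_on_ident: "smooth_on S (\<lambda>x. x)"
  unfolding smooth_on_def
proof
  show "Ck_on k S (\<lambda>x. x)" for k by (cases k) (auto simp: Ck_on_const)
qed

lemma Ck_on_add:
  assumes "open S" "Ck_on k S f" "Ck_on k S g"
  shows "Ck_on k S (\<lambda>x. f x + g x)"
  using assms(2,3)
proof (induction k arbitrary: f g)
  case 0
  then show ?case by (auto intro: continuous_intros)
next
  case (Suc k)
  have D: "differential (\<lambda>x. f x + g x) x v = differential f x v + differential g x v" if "x \<in> S" for x v
  proof -
    have "f differentiable (at x)" "g differentiable (at x)" using Suc.prems that by auto
    from fun_cong[OF frechet_derivative_at[OF has_derivative_add[OF this[unfolded frechet_derivative_works]]], of v]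
    show ?thesis by simp
  qed
  have "Ck_on k S (\<lambda>x. differential (\<lambda>x. f x + g x) x v)" for v
    by (rule Ck_on_cong[OF assms(1) _ Suc.IH[of "\<lambda>x. differential f x v" "\<lambda>x. differential g x v"]])
      (use Suc.prems D in auto)
  then show ?case using Suc.prems by auto
qed

text \<open>Intended for the projections \<open>fst\<close> and \<open>snd\<close>. For a linear
  inner map the differential in direction \<open>v\<close> is
  \<open>differential f (L x) (L v)\<close>, again a composition with \<open>L\<close>, so the
  induction closes.\<close>

lemma Ck_on_compose_linear:
  fixes L :: "'a::euclidean_space \<Rightarrow> 'b::euclidean_space"
  assumes "open S" "linear L" "L ` S \<subseteq> T" "Ck_on k T f"
  shows "Ck_on k S (\<lambda>x. f (L x))"
  using assms(4)
proof (induction k arbitrary: f)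
  case 0
  then show ?case
    using assms(2,3) continuous_on_compose2[of T f S L] linear_continuous_on[of L S]
    by (auto simp: linear_conv_bounded_linear)
next
  case (Suc k)
  have bl: "bounded_linear L" using assms(2) linear_conv_bounded_linear by blast
  have der: "((\<lambda>x. f (L x)) has_derivative (\<lambda>h. differential f (L x) (L h))) (at x)" if "x \<in> S" for x
  proof -
    have "f differentiable (at (L x))" using Suc.prems that assms(3) by auto
    then show ?thesis
      using has_derivative_compose[OF bounded_linear_imp_has_derivative[OF bl], of f]
      unfolding frechet_derivative_works by blast
  qed
  have "Ck_on k S (\<lambda>x. differential (\<lambda>x. f (L x)) x v)" for v
    by (rule Ck_on_cong[OF assms(1) _ Suc.IH[of "\<lambda>x. differential f x (L v)"]])
      (use Suc.prems fun_cong[OF frechet_derivative_at[OF der]] in auto)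
  moreover have "(\<lambda>x. f (L x)) differentiable (at x)" if "x \<in> S" for x
    using der[OF that] unfolding differentiable_def by blast
  ultimately show ?case by simp
qed

definition product_metric :: "('a \<Rightarrow> 'a \<Rightarrow> 'a \<Rightarrow> real) \<Rightarrow> ('b \<Rightarrow> 'b \<Rightarrow> 'b \<Rightarrow> real) \<Rightarrow> 'a \<times> 'b \<Rightarrow> 'a \<times> 'b \<Rightarrow> 'a \<times> 'b \<Rightarrow> real" where
  "product_metric g1 g2 u v w = g1 (fst u) (fst v) (fst w) + g2 (snd u) (snd v) (snd w)"

locale product_smooth_metric = m1: smooth_metric U1 g1 + m2: smooth_metric U2 g2
  for U1 :: "'a::euclidean_space set" and g1 and U2 :: "'b::euclidean_space set" and g2
begin

abbreviation "g \<equiv> product_metric g1 g2"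

sublocale smooth_metric "U1 \<times> U2" g
proof
  show "open (U1 \<times> U2)" by (intro open_Times m1.U m2.U)
  fix u v w
  assume "u \<in> U1 \<times> U2"
  then have u: "fst u \<in> U1" "snd u \<in> U2" by auto
  show "bilinear (g u)"
    using u by (auto simp: bilinear_def linear_iff product_metric_def m1.g_simps m2.g_simps algebra_simps)
  show "g u v w = g u w v"
    using m1.g_sym[OF u(1)] m2.g_sym[OF u(2)] by (simp add: product_metric_def)
  assume "v \<noteq> 0"
  then have "fst v \<noteq> 0 \<or> snd v \<noteq> 0" by (simp add: prod_eq_iff)
  then show "0 < g u v v"
    using m1.g_pos[OF u(1)] m2.g_pos[OF u(2)] m1.g_nonneg[OF u(1)] m2.g_nonneg[OF u(2)]
    by (auto simp: product_metric_def intro: add_pos_nonneg add_nonneg_pos)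
next
  fix v w
  have "Ck_on k (U1 \<times> U2) (\<lambda>u. g1 (fst u) (fst v) (fst w) + g2 (snd u) (snd v) (snd w))" for k
    using m1.g_smooth m2.g_smooth
    by (intro Ck_on_add Ck_on_compose_linear[where L = fst and T = U1] Ck_on_compose_linear[where L = snd and T = U2])
      (auto simp: smooth_on_def linear_fst linear_snd intro: open_Times m1.U m2.U)
  then show "smooth_on (U1 \<times> U2) (\<lambda>u. g u v w)" by (simp add: smooth_on_def product_metric_def)
qed

lemma dg_product:
  assumes "u \<in> U1 \<times> U2"
  shows "dg u z v w = m1.dg (fst u) (fst z) (fst v) (fst w) + m2.dg (snd u) (snd z) (snd v) (snd w)"
proof -
  have u: "fst u \<in> U1" "snd u \<in> U2" using assms by auto
  have "((\<lambda>y. g1 (fst y) (fst v) (fst w) + g2 (snd y) (snd v) (snd w)) has_derivative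
    (\<lambda>z. m1.dg (fst u) (fst z) (fst v) (fst w) + m2.dg (snd u) (snd z) (snd v) (snd w))) (at u)"
    unfolding m1.dg_def m2.dg_def
    by (intro has_derivative_add
      has_derivative_compose[OF has_derivative_fst[OF has_derivative_ident] m1.g_differentiable[OF u(1), unfolded frechet_derivative_works]]
      has_derivative_compose[OF has_derivative_snd[OF has_derivative_ident] m2.g_differentiable[OF u(2), unfolded frechet_derivative_works]])
  from fun_cong[OF frechet_derivative_at[OF this], of z] show ?thesis
    by (simp add: dg_def product_metric_def)
qed

text \<open>Derivatives of the product metric split, so the pair of factor symbols satisfies the
  same Koszul equation; nondegeneracy gives equality.\<close>

lemma christoffel_product:
  assumes "u \<in> U1 \<times> U2"
  shows "christoffel g u v w = (christoffel g1 (fst u) (fst v) (fst w), christoffel g2 (snd u) (snd v) (snd w))"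
proof (rule g_eqI[OF assms])
  fix z
  have u: "fst u \<in> U1" "snd u \<in> U2" using assms by auto
  show "g u (christoffel g u v w) z =
    g u (christoffel g1 (fst u) (fst v) (fst w), christoffel g2 (snd u) (snd v) (snd w)) z"
    using koszul[OF assms, of v w z] m1.koszul[OF u(1), of "fst v" "fst w" "fst z"]
      m2.koszul[OF u(2), of "snd v" "snd w" "snd z"]
    unfolding dg_product[OF assms] by (simp add: product_metric_def)
qed

lemma differential_christoffel_product:
  assumes "u \<in> U1 \<times> U2"
  shows "differential (\<lambda>y. christoffel g y v w) u z =
    (differential (\<lambda>y. christoffel g1 y (fst v) (fst w)) (fst u) (fst z),
     differential (\<lambda>y. christoffel g2 y (snd v) (snd w)) (snd u) (snd z))"
proof -
  have u: "fst u \<in> U1" "snd u \<in> U2" using assms by auto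
  have "((\<lambda>y. (christoffel g1 (fst y) (fst v) (fst w), christoffel g2 (snd y) (snd v) (snd w))) has_derivative
    (\<lambda>z. (differential (\<lambda>y. christoffel g1 y (fst v) (fst w)) (fst u) (fst z),
     differential (\<lambda>y. christoffel g2 y (snd v) (snd w)) (snd u) (snd z)))) (at u)"
    by (intro has_derivative_Pair
      has_derivative_compose[OF has_derivative_fst[OF has_derivative_ident] m1.christoffel_differentiable[OF u(1), unfolded frechet_derivative_works]]
      has_derivative_compose[OF has_derivative_snd[OF has_derivative_ident] m2.christoffel_differentiable[OF u(2), unfolded frechet_derivative_works]])
  then have "((\<lambda>y. christoffel g y v w) has_derivative
    (\<lambda>z. (differential (\<lambda>y. christoffel g1 y (fst v) (fst w)) (fst u) (fst z),
     differential (\<lambda>y. christoffel g2 y (snd v) (snd w)) (snd u) (snd z)))) (at u)"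
    by (rule has_derivative_transform_within_open[OF _ U assms]) (simp add: christoffel_product)
  from fun_cong[OF frechet_derivative_at[OF this], of z] show ?thesis by simp
qed

lemma Rm_product:
  assumes "u \<in> U1 \<times> U2"
  shows "Rm u v w z =
    (m1.Rm (fst u) (fst v) (fst w) (fst z), m2.Rm (snd u) (snd v) (snd w) (snd z))"
  unfolding Rm_def m1.Rm_def m2.Rm_def
  by (simp add: differential_christoffel_product christoffel_product assms)

end

lemma riemannian_manifold_smooth_metric:
  assumes "riemannian_manifold M" "i \<in> indices M"
  shows "smooth_metric (chart_img M i) (metric_in M i)"
  using assms by unfold_locales (auto simp: riemannian_manifold_def smooth_manifold_def)

text \<open>The curvature formula along a map, taken for the identity and constant fields.\<close>

lemma (in smooth_metric) sectional_curvature_eq_Rm: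
  assumes "u \<in> U"
  shows "sectional_curvature g u v w = g u (Rm u v w w) v / (g u v v * g u w w - (g u v w)\<^sup>2)"
proof -
  interpret id: smooth_metric_map U g U "\<lambda>y. y"
    by unfold_locales (auto intro: U smooth_on_ident)
  have "smooth_on U (\<lambda>_. w)" by (simp add: smooth_on_def Ck_on_const)
  from id.curvature_along[OF this assms, of "\<lambda>_. v" "\<lambda>_. w"] show ?thesis
    by (simp add: sectional_curvature_def)
qed

lemma real_space_form_Rm:
  assumes "real_space_form c M" "i \<in> indices M" "u \<in> chart_img M i"
  shows "metric_in M i u (smooth_metric.Rm (metric_in M i) u v w z) x =
    c * (metric_in M i u w z * metric_in M i u v x - metric_in M i u v z * metric_in M i u w x)"
proof -
  interpret smooth_metric "chart_img M i" "metric_in M i"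
    using assms by (intro riemannian_manifold_smooth_metric) (auto simp: real_space_form_def)
  show ?thesis
    using assms by (intro Rm_constant_curvature)
      (auto simp: real_space_form_def sectional_curvature_eq_Rm[symmetric])
qed

lemma chart_img_product:
  "chart_img (riemannian_product M1 M2) (i, j) = chart_img M1 i \<times> chart_img M2 j"
  by (auto simp: chart_img_def riemannian_product_def)

lemma metric_in_product:
  "metric_in (riemannian_product M1 M2) (i, j) = product_metric (metric_in M1 i) (metric_in M2 j)"
  by (simp add: riemannian_product_def product_metric_def fun_eq_iff)

text \<open>\<open>chart_inv\<close> chooses preimages and is a right inverse of the product chart
  on its image, where the first coordinate can be read off.\<close>

lemma local_rep_product_fst:
  assumes "v \<in> chart_img (riemannian_product M1 M2) (i, j)"
  shows "local_rep (riemannian_product M1 M2) (i, j) M1 i fst v = fst v"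
proof -
  let ?M = "riemannian_product M1 M2"
  have "chart_map ?M (i, j) (chart_inv ?M (i, j) v) = v"
    using assms unfolding chart_img_def chart_inv_def by (rule f_inv_into_f)
  moreover have "chart_map ?M (i, j) z = (chart_map M1 i (fst z), chart_map M2 j (snd z))" for z
    by (simp add: riemannian_product_def split_beta)
  ultimately show ?thesis by (simp add: local_rep_def) (metis fst_conv)
qed

lemma local_rep_in_chart_img:
  assumes "smooth_manifold N" "k \<in> indices N" "y \<in> local_dom N k M i F"
  shows "local_rep N k M i F y \<in> chart_img M i"
proof -
  obtain z where z: "z \<in> chart_dom N k" "F z \<in> chart_dom M i" "y = chart_map N k z"
    using assms(3) by (auto simp: local_dom_def)
  have "openin (mtop N) (chart_dom N k)"
    and hom: "homeomorphic_map (subtopology (mtop N) (chart_dom N k)) (top_of_set (chart_img N k)) (chart_map N k)"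
    using assms(1,2) by (auto simp: smooth_manifold_def)
  then have "topspace (subtopology (mtop N) (chart_dom N k)) = chart_dom N k"
    using openin_subset by fastforce
  then have "inj_on (chart_map N k) (chart_dom N k)"
    using homeomorphic_imp_injective_map[OF hom] by simp
  then have "chart_inv N k y = z" using z by (simp add: chart_inv_def)
  then show ?thesis using z by (simp add: local_rep_def chart_img_def)
qed

section \<open>The normal scalar curvature inequality\<close>

lemma sum_strict_upper_triangle:
  fixes F :: "nat \<Rightarrow> nat \<Rightarrow> real"
  assumes "\<And>i j. F i j = F j i"
  shows "2 * (\<Sum>i=1..n. \<Sum>j\<in>{i<..n}. F i j) = (\<Sum>i=1..n. \<Sum>j=1..n. F i j) - (\<Sum>i=1..n. F i i)"
proof (induction n)
  case (Suc n)
  have "(\<Sum>j\<in>{i<..Suc n}. F i j) = F i (Suc n) + (\<Sum>j\<in>{i<..n}. F i j)" if "i \<in> {1..n}" for i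
  proof -
    have "{i<..Suc n} = insert (Suc n) {i<..n}" using that by auto
    then show ?thesis by simp
  qed
  then have "2 * (\<Sum>i=1..Suc n. \<Sum>j\<in>{i<..Suc n}. F i j) =
    2 * (\<Sum>i=1..n. F i (Suc n)) + 2 * (\<Sum>i=1..n. \<Sum>j\<in>{i<..n}. F i j)"
    by (simp add: sum.distrib)
  moreover have "(\<Sum>i=1..Suc n. \<Sum>j=1..Suc n. F i j) =
    (\<Sum>i=1..n. \<Sum>j=1..n. F i j) + 2 * (\<Sum>i=1..n. F i (Suc n)) + F (Suc n) (Suc n)"
  proof -
    have "(\<Sum>j=1..n. F (Suc n) j) = (\<Sum>i=1..n. F i (Suc n))" by (intro sum.cong refl assms)
    then show ?thesis by (simp add: sum.distrib)
  qed
  ultimately show ?case using Suc.IH by simp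
qed simp

text \<open>Bounds the squared components of the traceless second fundamental form along the normal
  frame by its full squared norm.\<close>

lemma (in smooth_metric) bessel:
  assumes u: "u \<in> U" and "finite R"
    and on: "\<And>r s. r \<in> R \<Longrightarrow> s \<in> R \<Longrightarrow> g u (b r) (b s) = (if r = s then 1 else 0)"
  shows "(\<Sum>r\<in>R. (g u w (b r))\<^sup>2) \<le> g u w w"
proof -
  define z where "z = (\<Sum>r\<in>R. g u w (b r) *\<^sub>R b r)"
  have wz: "g u w z = (\<Sum>r\<in>R. (g u w (b r))\<^sup>2)"
    using u by (simp add: z_def g_sum_right g_simps power2_eq_square)
  have bz: "g u (b r) z = g u w (b r)" if "r \<in> R" for r
  proof -
    have "g u (b r) z = (\<Sum>s\<in>R. g u w (b s) * g u (b r) (b s))"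
      using u by (simp add: z_def g_sum_right g_simps)
    also have "\<dots> = (\<Sum>s\<in>R. if r = s then g u w (b s) else 0)"
      by (intro sum.cong refl) (simp add: on that)
    finally show ?thesis using that \<open>finite R\<close> by simp
  qed
  have "g u z z = (\<Sum>r\<in>R. g u w (b r) * g u (b r) z)"
    using u by (subst z_def) (simp add: g_sum_left g_simps)
  then have zz: "g u z z = g u w z" by (simp add: bz wz power2_eq_square)
  have "0 \<le> g u (w - z) (w - z)" by (rule g_nonneg[OF u])
  also have "\<dots> = g u w w - g u w z"
    using u g_sym[OF u, of z w] zz by (simp add: g_simps)
  finally show ?thesis by (simp add: wz)
qed

context framed_immersion begin

text \<open>The algebra at one point: \<open>h\<close> is the second fundamental form in the frame,
  and the inner sums are the commutator entries from the Ricci equation.\<close>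

lemma normal_curvature_sum_bound:
  fixes h :: "nat \<Rightarrow> nat \<Rightarrow> 'a" and \<nu> :: "nat \<Rightarrow> 'a"
  defines "n \<equiv> DIM('n)"
  assumes u: "u \<in> U" and h_sym: "\<And>i j. h i j = h j i"
    and \<nu>: "\<And>r s. r \<in> {1..m} \<Longrightarrow> s \<in> {1..m} \<Longrightarrow> g u (\<nu> r) (\<nu> s) = (if r = s then 1 else 0)"
    and m: "m \<le> DIM('a)"
    and H: "H = (1 / real n) *\<^sub>R (\<Sum>i=1..n. h i i)"
  shows "2 * sqrt (\<Sum>i=1..n. \<Sum>j\<in>{i<..n}. \<Sum>r=1..m. \<Sum>s\<in>{r<..m}.
      (\<Sum>k=1..n. g u (h j k) (\<nu> r) * g u (h i k) (\<nu> s) - g u (h i k) (\<nu> r) * g u (h j k) (\<nu> s))\<^sup>2)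
    \<le> (\<Sum>i=1..n. \<Sum>j=1..n. g u (h i j) (h i j)) - n * g u H H"
proof -
  have npos: "n > 0" by (simp add: n_def)
  \<comment> \<open>The traceless part, whose total squared norm is that of \<open>h\<close> minus
    \<open>n * g u H H\<close>; this produces the subtracted mean curvature term.\<close>
  define h0 where "h0 = (\<lambda>i j. h i j - (if i = j then H else 0))"
  define b where "b = (\<lambda>r i j. g u (h0 i j) (\<nu> r))"
  define C where "C = (\<lambda>i j r s. (\<Sum>k=1..n. b r i k * b s k j - b s i k * b r k j))"
  have h0_sym: "h0 i j = h0 j i" for i j using h_sym by (simp add: h0_def)
  have b_sym: "b r i j = b r j i" for r i j by (simp add: b_def h0_sym[of i])
  \<comment> \<open>Passing from \<open>h\<close> to \<open>h0\<close> adds a multiple of the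
    identity to each matrix, which leaves commutators unchanged; the sign disappears after
    squaring.\<close>
  have C_eq: "(\<Sum>k=1..n. g u (h j k) (\<nu> r) * g u (h i k) (\<nu> s) - g u (h i k) (\<nu> r) * g u (h j k) (\<nu> s)) = - C i j r s"
    if "i \<in> {1..n}" "j \<in> {1..n}" for i j r s
  proof -
    define a where "a = (\<lambda>r i j. g u (h i j) (\<nu> r))"
    define t where "t = (\<lambda>r. g u H (\<nu> r))"
    have b: "b r i j = a r i j - (if i = j then t r else 0)" for r i j
      using u by (simp add: b_def h0_def a_def t_def g_simps)
    have "C i j r s = (\<Sum>k=1..n. (a r i k * a s k j - a s i k * a r k j)
      - ((if i = k then t r * a s k j - t s * a r k j else 0) + (if k = j then a r i k * t s - a s i k * t r else 0)))"
      unfolding C_def by (intro sum.cong refl) (simp add: b algebra_simps)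
    also have "\<dots> = (\<Sum>k=1..n. a r i k * a s k j - a s i k * a r k j)"
      using that by (simp add: sum_subtractf sum.distrib)
    also have "\<dots> = (\<Sum>k=1..n. - (g u (h j k) (\<nu> r) * g u (h i k) (\<nu> s) - g u (h i k) (\<nu> r) * g u (h j k) (\<nu> s)))"
    proof (intro sum.cong refl)
      fix k
      have "a t k j = g u (h j k) (\<nu> t)" for t by (simp only: a_def h_sym[of k j])
      then show "a r i k * a s k j - a s i k * a r k j =
        - (g u (h j k) (\<nu> r) * g u (h i k) (\<nu> s) - g u (h i k) (\<nu> r) * g u (h j k) (\<nu> s))"
        by (simp add: a_def)
    qed
    finally show ?thesis by (simp only: sum_negf minus_minus)
  qed
  have C_anti: "C j i r s = - C i j r s" "C i j s r = - C i j r s" for i j r s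
    unfolding C_def by (simp_all add: b_sym[of _ j] b_sym[of _ _ i] sum_subtractf mult.commute)
  have C2: "(C j i r s)\<^sup>2 = (C i j r s)\<^sup>2" "(C i j s r)\<^sup>2 = (C i j r s)\<^sup>2" for i j r s
    by (simp_all add: C_anti[of j i] C_anti(2)[of i j s])
  have C0: "C i i r s = 0" "C i j r r = 0" for i j r s
    using C_anti(1)[of i i r s] C_anti(2)[of i j r r] by simp_all
  define X where "X = (\<Sum>i=1..n. \<Sum>j\<in>{i<..n}. \<Sum>r=1..m. \<Sum>s\<in>{r<..m}. (C i j r s)\<^sup>2)"
  \<comment> \<open>\<open>C\<close> is antisymmetric in \<open>i, j\<close> and in
    \<open>r, s\<close>: the full sum counts each strict pair twice in both respects, and the
    diagonals vanish.\<close>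
  have "4 * X = 2 * (\<Sum>i=1..n. \<Sum>j\<in>{i<..n}. 2 * (\<Sum>r=1..m. \<Sum>s\<in>{r<..m}. (C i j r s)\<^sup>2))"
    by (simp add: X_def sum_distrib_left)
  also have "\<dots> = 2 * (\<Sum>i=1..n. \<Sum>j\<in>{i<..n}. \<Sum>r=1..m. \<Sum>s=1..m. (C i j r s)\<^sup>2)"
    using sum_strict_upper_triangle[of "\<lambda>r s. (C _ _ r s)\<^sup>2" m] by (simp add: C2(2) C0)
  also have "\<dots> = (\<Sum>i=1..n. \<Sum>j=1..n. \<Sum>r=1..m. \<Sum>s=1..m. (C i j r s)\<^sup>2)"
    using sum_strict_upper_triangle[of "\<lambda>i j. \<Sum>r=1..m. \<Sum>s=1..m. (C i j r s)\<^sup>2" n] by (simp add: C2(1) C0)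
  also have "\<dots> = (\<Sum>r=1..m. \<Sum>s=1..m. \<Sum>i=1..n. \<Sum>j=1..n. (C i j r s)\<^sup>2)"
  proof -
    have rot: "(\<Sum>a=1..n. \<Sum>r=1..m. \<Sum>s=1..m. G a r s) = (\<Sum>r=1..m. \<Sum>s=1..m. \<Sum>a=1..n. G a r s)"
      for G :: "nat \<Rightarrow> nat \<Rightarrow> nat \<Rightarrow> real"
      by (subst sum.swap) (intro sum.cong refl sum.swap)
    show ?thesis unfolding rot by (rule refl)
  qed
  also have "\<dots> \<le> (\<Sum>r=1..m. \<Sum>i=1..n. \<Sum>j=1..n. (b r i j)\<^sup>2)\<^sup>2"
  proof -
    obtain \<beta> :: "nat \<Rightarrow> 'n" where \<beta>: "bij_betw \<beta> {1..n} Basis"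
      using finite_same_card_bij[of "{1..n}" "Basis :: 'n set"] by (auto simp: n_def)
    obtain B :: "'a set" where B: "B \<subseteq> Basis" "card B = m" "finite B"
      using obtain_subset_with_card_n[OF m] by blast
    obtain \<gamma> :: "nat \<Rightarrow> 'a" where \<gamma>: "bij_betw \<gamma> {1..m} B"
      using finite_same_card_bij[of "{1..m}" B] B by auto
    show ?thesis
      unfolding C_def
      by (rule ddvv_inequality_components[OF \<beta>, of \<gamma>]) (use \<gamma> B b_sym in \<open>auto simp: bij_betw_def\<close>)
  qed
  finally have X4: "4 * X \<le> (\<Sum>r=1..m. \<Sum>i=1..n. \<Sum>j=1..n. (b r i j)\<^sup>2)\<^sup>2" .
  have b_swap: "(\<Sum>r=1..m. \<Sum>i=1..n. \<Sum>j=1..n. (b r i j)\<^sup>2) = (\<Sum>i=1..n. \<Sum>j=1..n. \<Sum>r=1..m. (b r i j)\<^sup>2)"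
    by (subst sum.swap) (intro sum.cong refl sum.swap)
  have "2 * sqrt X = sqrt (4 * X)" by (simp add: real_sqrt_mult)
  also have "\<dots> \<le> (\<Sum>r=1..m. \<Sum>i=1..n. \<Sum>j=1..n. (b r i j)\<^sup>2)"
    using real_sqrt_le_mono[OF X4] by (simp add: sum_nonneg)
  also have "\<dots> \<le> (\<Sum>i=1..n. \<Sum>j=1..n. g u (h0 i j) (h0 i j))"
    unfolding b_swap unfolding b_def using \<nu> by (intro sum_mono bessel[OF u]) auto
  also have "\<dots> = (\<Sum>i=1..n. \<Sum>j=1..n. g u (h i j) (h i j)) - n * g u H H"
  proof -
    have "(\<Sum>i=1..n. \<Sum>j=1..n. g u (h0 i j) (h0 i j)) =
      (\<Sum>i=1..n. \<Sum>j=1..n. g u (h i j) (h i j) - (if i = j then 2 * g u (h i j) H - g u H H else 0))"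
    proof (intro sum.cong refl)
      fix i j
      show "g u (h0 i j) (h0 i j) = g u (h i j) (h i j) - (if i = j then 2 * g u (h i j) H - g u H H else 0)"
        using u g_sym[OF u, of H "h j j"] by (simp add: h0_def g_simps)
    qed
    also have "\<dots> = (\<Sum>i=1..n. \<Sum>j=1..n. g u (h i j) (h i j)) - (\<Sum>i=1..n. 2 * g u (h i i) H - g u H H)"
      by (simp add: sum_subtractf)
    also have "(\<Sum>i=1..n. 2 * g u (h i i) H - g u H H) = 2 * g u (\<Sum>i=1..n. h i i) H - n * g u H H"
      using u by (simp add: sum_subtractf g_sum_left sum_distrib_left)
    also have "(\<Sum>i=1..n. h i i) = real n *\<^sub>R H" using npos by (simp add: H)
    finally show ?thesis using u by (simp add: g_simps)
  qed
  finally have "2 * sqrt X \<le> (\<Sum>i=1..n. \<Sum>j=1..n. g u (h i j) (h i j)) - n * g u H H" .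
  moreover have "(\<Sum>i=1..n. \<Sum>j\<in>{i<..n}. \<Sum>r=1..m. \<Sum>s\<in>{r<..m}.
      (\<Sum>k=1..n. g u (h j k) (\<nu> r) * g u (h i k) (\<nu> s) - g u (h i k) (\<nu> r) * g u (h j k) (\<nu> s))\<^sup>2) = X"
    unfolding X_def by (intro sum.cong refl) (subst C_eq, auto)
  ultimately show ?thesis by simp
qed

text \<open>
  In the products at hand, \<open>\<alpha>\<close> and \<open>\<beta>\<close> are the pullbacks of the two factor metrics. For a tangent
  vector and a normal vector they are opposite, so the two curvature terms cancel in the Ricci equation.
\<close>

lemma normal_scalar_curvature_inequality:
  fixes \<alpha> \<beta> :: "'a \<Rightarrow> 'a \<Rightarrow> real"
  assumes x: "x \<in> W" and n2: "2 \<le> DIM('n)"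
    and \<nu>: "orthonormal_normal_frame g f W \<nu>"
    and g: "\<And>v w. g (f x) v w = \<alpha> v w + \<beta> v w"
    and R: "\<And>v w z t. g (f x) (Rm (f x) v w z) t =
      c * (\<alpha> w z * \<alpha> v t - \<alpha> v z * \<alpha> w t) - c * (\<beta> w z * \<beta> v t - \<beta> v z * \<beta> w t)"
  defines "n \<equiv> real DIM('n)" and "H \<equiv> mean_curvature_vector g f e x"
    and "lam \<equiv> \<Sum>i=1..DIM('n). \<alpha> (differential f x (e i x)) (differential f x (e i x))"
  shows "normalized_scalar_curvature g f e x + normalized_normal_scalar_curvature g f e \<nu> x
    \<le> g (f x) H H + 2 * c * lam / n - c"
proof -
  note fx = f_in[OF x]
  define N where "N = DIM('n)"
  have nN: "n = real N" and n: "n \<ge> 2" using n2 by (auto simp: n_def N_def)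
  define m where "m = DIM('a) - DIM('n)"
  define E where "E = (\<lambda>i. differential f x (e i x))"
  define h where "h = (\<lambda>i j. sff x (e i x) (e j x))"
  define A where "A = (\<lambda>i. \<alpha> (E i) (E i))"
  have ed: "e i differentiable (at x)" if "i \<in> {1..N}" for i
    using smooth_on_imp_differentiable[OF frame_smooth x] that by (simp add: N_def)
  have EE: "g (f x) (E i) (E j) = (if i = j then 1 else 0)" if "i \<in> {1..N}" "j \<in> {1..N}" for i j
    using frame_orthonormal[OF x] that by (simp add: E_def N_def)
  have h_sym: "h i j = h j i" for i j by (simp add: h_def sff_sym[OF x])
  have H: "H = (1 / real N) *\<^sub>R (\<Sum>i=1..N. h i i)"
    unfolding H_def mean_curvature_vector_def N_def[symmetric] h_def
    by (intro arg_cong2[where f = scaleR] sum.cong refl second_fundamental_form_eq_sff[OF x ed])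
  have nH: "(\<Sum>i=1..N. h i i) = n *\<^sub>R H" using n by (simp add: H nN)
  \<comment> \<open>Since \<open>\<alpha>\<close> and \<open>\<beta>\<close> add up to
    \<open>g\<close>, orthonormality gives \<open>1 - A i\<close> and \<open>1 - A j\<close> for
    \<open>\<beta>\<close> and opposite mixed terms. The squares of the mixed terms cancel, and
    \<open>A i * A j - (1 - A i) * (1 - A j) = A i + A j - 1\<close>.\<close>
  have sec: "sectional_curvature (induced_metric g f) x (e i x) (e j x) =
      c * (A i + A j - 1) + (g (f x) (h i i) (h j j) - g (f x) (h i j) (h i j))"
    if ij: "i \<in> {1..N}" "j \<in> {1..N}" "i \<noteq> j" for i j
  proof -
    have \<beta>: "\<beta> (E i) (E i) = 1 - A i" "\<beta> (E j) (E j) = 1 - A j"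
      "\<beta> (E i) (E j) = - \<alpha> (E i) (E j)" "\<beta> (E j) (E i) = - \<alpha> (E j) (E i)"
      using EE[OF ij(1,1)] EE[OF ij(2,2)] EE[OF ij(1,2)] EE[OF ij(2,1)] ij(3) by (simp_all add: g A_def)
    have "g (f x) (Rm (f x) (E i) (E j) (E j)) (E i) = c * (A i + A j - 1)"
      unfolding R \<beta> by (simp add: A_def algebra_simps)
    then show ?thesis
      using EE[OF ij(1,1)] EE[OF ij(2,2)] EE[OF ij(1,2)] ij(3) gauss_equation[OF x, of "e i x" "e j x"]
      by (simp add: sectional_curvature_def E_def h_def induced_metric_def)
  qed
  have lamA: "(\<Sum>i=1..N. A i) = lam" by (simp add: lam_def A_def E_def N_def)
  define S where "S = (\<Sum>i=1..N. \<Sum>j=1..N. g (f x) (h i j) (h i j))"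
  have rho: "normalized_scalar_curvature g f e x = (c * (n - 1) * (2 * lam - n) + n\<^sup>2 * g (f x) H H - S) / (n * (n - 1))"
  proof -
    let ?F = "\<lambda>i j. c * (A i + A j - 1) + (g (f x) (h i i) (h j j) - g (f x) (h i j) (h i j))"
    have "2 * (\<Sum>i=1..N. \<Sum>j\<in>{i<..N}. sectional_curvature (induced_metric g f) x (e i x) (e j x)) =
       2 * (\<Sum>i=1..N. \<Sum>j\<in>{i<..N}. ?F i j)"
      by (intro arg_cong[where f = "(*) 2"] sum.cong refl sec) auto
    also have "\<dots> = (\<Sum>i=1..N. \<Sum>j=1..N. ?F i j) - (\<Sum>i=1..N. ?F i i)"
    proof (rule sum_strict_upper_triangle)
      show "?F i j = ?F j i" for i j
        using g_sym[OF fx, of "h i i" "h j j"] h_sym[of i j] by (simp add: add.commute)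
    qed
    \<comment> \<open>On the diagonal the two products of \<open>h\<close> cancel and only
      \<open>c * (2 * A i - 1)\<close> remains.\<close>
    also have "(\<Sum>i=1..N. ?F i i) = c * (2 * lam - n)"
    proof -
      have "(\<Sum>i=1..N. ?F i i) = (\<Sum>i=1..N. 2 * c * A i - c)"
        by (intro sum.cong refl) (simp add: algebra_simps)
      also have "\<dots> = 2 * c * (\<Sum>i=1..N. A i) - n * c" by (simp only: sum_subtractf sum_distrib_left) (simp add: nN)
      also have "\<dots> = c * (2 * lam - n)" unfolding lamA by (simp add: algebra_simps)
      finally show ?thesis .
    qed
    also have "(\<Sum>i=1..N. \<Sum>j=1..N. ?F i j) = c * (n * lam + n * lam - n * n) + (n\<^sup>2 * g (f x) H H - S)"
    proof -
      have "(\<Sum>i=1..N. \<Sum>j=1..N. g (f x) (h i i) (h j j)) = g (f x) (n *\<^sub>R H) (n *\<^sub>R H)"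
        unfolding nH[symmetric] using fx by (simp add: g_sum_left g_sum_right) (rule sum.swap)
      then have hh: "(\<Sum>i=1..N. \<Sum>j=1..N. g (f x) (h i i) (h j j)) = n\<^sup>2 * g (f x) H H"
        using fx by (simp add: g_simps power2_eq_square)
      have "(\<Sum>i=1..N. \<Sum>j=1..N. c * (A i + A j - 1)) = c * (\<Sum>i=1..N. \<Sum>j=1..N. A i + A j - 1)"
        by (simp only: sum_distrib_left)
      also have "(\<Sum>i=1..N. \<Sum>j=1..N. A i + A j - 1) = (\<Sum>i=1..N. n * A i + (lam - n))"
        by (intro sum.cong refl) (simp only: sum.distrib sum_subtractf lamA, simp add: nN)
      also have "\<dots> = n * lam + n * (lam - n)"
        unfolding sum.distrib sum_distrib_left[symmetric] lamA by (simp add: nN)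
      finally have "(\<Sum>i=1..N. \<Sum>j=1..N. c * (A i + A j - 1)) = c * (n * lam + n * lam - n * n)"
        by (simp add: algebra_simps)
      then show ?thesis by (simp only: sum.distrib sum_subtractf hh S_def)
    qed
    finally have two: "2 * (\<Sum>i=1..N. \<Sum>j\<in>{i<..N}. sectional_curvature (induced_metric g f) x (e i x) (e j x)) =
      c * (n - 1) * (2 * lam - n) + n\<^sup>2 * g (f x) H H - S" by (simp add: algebra_simps)
    have "normalized_scalar_curvature g f e x =
      2 * (\<Sum>i=1..N. \<Sum>j\<in>{i<..N}. sectional_curvature (induced_metric g f) x (e i x) (e j x)) / (n * (n - 1))"
      by (simp add: normalized_scalar_curvature_def n_def N_def)
    then show ?thesis unfolding two .
  qed
  have \<nu>n: "\<nu> r y \<in> normal_space g f y" if "r \<in> {1..m}" "y \<in> W" for r y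
    using \<nu> that by (simp add: orthonormal_normal_frame_def m_def)
  have nc: "normal_curvature g f (e i) (e j) (\<nu> r) (\<nu> s) x =
      (\<Sum>k=1..N. g (f x) (h j k) (\<nu> r x) * g (f x) (h i k) (\<nu> s x) - g (f x) (h i k) (\<nu> r x) * g (f x) (h j k) (\<nu> s x))"
    if "i \<in> {1..N}" "j \<in> {1..N}" "r \<in> {1..m}" "s \<in> {1..m}" for i j r s
  proof -
    have \<nu>_smooth: "smooth_on W (\<nu> r)" using \<nu> that by (simp add: orthonormal_normal_frame_def m_def)
    have opp: "\<beta> (E a) (\<nu> b x) = - \<alpha> (E a) (\<nu> b x)" if "b \<in> {1..m}" for a b
      using g_normal_tangent[OF \<nu>n[OF that x], of "e a x"] g_sym[OF fx, of "\<nu> b x" "E a"]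
      by (simp add: g E_def)
    have "g (f x) (Rm (f x) (E i) (E j) (\<nu> r x)) (\<nu> s x) = 0"
      unfolding R opp[OF that(3)] opp[OF that(4)] by simp
    then show ?thesis
      using that ricci_equation[OF x frame_smooth frame_smooth \<nu>_smooth \<nu>n[OF that(3)], of i j "\<nu> s"] \<nu>n[OF that(4) x]
      by (simp add: N_def E_def h_def)
  qed
  have perp: "normalized_normal_scalar_curvature g f e \<nu> x \<le> (S - n * g (f x) H H) / (n * (n - 1))"
  proof -
    let ?Q = "\<Sum>i=1..N. \<Sum>j\<in>{i<..N}. \<Sum>r=1..m. \<Sum>s\<in>{r<..m}. (normal_curvature g f (e i) (e j) (\<nu> r) (\<nu> s) x)\<^sup>2"
    have "?Q = (\<Sum>i=1..N. \<Sum>j\<in>{i<..N}. \<Sum>r=1..m. \<Sum>s\<in>{r<..m}.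
      (\<Sum>k=1..N. g (f x) (h j k) (\<nu> r x) * g (f x) (h i k) (\<nu> s x) - g (f x) (h i k) (\<nu> r x) * g (f x) (h j k) (\<nu> s x))\<^sup>2)"
      by (intro sum.cong refl arg_cong[where f = "\<lambda>z. z\<^sup>2"] nc) auto
    then have "2 * sqrt ?Q \<le> S - n * g (f x) H H"
      using normal_curvature_sum_bound[OF fx h_sym, of m "\<lambda>r. \<nu> r x" H, folded N_def] \<nu> x H
      by (simp add: orthonormal_normal_frame_def m_def S_def nN)
    then have "2 * sqrt ?Q / (n * (n - 1)) \<le> (S - n * g (f x) H H) / (n * (n - 1))"
      using n by (intro divide_right_mono) auto
    moreover have "normalized_normal_scalar_curvature g f e \<nu> x = 2 * sqrt ?Q / (n * (n - 1))"
      by (simp add: normalized_normal_scalar_curvature_def n_def N_def m_def)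
    ultimately show ?thesis by simp
  qed
  \<comment> \<open>\<open>S\<close> cancels, and \<open>n^2 - n\<close> equals the denominator, so
    the mean curvature term keeps coefficient 1.\<close>
  have "(c * (n - 1) * (2 * lam - n) + n\<^sup>2 * g (f x) H H - S) / (n * (n - 1)) + (S - n * g (f x) H H) / (n * (n - 1))
    = g (f x) H H + 2 * c * lam / n - c"
    using n by (simp add: add_divide_distrib[symmetric] power2_eq_square field_simps)
  then show ?thesis using rho perp by linarith
qed

end

text \<open>The inequality is pointwise, so one chart of \<open>N\<close> and one product chart of
  \<open>M\<close> around the point suffice. In them \<open>pi1\<close> becomes \<open>fst\<close>,
  and \<open>lam\<close> becomes the trace of the first factor metric over the frame.\<close>

theorem proposition4p13:
  fixes M1 :: "('x, 'i, 'p::euclidean_space) riemannian"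
    and M2 :: "('y, 'j, 'q::euclidean_space) riemannian"
    and M :: "('x \<times> 'y, 'i \<times> 'j, 'p \<times> 'q) riemannian"
    and N :: "('z, 'k, 'n::euclidean_space) manifold"
    and F :: "'z \<Rightarrow> 'x \<times> 'y"
    and g :: "'p \<times> 'q \<Rightarrow> 'p \<times> 'q \<Rightarrow> 'p \<times> 'q \<Rightarrow> real"
    and f :: "'n \<Rightarrow> 'p \<times> 'q"
    and pi1 :: "'p \<times> 'q \<Rightarrow> 'p"
    and e :: "nat \<Rightarrow> 'n \<Rightarrow> 'n"
    and \<nu> :: "nat \<Rightarrow> 'n \<Rightarrow> 'p \<times> 'q"
    and W :: "'n set"
    and c p q n lam :: real
    and x :: 'z and i :: 'i and j :: 'j and k :: 'k
    and u :: 'n and H :: "'p \<times> 'q"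
  assumes dims: "p = real DIM('p)" "q = real DIM('q)" "n = real DIM('n)"
    and dim_bounds: "DIM('n) \<ge> 3" "DIM('p) \<ge> 2" "DIM('q) \<ge> 2"
    and "c \<noteq> 0"
    and space_forms: "real_space_form c M1" "real_space_form (- c) M2"
    and product: "M = riemannian_product M1 M2"
    and submanifold: "immersed_submanifold N M F"
    and charts: "k \<in> indices N" "(i, j) \<in> indices M"
      "x \<in> chart_dom N k" "F x \<in> chart_dom M (i, j)"
    and coords: "u = chart_map N k x" "f = local_rep N k M (i, j) F" "g = metric_in M (i, j)"
      "pi1 = local_rep M (i, j) M1 i fst"
    and nbhd: "open W" "u \<in> W" "W \<subseteq> local_dom N k M (i, j) F"
    and frames: "orthonormal_tangent_frame g f W e" "orthonormal_normal_frame g f W \<nu>"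
    and H: "H = mean_curvature_vector g f e u"
    and lam: "lam = (\<Sum>l=1..DIM('n).
        (let w = differential pi1 (f u) (differential f u (e l u))
         in metric_in M1 i (pi1 (f u)) w w))"
  shows "normalized_scalar_curvature g f e u + normalized_normal_scalar_curvature g f e \<nu> u
       \<le> g (f u) H H
         + 2 * c / (n * (p + q - 2)) * ((p - 1) * lam - (q - 1) * (n - lam))
         - c * (p - q) / (p + q - 2)"
proof -
  have ij: "i \<in> indices M1" "j \<in> indices M2"
    using charts(2) by (auto simp: product riemannian_product_def)
  define U1 U2 g1 g2 where "U1 = chart_img M1 i" and "U2 = chart_img M2 j"
    and "g1 = metric_in M1 i" and "g2 = metric_in M2 j"
  interpret product_smooth_metric U1 g1 U2 g2
    unfolding product_smooth_metric_def U1_def U2_def g1_def g2_def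
    using space_forms ij by (auto simp: real_space_form_def intro: riemannian_manifold_smooth_metric)
  have g: "g = product_metric g1 g2"
    by (simp add: coords(3) product metric_in_product g1_def g2_def)
  have img: "chart_img M (i, j) = U1 \<times> U2" by (simp add: product chart_img_product U1_def U2_def)
  have f_in: "f y \<in> U1 \<times> U2" if "y \<in> W" for y
    using local_rep_in_chart_img[of N k y M "(i, j)" F] submanifold charts(1) nbhd(3) that
    by (auto simp: coords(2) immersed_submanifold_def simp flip: img)
  have "smooth_on W f"
    using submanifold charts(1,2) nbhd(3) smooth_on_subset
    unfolding immersed_submanifold_def coords(2) by blast
  then interpret framed_immersion "U1 \<times> U2" "product_metric g1 g2" W f e
    using nbhd(1) f_in frames(1) by unfold_locales (auto simp: g)
  note fu = f_in[OF nbhd(2)]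
  have pi1: "pi1 v = fst v" if "v \<in> U1 \<times> U2" for v
    using local_rep_product_fst[of v M1 M2 i j] that by (simp add: coords(4) img flip: product)
  \<comment> \<open>\<open>pi1\<close> is identified with \<open>fst\<close> on the chart image;
    this is an open neighbourhood of \<open>f u\<close>, which suffices for the derivative.\<close>
  have "differential pi1 (f u) = fst"
  proof -
    have "((\<lambda>v. fst v) has_derivative fst) (at (f u))" by (rule has_derivative_fst[OF has_derivative_ident])
    then have "(pi1 has_derivative fst) (at (f u))"
      by (rule has_derivative_transform_within_open[OF _ U fu]) (simp add: pi1)
    then show ?thesis by (rule frechet_derivative_at[symmetric])
  qed
  then have lam': "lam = (\<Sum>l=1..DIM('n). g1 (fst (f u)) (fst (differential f u (e l u))) (fst (differential f u (e l u))))"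
    by (simp add: lam pi1 fu g1_def Let_def)
  have u12: "fst (f u) \<in> U1" "snd (f u) \<in> U2" using fu by auto
  have "normalized_scalar_curvature g f e u + normalized_normal_scalar_curvature g f e \<nu> u
    \<le> g (f u) H H + 2 * c * lam / n - c"
    unfolding H g lam' dims
  proof (rule normal_scalar_curvature_inequality[OF nbhd(2) _ frames(2)[unfolded g],
      where \<alpha> = "\<lambda>v w. g1 (fst (f u)) (fst v) (fst w)" and \<beta> = "\<lambda>v w. g2 (snd (f u)) (snd v) (snd w)"])
    show "2 \<le> DIM('n)" using dim_bounds by simp
    fix v w z t
    show "product_metric g1 g2 (f u) v w = g1 (fst (f u)) (fst v) (fst w) + g2 (snd (f u)) (snd v) (snd w)"
      by (simp add: product_metric_def)
    show "product_metric g1 g2 (f u) (Rm (f u) v w z) t =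
      c * (g1 (fst (f u)) (fst w) (fst z) * g1 (fst (f u)) (fst v) (fst t)
         - g1 (fst (f u)) (fst v) (fst z) * g1 (fst (f u)) (fst w) (fst t))
      - c * (g2 (snd (f u)) (snd w) (snd z) * g2 (snd (f u)) (snd v) (snd t)
         - g2 (snd (f u)) (snd v) (snd z) * g2 (snd (f u)) (snd w) (snd t))"
      using real_space_form_Rm[OF space_forms(1) ij(1)] real_space_form_Rm[OF space_forms(2) ij(2)] u12
      unfolding Rm_product[OF fu]
      by (simp add: product_metric_def U1_def U2_def g1_def g2_def)
  qed
  also have "\<dots> = g (f u) H H
         + 2 * c / (n * (p + q - 2)) * ((p - 1) * lam - (q - 1) * (n - lam))
         - c * (p - q) / (p + q - 2)"
  proof -
    \<comment> \<open>In terms of \<open>d\<close> the bracket is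
      \<open>d * lam - (q - 1) * n\<close> and \<open>p - q\<close> is
      \<open>d - 2 * (q - 1)\<close>; the two terms with \<open>q - 1\<close> cancel and leave
      \<open>2 * c * lam / n - c\<close>.\<close>
    define d where "d = p + q - 2"
    have pos: "n > 0" "d > 0" using dims dim_bounds by (auto simp: d_def)
    have *: "(p - 1) * lam - (q - 1) * (n - lam) = d * lam - (q - 1) * n" "p - q = d - 2 * (q - 1)"
      by (simp_all add: d_def algebra_simps)
    have "2 * c / (n * d) * (d * lam - (q - 1) * n) = 2 * c * lam / n - 2 * c * (q - 1) / d"
      "c * (d - 2 * (q - 1)) / d = c - 2 * c * (q - 1) / d"
      using pos by (simp_all add: field_simps)
    then show ?thesis unfolding * d_def[symmetric] by simp
  qed
  finally show ?thesis .
qed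

end
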